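(* Let $p$ be a prime and $m,n\ge1$ with $p^m>2$. Let $Q\in\mathcal{LSS}(p^m,p^n,\sigma_Q)$, $G=\mathrm{Dis}(Q)$ and $a\in Q$. Then $Q$ is latin, $Z(G)=\mathrm{Dis}_{\zeta_Q}\cong\mathbb{Z}_p^m$ and $$\Phi(G)=\gamma_1(G)\cong Z(G)\times G_a\cong \mathbb{Z}_p^{m+k}$$ for some integer $k\ge 0$. In particular $n\geq 2$.
   Context: A quandle is a set $Q$ with a binary operation $*$ such that every $L_a:b\mapsto a*b$ is a bijection, $a*(b*c)=(a*b)*(a*c)$ and $a*a=a$. The displacement group is $\mathrm{Dis}(Q)=\langle L_aL_b^{-1}: a,b\in Q\rangle$; $Q$ is connected if $\mathrm{Dis}(Q)$ is transitive on $Q$, latin if all right translations $b\mapsto b*a$ are bijective. Congruences are equivalence relations compatible with $*$ and left division; $0_Q$ is equality, $1_Q=Q\times Q$. $Q$ is subdirectly irreducible if the intersection of all congruences $\neq 0_Q$ is $\ne 0_Q$. A subquandle is proper if it has more than one element and is not all of $Q$; a quandle with more than one element is strictly simple if it has no proper subquandles, and locally strictly simple (LSS) if all its proper subquandles are strictly simple. A quandle is abelian if $\mathrm{Dis}(Q)$ is abelian and acts semiregularly; a finite connected quandle is abelian iff it is isomorphic to $(A,* )$ with $A$ an abelian group, $a*b=a+f(b-a)$, $f\in\mathrm{Aut}(A)$. $\sigma_Q$ is the equivalence relation: $a\,\sigma_Q\,b$ iff $\mathrm{Dis}(Q)_a=\mathrm{Dis}(Q)_b$ (point stabilizers). For primes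 $p,q$, $\mathcal{LSS}(p^m,q^n,\sigma_Q)$ denotes the class of finite connected non-abelian subdirectly irreducible LSS quandles having a unique congruence different from $0_Q,1_Q$, with factor of size $q^n$ and blocks of size $p^m$, and with the given relation $\sigma_Q$ (here $\sigma_Q$ is unrestricted). For a congruence $\alpha$, $\mathrm{Dis}_\alpha=\langle L_aL_b^{-1}: a\,\alpha\,b\rangle$. $\zeta_Q$ is the center of $Q$, the largest central congruence: $a\,\zeta_Q\,b$ iff $L_aL_b^{-1}\in Z(\mathrm{Dis}(Q))$ and $\mathrm{Dis}(Q)_a=\mathrm{Dis}(Q)_b$. For a group $G$: $Z(G)$ is the center, $\Phi(G)$ the Frattini subgroup, $\gamma_1(G)=[G,G]$, and $G_a$ is the stabilizer of $a$. *)

theory Defs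
  imports
    "HOL-Algebra.Group_Action"
    "HOL-Algebra.Generated_Groups"
    "HOL-Algebra.Product_Groups"
    "HOL-Computational_Algebra.Primes"
begin

section \<open>Groups\<close>

definition group_center :: "('g, 'h) monoid_scheme \<Rightarrow> 'g set" where
  "group_center G = {z \<in> carrier G. \<forall>g \<in> carrier G. z \<otimes>\<^bsub>G\<^esub> g = g \<otimes>\<^bsub>G\<^esub> z}"

definition maximal_subgroup :: "'g set \<Rightarrow> ('g, 'h) monoid_scheme \<Rightarrow> bool" where
  "maximal_subgroup M G \<longleftrightarrow> subgroup M G \<and> M \<noteq> carrier G \<and>
     (\<forall>K. subgroup K G \<and> M \<subseteq> K \<longrightarrow> K = M \<or> K = carrier G)"

text \<open>If there is no maximal subgroup, this is the whole group.\<close>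

definition frattini :: "('g, 'h) monoid_scheme \<Rightarrow> 'g set" where
  "frattini G = {x \<in> carrier G. \<forall>M. maximal_subgroup M G \<longrightarrow> x \<in> M}"

text \<open>The group \<open>\<int>\<^sub>p\<^sup>m\<close>, that is, the direct product of \<open>m\<close> copies of \<open>\<int>/p\<int>\<close>.\<close>

definition Zmod_power :: "nat \<Rightarrow> nat \<Rightarrow> (nat \<Rightarrow> int) monoid" where
  "Zmod_power p m = product_group {..<m} (\<lambda>_. integer_mod_group p)"


section \<open>Quandles\<close>

locale quandle =
  fixes Q :: "'a set" and mul :: "'a \<Rightarrow> 'a \<Rightarrow> 'a" (infixl \<open>\<star>\<close> 70)
  assumes left_bij: "a \<in> Q \<Longrightarrow> bij_betw (\<lambda>b. a \<star> b) Q Q"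
    and left_distrib:
      "\<lbrakk>a \<in> Q; b \<in> Q; c \<in> Q\<rbrakk> \<Longrightarrow> a \<star> (b \<star> c) = (a \<star> b) \<star> (a \<star> c)"
    and idem: "a \<in> Q \<Longrightarrow> a \<star> a = a"

text \<open>The element \<open>L\<^sub>a\<close> of the symmetric group \<^const>\<open>BijGroup\<close> on \<open>Q\<close>, whose
  members are extensional functions.\<close>

definition left_mult :: "'a set \<Rightarrow> ('a \<Rightarrow> 'a \<Rightarrow> 'a) \<Rightarrow> 'a \<Rightarrow> ('a \<Rightarrow> 'a)" where
  "left_mult Q mul a = (\<lambda>b\<in>Q. mul a b)"

definition left_div :: "'a set \<Rightarrow> ('a \<Rightarrow> 'a \<Rightarrow> 'a) \<Rightarrow> 'a \<Rightarrow> 'a \<Rightarrow> 'a" where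
  "left_div Q mul a b = inv_into Q (mul a) b"

definition displacement :: "'a set \<Rightarrow> ('a \<Rightarrow> 'a \<Rightarrow> 'a) \<Rightarrow> 'a \<Rightarrow> 'a \<Rightarrow> ('a \<Rightarrow> 'a)" where
  "displacement Q mul a b =
     left_mult Q mul a \<otimes>\<^bsub>BijGroup Q\<^esub> inv\<^bsub>BijGroup Q\<^esub> (left_mult Q mul b)"

definition Dis_rel :: "'a set \<Rightarrow> ('a \<Rightarrow> 'a \<Rightarrow> 'a) \<Rightarrow> ('a \<times> 'a) set \<Rightarrow> ('a \<Rightarrow> 'a) set" where
  "Dis_rel Q mul \<alpha> = generate (BijGroup Q) {displacement Q mul a b | a b. (a, b) \<in> \<alpha>}"

definition Dis :: "'a set \<Rightarrow> ('a \<Rightarrow> 'a \<Rightarrow> 'a) \<Rightarrow> ('a \<Rightarrow> 'a) monoid" where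
  "Dis Q mul = (BijGroup Q)\<lparr>carrier := Dis_rel Q mul (Q \<times> Q)\<rparr>"

text \<open>Elements of \<^term>\<open>Dis Q mul\<close> are themselves permutations of \<open>Q\<close>, so the action is \<^const>\<open>id\<close>.\<close>

definition Dis_stab :: "'a set \<Rightarrow> ('a \<Rightarrow> 'a \<Rightarrow> 'a) \<Rightarrow> 'a \<Rightarrow> ('a \<Rightarrow> 'a) set" where
  "Dis_stab Q mul a = stabilizer (Dis Q mul) id a"

definition connected_quandle :: "'a set \<Rightarrow> ('a \<Rightarrow> 'a \<Rightarrow> 'a) \<Rightarrow> bool" where
  "connected_quandle Q mul \<longleftrightarrow> quandle Q mul \<and> transitive_action (Dis Q mul) Q id"

definition latin_quandle :: "'a set \<Rightarrow> ('a \<Rightarrow> 'a \<Rightarrow> 'a) \<Rightarrow> bool" where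
  "latin_quandle Q mul \<longleftrightarrow> quandle Q mul \<and> (\<forall>a\<in>Q. bij_betw (\<lambda>b. mul b a) Q Q)"

definition abelian_quandle :: "'a set \<Rightarrow> ('a \<Rightarrow> 'a \<Rightarrow> 'a) \<Rightarrow> bool" where
  "abelian_quandle Q mul \<longleftrightarrow> quandle Q mul \<and> comm_group (Dis Q mul) \<and>
     (\<forall>a\<in>Q. Dis_stab Q mul a = {\<one>\<^bsub>Dis Q mul\<^esub>})"


subsection \<open>Congruences\<close>

definition quandle_congruence :: "'a set \<Rightarrow> ('a \<Rightarrow> 'a \<Rightarrow> 'a) \<Rightarrow> ('a \<times> 'a) set \<Rightarrow> bool" where
  "quandle_congruence Q mul \<alpha> \<longleftrightarrow> equiv Q \<alpha> \<and>
     (\<forall>a b c d. (a, b) \<in> \<alpha> \<and> (c, d) \<in> \<alpha> \<longrightarrow>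
        (mul a c, mul b d) \<in> \<alpha> \<and> (left_div Q mul a c, left_div Q mul b d) \<in> \<alpha>)"

text \<open>The intersection is taken inside \<open>Q \<times> Q\<close>, so it is \<open>Q \<times> Q\<close> if there is no congruence other
  than equality.\<close>

definition subdirectly_irreducible :: "'a set \<Rightarrow> ('a \<Rightarrow> 'a \<Rightarrow> 'a) \<Rightarrow> bool" where
  "subdirectly_irreducible Q mul \<longleftrightarrow>
     (Q \<times> Q) \<inter> \<Inter>{\<alpha>. quandle_congruence Q mul \<alpha> \<and> \<alpha> \<noteq> Id_on Q} \<noteq> Id_on Q"

definition sigma_rel :: "'a set \<Rightarrow> ('a \<Rightarrow> 'a \<Rightarrow> 'a) \<Rightarrow> ('a \<times> 'a) set" where
  "sigma_rel Q mul = {(a, b) \<in> Q \<times> Q. Dis_stab Q mul a = Dis_stab Q mul b}"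

definition quandle_center :: "'a set \<Rightarrow> ('a \<Rightarrow> 'a \<Rightarrow> 'a) \<Rightarrow> ('a \<times> 'a) set" where
  "quandle_center Q mul = {(a, b) \<in> Q \<times> Q.
     displacement Q mul a b \<in> group_center (Dis Q mul) \<and>
     Dis_stab Q mul a = Dis_stab Q mul b}"


subsection \<open>Subquandles\<close>

text \<open>Since \<^locale>\<open>quandle\<close> asks for left translations to be bijections of the carrier,
  the subsets below are closed under both multiplication and left division.\<close>

definition proper_subquandle :: "'a set \<Rightarrow> 'a set \<Rightarrow> ('a \<Rightarrow> 'a \<Rightarrow> 'a) \<Rightarrow> bool" where
  "proper_subquandle S Q mul \<longleftrightarrow>
     S \<subseteq> Q \<and> quandle S mul \<and> (\<exists>x\<in>S. \<exists>y\<in>S. x \<noteq> y) \<and> S \<noteq> Q"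

definition strictly_simple :: "'a set \<Rightarrow> ('a \<Rightarrow> 'a \<Rightarrow> 'a) \<Rightarrow> bool" where
  "strictly_simple Q mul \<longleftrightarrow>
     quandle Q mul \<and> (\<exists>x\<in>Q. \<exists>y\<in>Q. x \<noteq> y) \<and> (\<nexists>S. proper_subquandle S Q mul)"

definition locally_strictly_simple :: "'a set \<Rightarrow> ('a \<Rightarrow> 'a \<Rightarrow> 'a) \<Rightarrow> bool" where
  "locally_strictly_simple Q mul \<longleftrightarrow>
     quandle Q mul \<and> (\<forall>S. proper_subquandle S Q mul \<longrightarrow> strictly_simple S mul)"

text \<open>The class \<open>LSS(b, f, \<sigma>)\<close>: \<open>b\<close> is the size of the blocks and \<open>f\<close> the size of the factor of
  the unique congruence \<open>\<alpha>\<close> other than equality and \<open>Q \<times> Q\<close>, and \<open>\<sigma>\<close> prescribes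
  \<^term>\<open>sigma_rel Q mul\<close>.\<close>

definition LSS :: "nat \<Rightarrow> nat \<Rightarrow> ('a \<times> 'a) set \<Rightarrow> 'a set \<Rightarrow> ('a \<Rightarrow> 'a \<Rightarrow> 'a) \<Rightarrow> bool" where
  "LSS b f \<sigma> Q mul \<longleftrightarrow>
     finite Q \<and> connected_quandle Q mul \<and> \<not> abelian_quandle Q mul \<and>
     subdirectly_irreducible Q mul \<and> locally_strictly_simple Q mul \<and>
     (\<exists>\<alpha>. {\<beta>. quandle_congruence Q mul \<beta> \<and> \<beta> \<noteq> Id_on Q \<and> \<beta> \<noteq> Q \<times> Q} = {\<alpha>} \<and>
          card (Q // \<alpha>) = f \<and> (\<forall>B \<in> Q // \<alpha>. card B = b)) \<and>
     sigma_rel Q mul = \<sigma>"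

end

theory Submission
  imports Defs "HOL-Algebra.Sylow" "HOL-Algebra.Multiplicative_Group" "HOL-Algebra.Zassenhaus"
begin

text \<open>
  Let \<open>G\<close> be the displacement group, \<open>\<alpha>\<close> the congruence between equality and the total one,
  \<open>K\<close> the subgroup of \<open>G\<close> fixing every block of \<open>\<alpha>\<close>, and \<open>\<gamma>\<close> the commutator subgroup of \<open>G\<close>.

  The blocks and the factor \<open>Q/\<alpha>\<close> are strictly simple quandles of prime power size whose automorphism
  groups are transitive. In such a quandle the fixed points of an automorphism form a subquandle, so an
  automorphism with two fixed points is trivial: the automorphism group is regular or a Frobenius group.
  As the degree is a power of \<open>p\<close>, the identity and the fixed point free automorphisms form a Sylow
  subgroup (\<open>T_subgroup\<close>), the Frobenius kernel. Its central elements of order dividing \<open>p\<close> sweep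
  out a subquandle, so it is elementary abelian (\<open>central_torsion_eq_T\<close>). Hence \<open>G/K\<close> is
  elementary abelian, and so is the group \<open>N\<close> of those elements of \<open>K\<close> that act on every block through
  the Frobenius kernel of that block.

  The orbits of a subgroup that is normalized by the automorphisms preserving \<open>\<alpha>\<close> form a congruence
  (\<open>orbit_congruence\<close>). So such a subgroup inside \<open>K\<close>, if it is not trivial, is transitive on every block (\<open>transitive_on_blocks\<close>). This is used for \<open>N\<close>, \<open>\<gamma>\<close> and \<open>Z(G)\<close>.

  The equality \<open>K = N\<close> rests on two facts. For \<open>k\<close> in \<open>K\<close> there is \<open>s\<close> in \<open>N\<close> with \<open>k x = s x\<close>, and then
  \<open>k\<close> and \<open>s\<close> conjugate \<open>L\<^sub>x\<close> to the same element; thus \<open>[K, G] \<subseteq> N\<close>. Secondly, conjugation by \<open>L\<^sub>a\<close> fixes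
  the point stabilizer \<open>G\<^sub>a\<close> elementwise but has no nontrivial fixed point on \<open>G/\<gamma>\<close>, because \<open>G\<close> is generated
  by the quotients of elements by their conjugates; thus \<open>G\<^sub>a \<subseteq> \<gamma>\<close> (\<open>stab_derived\<close>). Modulo \<open>N\<close> the
  group \<open>G\<close> has class at most two and central \<open>p\<close>-th powers, so \<open>\<gamma>\<close> has exponent dividing \<open>p\<close> there.
  Consequently \<open>G\<^sub>a\<close> consists of \<open>p\<close>-elements, and a \<open>p\<close>-element of \<open>K\<close> lies in \<open>N\<close>.

  Now \<open>G\<close> is a \<open>p\<close>-group, so its center is not trivial. A transitive center would make \<open>Q\<close> abelian, hence
  the orbits of \<open>Z(G)\<close> are the blocks, on which it acts regularly. This gives the order of \<open>Z(G)\<close>, the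
  decomposition \<open>N = Z(G) \<times> G\<^sub>a\<close>, and \<open>\<gamma> = N\<close> as \<open>\<gamma>\<close> is transitive on blocks and contains \<open>G\<^sub>a\<close>. The
  Frattini subgroup contains \<open>\<gamma>\<close> since \<open>G\<close> is a \<open>p\<close>-group and lies in \<open>N\<close> since \<open>G/N\<close> is elementary
  abelian. Latinity is checked first in the factor and then inside a block, where two elements differ by
  a central element. If \<open>n = 1\<close>, then the Frattini subgroup has index \<open>p\<close>, so \<open>G\<close> is cyclic, which is
  impossible.
\<close>

section \<open>Centers, prime power order and commutators\<close>

lemma (in group) inv_mult_cancel:
  assumes "x \<in> carrier G" "y \<in> carrier G"
  shows "inv x \<otimes> (x \<otimes> y) = y" "x \<otimes> (inv x \<otimes> y) = y"
  using assms by (simp_all flip: m_assoc)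

lemma group_centerI:
  assumes "z \<in> carrier G" "\<And>g. g \<in> carrier G \<Longrightarrow> z \<otimes>\<^bsub>G\<^esub> g = g \<otimes>\<^bsub>G\<^esub> z"
  shows "z \<in> group_center G"
  using assms by (simp only: group_center_def mem_Collect_eq Ball_def) simp

lemma group_centerD:
  assumes "z \<in> group_center G"
  shows "z \<in> carrier G" "g \<in> carrier G \<Longrightarrow> z \<otimes>\<^bsub>G\<^esub> g = g \<otimes>\<^bsub>G\<^esub> z"
  using assms unfolding group_center_def by blast+

lemma (in group) group_center_subgroup: "subgroup (group_center G) G"
proof (rule subgroupI)
  show "group_center G \<subseteq> carrier G" by (auto simp: group_center_def)
  show "group_center G \<noteq> {}" by (auto simp: group_center_def)
next
  fix a assume a: "a \<in> group_center G"
  then have aG: "a \<in> carrier G" by (simp add: group_center_def)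
  have "inv a \<otimes> g = g \<otimes> inv a" if g: "g \<in> carrier G" for g
  proof -
    have "a \<otimes> g = g \<otimes> a" using group_centerD(2)[OF a g] .
    then have "inv a \<otimes> (g \<otimes> a) \<otimes> inv a = inv a \<otimes> (a \<otimes> g) \<otimes> inv a" by simp
    moreover have "inv a \<otimes> (g \<otimes> a) \<otimes> inv a = inv a \<otimes> g" using aG g by (simp add: m_assoc)
    moreover have "inv a \<otimes> (a \<otimes> g) \<otimes> inv a = g \<otimes> inv a" using aG g by (simp flip: m_assoc)
    ultimately show ?thesis by metis
  qed
  then show "inv a \<in> group_center G" by (rule group_centerI[OF inv_closed[OF aG]])
next
  fix a b assume ab: "a \<in> group_center G" "b \<in> group_center G"
  have "a \<otimes> b \<otimes> g = g \<otimes> (a \<otimes> b)" if g: "g \<in> carrier G" for g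
  proof -
    have ca: "a \<in> carrier G" "b \<in> carrier G" using ab[THEN group_centerD(1)] by auto
    have "a \<otimes> b \<otimes> g = a \<otimes> (b \<otimes> g)" using ca g by (simp add: m_assoc)
    also have "\<dots> = (a \<otimes> g) \<otimes> b" using ca g group_centerD(2)[OF ab(2) g] by (simp add: m_assoc)
    also have "\<dots> = g \<otimes> (a \<otimes> b)" using ca g group_centerD(2)[OF ab(1) g] by (simp add: m_assoc)
    finally show ?thesis .
  qed
  moreover have "a \<otimes> b \<in> carrier G" using ab[THEN group_centerD(1)] by simp
  ultimately show "a \<otimes> b \<in> group_center G" by (metis group_centerI)
qed

lemma (in group) prime_dvd_order_imp_element:
  assumes "finite (carrier G)" "prime p" "p dvd order G"
  obtains x where "x \<in> carrier G" "x \<noteq> \<one>" "x [^] p = \<one>"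
proof -
  obtain m where "order G = p ^ 1 * m" using assms by (auto elim: dvdE)
  then obtain H where H: "subgroup H G" "card H = p"
    using sylow_thm[OF assms(2) is_group _ assms(1), of 1 m] by auto
  have "p > 1" using assms(2) prime_gt_1_nat by blast
  then obtain x where x: "x \<in> H" "x \<noteq> \<one>"
  proof -
    have "H \<noteq> {\<one>}" "H \<noteq> {}" using H \<open>p > 1\<close> by auto
    then show ?thesis using that by blast
  qed
  interpret H: group "G\<lparr>carrier := H\<rparr>" using H subgroup_imp_group by blast
  have "x [^]\<^bsub>G\<lparr>carrier := H\<rparr>\<^esub> card H = \<one>"
    using H.pow_order_eq_1[of x] x by (simp add: order_def)
  then have "x [^] p = \<one>" using H by (simp add: nat_pow_consistent[symmetric])
  then show ?thesis using that x H subgroup.mem_carrier by metis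
qed

text \<open>The points that are not fixed split into orbits of size a nontrivial power of \<open>p\<close>.\<close>

lemma (in group_action) p_dvd_card_fixed_points:
  assumes p: "prime p" and G: "order G = p ^ k" and E: "finite E" "p dvd card E"
  shows "p dvd card {x \<in> E. \<forall>g \<in> carrier G. \<phi> g x = x}" (is "p dvd card ?F")
proof -
  let ?C = "{orb \<in> orbits G E \<phi>. card orb \<noteq> 1}"
  have part: "partition E (orbits G E \<phi>)" by (rule orbit_partition)
  have sub: "orb \<subseteq> E" if "orb \<in> orbits G E \<phi>" for orb
    using part that by (auto simp: partition_def)
  have dv: "p dvd card orb" if orb: "orb \<in> ?C" for orb
  proof -
    obtain x where x: "x \<in> E" "orb = orbit G \<phi> x" using orb unfolding orbits_def by blast
    then have "card orb dvd p ^ k" using orbit_stabilizer_theorem[OF x(1)] G by (metis dvd_triv_left)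
    then obtain i where "card orb = p ^ i" using p by (auto simp: divides_primepow_nat)
    moreover have "i \<noteq> 0" using orb calculation by (auto intro: ccontr)
    ultimately show ?thesis by (simp add: dvd_power)
  qed
  have in_orb: "orbit G \<phi> x = {x} \<longleftrightarrow> (\<forall>g \<in> carrier G. \<phi> g x = x)" if "x \<in> E" for x
    using orbit_refl[OF that] by (auto simp: orbit_def)
  have one: "card orb = 1 \<longleftrightarrow> orb = {x}" if "x \<in> orb" for orb :: "'c set" and x
    using that by (metis card_1_singletonE is_singletonI is_singleton_altdef singletonD)
  have eq: "\<Union>?C = E - ?F"
  proof
    show "\<Union>?C \<subseteq> E - ?F"
    proof
      fix x assume "x \<in> \<Union>?C"
      then obtain orb where o: "orb \<in> orbits G E \<phi>" "card orb \<noteq> 1" "x \<in> orb" by auto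
      then have xE: "x \<in> E" using sub by blast
      have "orbit G \<phi> x \<in> orbits G E \<phi>" using xE by (auto simp: orbits_def)
      then have "orb = orbit G \<phi> x" using disjoint_union[OF o(1)] o(3) orbit_refl[OF xE] by blast
      then show "x \<in> E - ?F" using o one in_orb xE by auto
    qed
    show "E - ?F \<subseteq> \<Union>?C"
    proof
      fix x assume x: "x \<in> E - ?F"
      then have "orbit G \<phi> x \<in> orbits G E \<phi>" by (auto simp: orbits_def)
      moreover have "card (orbit G \<phi> x) \<noteq> 1" using one[OF orbit_refl] in_orb x by auto
      ultimately show "x \<in> \<Union>?C" using orbit_refl x by blast
    qed
  qed
  have "p dvd card (\<Union>?C)"
  proof (rule dvd_partition)
    show "finite (\<Union>?C)" unfolding eq using E by simp
    show "\<forall>c\<in>?C. p dvd card c" using dv by blast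
    show "\<forall>c1\<in>?C. \<forall>c2\<in>?C. c1 \<noteq> c2 \<longrightarrow> c1 \<inter> c2 = {}" using disjoint_union by blast
  qed
  moreover have "card E = card (\<Union>?C) + card ?F"
    unfolding eq using E(1) card_mono[of E ?F] card_Diff_subset[of ?F E] by simp
  ultimately show ?thesis using E(2) dvd_add_right_iff[of p "card (\<Union>?C)" "card ?F"] by simp
qed

text \<open>The center is the set of fixed points of conjugation, and it is not empty.\<close>

lemma (in group) p_group_center_nontrivial:
  assumes p: "prime p" and G: "order G = p ^ k" and k: "k \<ge> 1"
  shows "\<exists>z \<in> group_center G. z \<noteq> \<one>"
proof -
  let ?\<phi> = "\<lambda>g. \<lambda>h \<in> carrier G. g \<otimes> h \<otimes> inv g"
  have act: "group_action G (carrier G) ?\<phi>" by (rule action_by_conjugation)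
  have fin: "finite (carrier G)" using G p k by (metis card.infinite order_def power_not_zero not_prime_0)
  have eq: "{x \<in> carrier G. \<forall>g \<in> carrier G. ?\<phi> g x = x} = group_center G"
  proof -
    have "(?\<phi> g x = x) = (x \<otimes> g = g \<otimes> x)" if "x \<in> carrier G" "g \<in> carrier G" for x g
      using that inv_solve_right'[of "x" "g \<otimes> x" g] by auto
    then show ?thesis unfolding group_center_def by (intro Collect_cong conj_cong refl ball_cong) auto
  qed
  have "p dvd card (carrier G)" using k G by (simp add: order_def dvd_power)
  then have "p dvd card (group_center G)"
    using group_action.p_dvd_card_fixed_points[OF act p G fin] unfolding eq by simp
  moreover have "\<one> \<in> group_center G" using group_center_subgroup subgroup.one_closed by blast
  ultimately have "group_center G \<noteq> {\<one>}" "group_center G \<noteq> {}" using p by auto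
  then show ?thesis by auto
qed

lemma prime_power_if_unique_prime_divisor:
  fixes n p :: nat
  assumes "n > 0" "prime p" "\<And>q. prime q \<Longrightarrow> q dvd n \<Longrightarrow> q = p"
  shows "\<exists>k. n = p ^ k"
proof -
  obtain m where m: "n = p ^ multiplicity p n * m" "\<not> p dvd m"
    using assms by (metis multiplicity_decompose' not_prime_unit not_gr_zero)
  have "m = 1"
  proof (rule ccontr)
    assume "m \<noteq> 1"
    then obtain q where "prime q" "q dvd m" using prime_factor_nat by blast
    then show False using assms(3)[of q] m by (metis dvd_mult)
  qed
  then show ?thesis using m by auto
qed

lemma (in group) order_prime_power_if_exponent:
  assumes fin: "finite (carrier G)" and p: "prime p"
    and exp: "\<And>x. x \<in> carrier G \<Longrightarrow> x [^] (p ^ j) = \<one>"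
  shows "\<exists>k. order G = p ^ k"
proof (rule prime_power_if_unique_prime_divisor)
  show "order G > 0" using fin order_gt_0_iff_finite by blast
  show "prime p" by fact
  fix q :: nat assume q: "prime q" "q dvd order G"
  then obtain x where x: "x \<in> carrier G" "x \<noteq> \<one>" "x [^] q = \<one>"
    using prime_dvd_order_imp_element fin by blast
  then have "ord x dvd q" "ord x dvd p ^ j" using pow_eq_id exp by auto
  moreover have "ord x \<noteq> 1" using x ord_eq_1 by blast
  ultimately show "q = p" using q p by (metis prime_nat_iff prime_dvd_power primes_dvd_imp_eq)
qed

lemma (in group) pow_prime_powers_coprime:
  assumes "x \<in> carrier G" "x [^] (m::nat) = \<one>" "x [^] (n::nat) = \<one>" "coprime m n"
  shows "x = \<one>"
proof -
  have "ord x dvd m" "ord x dvd n" using assms pow_eq_id by auto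
  then have "ord x = 1" using assms(4) by (meson coprime_def nat_dvd_1_iff_1)
  then show ?thesis using assms(1) ord_eq_1 by blast
qed

lemma (in group) commutator_power:
  assumes x: "x \<in> carrier G" and y: "y \<in> carrier G" and c: "c \<in> carrier G"
    and xy: "x \<otimes> y = c \<otimes> y \<otimes> x" and cx: "x \<otimes> c = c \<otimes> x"
  shows "x [^] (n::nat) \<otimes> y = c [^] n \<otimes> y \<otimes> x [^] n"
proof (induction n)
  case 0 then show ?case using y by simp
next
  case (Suc n)
  have cn: "x [^] n \<otimes> c = c \<otimes> x [^] n" using group_commutes_pow[OF _ x c] cx by metis
  have "x [^] Suc n \<otimes> y = x [^] n \<otimes> (x \<otimes> y)" using x y by (simp add: m_assoc)
  also have "\<dots> = (x [^] n \<otimes> c) \<otimes> y \<otimes> x" using x y c by (simp add: m_assoc xy)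
  also have "\<dots> = c \<otimes> (x [^] n \<otimes> y) \<otimes> x" using x y c by (simp add: m_assoc cn)
  also have "\<dots> = (c \<otimes> c [^] n) \<otimes> y \<otimes> (x [^] n \<otimes> x)" using x y c by (simp add: m_assoc Suc)
  also have "\<dots> = c [^] Suc n \<otimes> y \<otimes> x [^] Suc n" using x y c
    by (metis nat_pow_Suc nat_pow_Suc2)
  finally show ?case .
qed

text \<open>If commutators and \<open>p\<close>-th powers become central under \<open>h\<close>, then \<open>[x,y]\<^sup>p\<close> and \<open>[x\<^sup>p,y]\<close> have the same
  image, which is trivial; products of central elements of exponent \<open>p\<close> again have exponent \<open>p\<close>.\<close>

lemma (in group_hom) image_of_derived_exponent:
  fixes p :: nat
  assumes class2: "\<And>x y. \<lbrakk>x \<in> carrier G; y \<in> carrier G\<rbrakk> \<Longrightarrow>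
       h (x \<otimes> y \<otimes> inv x \<otimes> inv y) \<in> group_center H"
    and powers: "\<And>x. x \<in> carrier G \<Longrightarrow> h (x [^] p) \<in> group_center H"
    and d: "d \<in> derived G (carrier G)"
  shows "h d [^]\<^bsub>H\<^esub> p = \<one>\<^bsub>H\<^esub>"
proof -
  let ?S = "{g \<in> carrier G. h g \<in> group_center H \<and> h g [^]\<^bsub>H\<^esub> p = \<one>\<^bsub>H\<^esub>}"
  have Hc: "subgroup (group_center H) H" by (rule H.group_center_subgroup)
  have S: "subgroup ?S G"
  proof (rule G.subgroupI)
    show "?S \<subseteq> carrier G" by auto
    have "\<one> \<in> ?S" using subgroup.one_closed[OF Hc] by simp
    then show "?S \<noteq> {}" by blast
  next
    fix a assume a: "a \<in> ?S"
    then show "inv a \<in> ?S" using subgroup.m_inv_closed[OF Hc, of "h a"] by (simp add: H.nat_pow_inv)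
  next
    fix a b assume ab: "a \<in> ?S" "b \<in> ?S"
    then have car: "h a \<in> carrier H" "h b \<in> carrier H" by auto
    have "h a \<otimes>\<^bsub>H\<^esub> h b = h b \<otimes>\<^bsub>H\<^esub> h a" using ab car group_centerD(2)[of "h a" H "h b"] by blast
    then have "(h a \<otimes>\<^bsub>H\<^esub> h b) [^]\<^bsub>H\<^esub> p = h a [^]\<^bsub>H\<^esub> p \<otimes>\<^bsub>H\<^esub> h b [^]\<^bsub>H\<^esub> p"
      using car by (rule H.pow_mult_distrib)
    then show "a \<otimes> b \<in> ?S" using ab subgroup.m_closed[OF Hc, of "h a" "h b"] by simp
  qed
  have "derived_set G (carrier G) \<subseteq> ?S"
  proof
    fix c assume "c \<in> derived_set G (carrier G)"
    then obtain x y where xy: "x \<in> carrier G" "y \<in> carrier G" "c = x \<otimes> y \<otimes> inv x \<otimes> inv y" by auto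
    then have c: "c \<in> carrier G" by simp
    have cc: "h c \<in> group_center H" using class2 xy by simp
    have xp: "h (x [^] p) \<in> group_center H" using powers xy by simp
    have car: "h x \<in> carrier H" "h y \<in> carrier H" "h c \<in> carrier H" using xy(1,2) c by auto
    have "x \<otimes> y = c \<otimes> y \<otimes> x" using xy by (simp add: G.m_assoc)
    then have "h x \<otimes>\<^bsub>H\<^esub> h y = h c \<otimes>\<^bsub>H\<^esub> h y \<otimes>\<^bsub>H\<^esub> h x"
      using xy(1,2) c by (metis hom_mult G.m_closed)
    then have "h x [^]\<^bsub>H\<^esub> p \<otimes>\<^bsub>H\<^esub> h y = h c [^]\<^bsub>H\<^esub> p \<otimes>\<^bsub>H\<^esub> h y \<otimes>\<^bsub>H\<^esub> h x [^]\<^bsub>H\<^esub> p"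
      by (rule H.commutator_power[OF car]) (rule group_centerD(2)[OF cc car(1), symmetric])
    moreover have "h x [^]\<^bsub>H\<^esub> p \<otimes>\<^bsub>H\<^esub> h y = h y \<otimes>\<^bsub>H\<^esub> h x [^]\<^bsub>H\<^esub> p"
      using group_centerD(2)[OF xp car(2)] hom_nat_pow[OF xy(1)] by simp
    ultimately have "h y \<otimes>\<^bsub>H\<^esub> h x [^]\<^bsub>H\<^esub> p = h c [^]\<^bsub>H\<^esub> p \<otimes>\<^bsub>H\<^esub> (h y \<otimes>\<^bsub>H\<^esub> h x [^]\<^bsub>H\<^esub> p)"
      using car by (simp add: H.m_assoc)
    then have "h c [^]\<^bsub>H\<^esub> p = \<one>\<^bsub>H\<^esub>" using car by (simp add: H.r_cancel_one')
    then show "c \<in> ?S" using c cc by simp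
  qed
  then have "d \<in> ?S" using d S G.generate_subgroup_incl unfolding derived_def by blast
  then show ?thesis by simp
qed

text \<open>On the abelianization, \<open>g \<mapsto> g f(g)\<inverse>\<close> is an endomorphism, and by hypothesis it is onto. As the
  abelianization is finite, it is injective, so a fixed point of \<open>f\<close> is trivial there.\<close>

lemma (in group) fixed_points_in_derived:
  assumes fin: "finite (carrier G)" and f: "f \<in> hom G G"
    and gen: "generate G {g \<otimes> inv (f g) | g. g \<in> carrier G} = carrier G"
    and c: "c \<in> carrier G" "f c = c"
  shows "c \<in> derived G (carrier G)"
proof -
  let ?D = "derived G (carrier G)"
  have D: "?D \<lhd> G" by (rule derived_is_normal[OF normal_self])
  interpret D: normal ?D G by fact
  interpret f: group_hom G G f by unfold_locales (rule f)
  let ?H = "G Mod ?D"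
  interpret H: comm_group ?H by (rule derived_quot_is_comm_group)
  interpret \<pi>: group_hom G ?H "\<lambda>a. ?D #> a"
    by (simp add: group_hom_def group_hom_axioms_def D.factorgroup_is_group D.r_coset_hom_Mod)
  define \<psi> where "\<psi> = (\<lambda>g. ?D #> (g \<otimes> inv (f g)))"
  have \<psi>: "\<psi> \<in> hom G ?H"
  proof (rule homI)
    fix x assume "x \<in> carrier G"
    then show "\<psi> x \<in> carrier ?H" unfolding \<psi>_def by (intro \<pi>.hom_closed) simp
  next
    fix x y assume xy: "x \<in> carrier G" "y \<in> carrier G"
    define X Y X' Y' where "X = ?D #> x" "Y = ?D #> y" "X' = ?D #> inv (f x)" "Y' = ?D #> inv (f y)"
    have car: "X \<in> carrier ?H" "Y \<in> carrier ?H" "X' \<in> carrier ?H" "Y' \<in> carrier ?H"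
      using xy by (auto simp: X_Y_X'_Y'_def)
    have "\<psi> (x \<otimes> y) = (X \<otimes>\<^bsub>?H\<^esub> Y) \<otimes>\<^bsub>?H\<^esub> (Y' \<otimes>\<^bsub>?H\<^esub> X')"
      using xy by (simp only: \<psi>_def X_Y_X'_Y'_def f.hom_mult inv_mult_group \<pi>.hom_mult m_closed inv_closed f.hom_closed)
    also have "\<dots> = (X \<otimes>\<^bsub>?H\<^esub> X') \<otimes>\<^bsub>?H\<^esub> (Y \<otimes>\<^bsub>?H\<^esub> Y')" using car by (simp only: H.m_ac H.m_closed)
    also have "\<dots> = \<psi> x \<otimes>\<^bsub>?H\<^esub> \<psi> y"
      using xy by (simp only: \<psi>_def X_Y_X'_Y'_def \<pi>.hom_mult m_closed inv_closed f.hom_closed)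
    finally show "\<psi> (x \<otimes> y) = \<psi> x \<otimes>\<^bsub>?H\<^esub> \<psi> y" .
  qed
  interpret \<psi>: group_hom G ?H \<psi> by unfold_locales (rule \<psi>)
  have surj: "\<psi> ` carrier G = carrier ?H"
  proof
    show "\<psi> ` carrier G \<subseteq> carrier ?H" by auto
    let ?P = "{g \<in> carrier G. ?D #> g \<in> \<psi> ` carrier G}"
    have im: "subgroup (\<psi> ` carrier G) ?H" by (rule \<psi>.img_is_subgroup)
    have sP: "subgroup ?P G"
    proof (rule subgroupI)
      show "?P \<subseteq> carrier G" by blast
      have "\<one> \<in> ?P" using subgroup.one_closed[OF im] by (simp only: \<pi>.hom_one mem_Collect_eq one_closed)
      then show "?P \<noteq> {}" by blast
    next
      fix a assume "a \<in> ?P"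
      then show "inv a \<in> ?P"
        using subgroup.m_inv_closed[OF im, of "?D #> a"] by (simp only: mem_Collect_eq inv_closed \<pi>.hom_inv)
    next
      fix a b assume "a \<in> ?P" "b \<in> ?P"
      then show "a \<otimes> b \<in> ?P"
        using subgroup.m_closed[OF im, of "?D #> a" "?D #> b"]
        by (simp only: mem_Collect_eq m_closed \<pi>.hom_mult)
    qed
    have incl: "{g \<otimes> inv (f g) | g. g \<in> carrier G} \<subseteq> ?P"
    proof
      fix z assume "z \<in> {g \<otimes> inv (f g) | g. g \<in> carrier G}"
      then obtain g where g: "g \<in> carrier G" "z = g \<otimes> inv (f g)" by blast
      then have "z \<in> carrier G" by simp
      moreover have "?D #> z = \<psi> g" by (simp add: \<psi>_def g)
      ultimately show "z \<in> ?P" using imageI[OF g(1), of \<psi>] by (metis (mono_tags, lifting) mem_Collect_eq)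
    qed
    have P: "carrier G \<subseteq> ?P"
      using generate_subgroup_incl[OF incl sP] unfolding gen .
    show "carrier ?H \<subseteq> \<psi> ` carrier G"
    proof
      fix X assume "X \<in> carrier ?H"
      then obtain g where g: "g \<in> carrier G" "X = ?D #> g"
        by (auto simp: FactGroup_def RCOSETS_def)
      have "g \<in> ?P" by (rule subsetD[OF P g(1)])
      then show "X \<in> \<psi> ` carrier G" unfolding g(2) mem_Collect_eq by (elim conjE)
    qed
  qed
  \<comment> \<open>The kernel has the same order as the derived subgroup, which it contains.\<close>
  let ?K = "kernel G ?H \<psi>"
  have K: "subgroup ?K G" by (rule \<psi>.subgroup_kernel)
  have "(G Mod ?K) \<cong> ?H" using \<psi>.FactGroup_iso[OF surj] by simp
  then have "card (rcosets ?K) = card (rcosets ?D)" using iso_same_card by (fastforce simp: FactGroup_def)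
  moreover have "card ?K * card (rcosets ?K) = order G" "card ?D * card (rcosets ?D) = order G"
    using lagrange K D.is_subgroup by (auto simp: mult.commute)
  moreover have "order G > 0" using fin order_gt_0_iff_finite by blast
  ultimately have cardeq: "card ?K = card ?D" by (metis mult_cancel2 nat_neq_iff mult_0_right)
  have one: "\<one>\<^bsub>?H\<^esub> = ?D" by (simp add: FactGroup_def)
  have fD: "f x \<in> ?D" if "x \<in> ?D" for x
  proof -
    have "f x \<in> derived G (f ` carrier G)" using f.derived_img[of "carrier G"] that by auto
    moreover have "f ` carrier G \<subseteq> carrier G" using f.hom_closed by blast
    ultimately show ?thesis using mono_derived[of "f ` carrier G" "carrier G"] by blast
  qed
  have "?D \<subseteq> ?K"
  proof
    fix x assume x: "x \<in> ?D"
    then have "x \<otimes> inv (f x) \<in> ?D" using fD D.m_inv_closed D.m_closed by blast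
    then show "x \<in> ?K" using x by (simp add: kernel_def \<psi>_def one D.rcos_const)
  qed
  then have "?D = ?K" using cardeq fin K by (metis card_subset_eq finite_subset subgroup.subset)
  moreover have "c \<in> ?K" using c by (simp add: kernel_def \<psi>_def one coset_mult_one D.subset)
  ultimately show ?thesis by blast
qed

lemma (in group) subgroup_coprime_powers:
  assumes S: "subgroup S G" and x: "x \<in> carrier G"
    and i: "x [^] (i::int) \<in> S" and j: "x [^] (j::int) \<in> S" and "coprime i j"
  shows "x \<in> S"
proof -
  obtain u v where "u * i + v * j = gcd i j" using bezout_int by blast
  then have uv: "i * u + j * v = 1" using assms(5) by (simp add: mult.commute)
  have "(x [^] i) [^] u \<otimes> (x [^] j) [^] v \<in> S"
    using subgroup_int_pow_closed[OF S i, of u] subgroup_int_pow_closed[OF S j, of v] subgroup.m_closed[OF S] by blast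
  then show ?thesis using x uv by (simp add: int_pow_pow flip: int_pow_mult)
qed

section \<open>Maximal subgroups of finite p-groups\<close>

lemma group_actionI:
  fixes G (structure)
  assumes G: "group G"
    and ext: "\<And>g. g \<in> carrier G \<Longrightarrow> \<phi> g \<in> extensional E"
    and clo: "\<And>g x. g \<in> carrier G \<Longrightarrow> x \<in> E \<Longrightarrow> \<phi> g x \<in> E"
    and one: "\<And>x. x \<in> E \<Longrightarrow> \<phi> \<one>\<^bsub>G\<^esub> x = x"
    and mult: "\<And>g h x. g \<in> carrier G \<Longrightarrow> h \<in> carrier G \<Longrightarrow> x \<in> E \<Longrightarrow> \<phi> (g \<otimes>\<^bsub>G\<^esub> h) x = \<phi> g (\<phi> h x)"
  shows "group_action G E \<phi>"
proof -
  interpret group G by fact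
  have bij: "\<phi> g \<in> Bij E" if g: "g \<in> carrier G" for g
  proof -
    have inv: "\<phi> (inv g) (\<phi> g x) = x" "\<phi> g (\<phi> (inv g) x) = x" if "x \<in> E" for x
      using mult[of "inv g" g x] mult[of g "inv g" x] g that one by auto
    have "bij_betw (\<phi> g) E E"
      by (rule bij_betw_byWitness[where f' = "\<phi> (inv g)"]) (use inv clo g in auto)
    then show ?thesis using ext g by (simp add: Bij_def)
  qed
  have "\<phi> \<in> hom G (BijGroup E)"
  proof (rule homI)
    fix g h assume gh: "g \<in> carrier G" "h \<in> carrier G"
    show "\<phi> (g \<otimes> h) = \<phi> g \<otimes>\<^bsub>BijGroup E\<^esub> \<phi> h"
    proof
      fix x show "\<phi> (g \<otimes> h) x = (\<phi> g \<otimes>\<^bsub>BijGroup E\<^esub> \<phi> h) x"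
        using gh bij mult ext[of "g \<otimes> h"] by (cases "x \<in> E") (auto simp: BijGroup_def compose_def extensional_def)
    qed
  qed (simp add: BijGroup_def bij)
  then show ?thesis
    by (simp add: group_action_def group_hom_def group_hom_axioms_def group_BijGroup is_group)
qed

lemma (in group) conjugate_subset_imp_inverse_conjugate:
  assumes M: "subgroup M G" "finite M" and x: "x \<in> carrier G"
    and sub: "\<And>m. m \<in> M \<Longrightarrow> x \<otimes> m \<otimes> inv x \<in> M" and m: "m \<in> M"
  shows "inv x \<otimes> m \<otimes> x \<in> M"
proof -
  have mc: "m \<in> carrier G" if "m \<in> M" for m using M(1) that subgroup.mem_carrier by metis
  let ?f = "\<lambda>m. x \<otimes> m \<otimes> inv x"
  have "inj_on ?f M" using mc x by (auto intro!: inj_onI)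
  moreover have "?f ` M \<subseteq> M" using sub by blast
  ultimately have "?f ` M = M" using M(2) by (simp add: endo_inj_surj)
  then obtain m' where m': "m' \<in> M" "m = ?f m'" using m by blast
  have "inv x \<otimes> m \<otimes> x = m'" unfolding m'(2) using mc[OF m'(1)] x
    by (metis conjugation_is_surj inv_closed inv_inv)
  then show ?thesis using m'(1) by simp
qed

text \<open>Normalizers grow in a \<open>p\<close>-group: the proper subgroup \<open>M\<close> acts on its cosets, fixes the coset \<open>M\<close>, and
  hence fixes another one.\<close>

lemma (in group) proper_subgroup_of_p_group_normalized_outside:
  assumes p: "prime p" and G: "order G = p ^ k" and M: "subgroup M G" "M \<noteq> carrier G"
  shows "\<exists>g \<in> carrier G - M. \<forall>m \<in> M. g \<otimes> m \<otimes> inv g \<in> M"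
proof -
  have fin: "finite (carrier G)" using G p by (metis card.infinite order_def power_not_zero not_prime_0)
  have mc: "m \<in> carrier G" if "m \<in> M" for m using M(1) that subgroup.mem_carrier by metis
  have MG: "M \<subseteq> carrier G" using mc by blast
  let ?E = "rcosets M"
  \<comment> \<open>The inverse turns right multiplication of right cosets into a left action.\<close>
  let ?\<phi> = "\<lambda>m. \<lambda>C \<in> ?E. C #> inv m"
  have EC: "C \<subseteq> carrier G" if "C \<in> ?E" for C using that rcosets_subset_PowG[OF M(1)] by auto
  have grpM: "group (G\<lparr>carrier := M\<rparr>)" using M(1) subgroup_imp_group by blast
  have clo: "C #> inv m \<in> ?E" if C: "C \<in> ?E" and m: "m \<in> M" for C m
  proof -
    obtain g where g: "g \<in> carrier G" "C = M #> g" using C by (auto simp: RCOSETS_def)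
    then have "C #> inv m = M #> (g \<otimes> inv m)" using mc m MG by (simp add: coset_mult_assoc)
    then show ?thesis using g mc m rcosetsI[OF MG, of "g \<otimes> inv m"] by simp
  qed
  have act: "group_action (G\<lparr>carrier := M\<rparr>) ?E ?\<phi>"
  proof (rule group_actionI[OF grpM])
    fix g h C assume a: "g \<in> carrier (G\<lparr>carrier := M\<rparr>)" "h \<in> carrier (G\<lparr>carrier := M\<rparr>)" "C \<in> ?E"
    then have "C #> inv h #> inv g = C #> (inv h \<otimes> inv g)" using EC mc by (simp add: coset_mult_assoc)
    then show "?\<phi> (g \<otimes>\<^bsub>G\<lparr>carrier := M\<rparr>\<^esub> h) C = ?\<phi> g (?\<phi> h C)"
      using a clo mc by (simp add: inv_mult_group)
  qed (use clo EC in \<open>auto simp: coset_mult_one\<close>)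
  have "card M * card ?E = p ^ k" using lagrange[OF M(1)] G by (simp add: mult.commute)
  moreover have "card M \<noteq> p ^ k"
    using M fin MG G card_subset_eq[OF fin MG] by (auto simp: order_def)
  ultimately obtain i j where ij: "card M = p ^ i" "card ?E = p ^ j" "j \<noteq> 0"
    using p by (metis divides_primepow_nat dvd_triv_left dvd_triv_right mult.right_neutral power_0)
  have oM: "order (G\<lparr>carrier := M\<rparr>) = p ^ i" using ij by (simp add: order_def)
  let ?F = "{C \<in> ?E. \<forall>m \<in> M. C #> inv m = C}"
  have finE: "finite ?E" using fin rcosets_subset_PowG[OF M(1)] by (meson finite_Pow_iff finite_subset)
  have "p dvd card {C \<in> ?E. \<forall>m \<in> carrier (G\<lparr>carrier := M\<rparr>). ?\<phi> m C = C}"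
    using group_action.p_dvd_card_fixed_points[OF act p oM finE] ij by (simp add: dvd_power)
  moreover have "{C \<in> ?E. \<forall>m \<in> carrier (G\<lparr>carrier := M\<rparr>). ?\<phi> m C = C} = ?F" by auto
  ultimately have pF: "p dvd card ?F" by simp
  have "M \<in> ?E" using rcosetsI[OF MG one_closed] coset_mult_one[OF MG] by simp
  moreover have "M #> inv m = M" if "m \<in> M" for m
    using that M(1) mc coset_join2[of "inv m" M] subgroup.m_inv_closed[OF M(1)] by simp
  ultimately have "M \<in> ?F" by simp
  moreover have "?F \<noteq> {M}" using pF p by auto
  ultimately obtain C where C: "C \<in> ?F" "C \<noteq> M" by auto
  then obtain g where g: "g \<in> carrier G" "C = M #> g" by (auto simp: RCOSETS_def)
  have "g \<notin> M" using g C(2) M(1) coset_join2 by blast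
  moreover have "g \<otimes> m \<otimes> inv g \<in> M" if m: "m \<in> M" for m
  proof -
    have "C #> inv (inv m) = C" using C(1) M(1) m subgroup.m_inv_closed by fastforce
    then have "M #> (g \<otimes> m) = M #> g" using g m mc MG by (simp add: coset_mult_assoc)
    then have "M #> (g \<otimes> m \<otimes> inv g) = M"
      using g m mc MG by (metis coset_mult_assoc coset_mult_one inv_closed m_closed r_inv)
    then show ?thesis using coset_join1[OF _ _ M(1)] g m mc by simp
  qed
  ultimately show ?thesis using g(1) by blast
qed

lemma (in group_hom) centralizer_of_image_subgroup:
  assumes "y \<in> carrier H"
  shows "subgroup {g \<in> carrier G. h g \<otimes>\<^bsub>H\<^esub> y = y \<otimes>\<^bsub>H\<^esub> h g} G"
proof (rule G.subgroupI)
  show "{g \<in> carrier G. h g \<otimes>\<^bsub>H\<^esub> y = y \<otimes>\<^bsub>H\<^esub> h g} \<noteq> {}" using assms by (auto intro!: exI[of _ \<one>])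
next
  fix a assume a: "a \<in> {g \<in> carrier G. h g \<otimes>\<^bsub>H\<^esub> y = y \<otimes>\<^bsub>H\<^esub> h g}"
  then have ay: "h a \<otimes>\<^bsub>H\<^esub> y = y \<otimes>\<^bsub>H\<^esub> h a" and car: "h a \<in> carrier H" "a \<in> carrier G" by auto
  have "inv\<^bsub>H\<^esub> h a \<otimes>\<^bsub>H\<^esub> y = inv\<^bsub>H\<^esub> h a \<otimes>\<^bsub>H\<^esub> (y \<otimes>\<^bsub>H\<^esub> h a) \<otimes>\<^bsub>H\<^esub> inv\<^bsub>H\<^esub> h a"
    using car assms by (simp add: H.m_assoc)
  also have "\<dots> = inv\<^bsub>H\<^esub> h a \<otimes>\<^bsub>H\<^esub> (h a \<otimes>\<^bsub>H\<^esub> y) \<otimes>\<^bsub>H\<^esub> inv\<^bsub>H\<^esub> h a" using ay by simp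
  also have "\<dots> = y \<otimes>\<^bsub>H\<^esub> inv\<^bsub>H\<^esub> h a" using car assms by (simp flip: H.m_assoc)
  finally show "inv a \<in> {g \<in> carrier G. h g \<otimes>\<^bsub>H\<^esub> y = y \<otimes>\<^bsub>H\<^esub> h g}" using car by simp
next
  fix a b assume ab: "a \<in> {g \<in> carrier G. h g \<otimes>\<^bsub>H\<^esub> y = y \<otimes>\<^bsub>H\<^esub> h g}" "b \<in> {g \<in> carrier G. h g \<otimes>\<^bsub>H\<^esub> y = y \<otimes>\<^bsub>H\<^esub> h g}"
  then have ay: "h a \<otimes>\<^bsub>H\<^esub> y = y \<otimes>\<^bsub>H\<^esub> h a" "h b \<otimes>\<^bsub>H\<^esub> y = y \<otimes>\<^bsub>H\<^esub> h b"
    and car: "h a \<in> carrier H" "a \<in> carrier G" "h b \<in> carrier H" "b \<in> carrier G" by auto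
  have "h a \<otimes>\<^bsub>H\<^esub> h b \<otimes>\<^bsub>H\<^esub> y = (h a \<otimes>\<^bsub>H\<^esub> y) \<otimes>\<^bsub>H\<^esub> h b" using car assms by (simp add: H.m_assoc ay(2))
  also have "\<dots> = y \<otimes>\<^bsub>H\<^esub> (h a \<otimes>\<^bsub>H\<^esub> h b)" using car assms by (simp add: ay(1) H.m_assoc)
  finally show "a \<otimes> b \<in> {g \<in> carrier G. h g \<otimes>\<^bsub>H\<^esub> y = y \<otimes>\<^bsub>H\<^esub> h g}" using car by simp
qed auto

text \<open>A maximal subgroup \<open>M\<close> is normalized by an element \<open>x\<close> outside \<open>M\<close>, hence is normal. The
  quotient is commutative: any subgroup containing \<open>M\<close> and \<open>x\<close> is the whole group, so everything
  commutes with \<open>x\<close> modulo \<open>M\<close>, and then with everything.\<close>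

lemma (in group) derived_subset_maximal_subgroup_of_p_group:
  assumes p: "prime p" and G: "order G = p ^ k" and max: "maximal_subgroup M G"
  shows "derived G (carrier G) \<subseteq> M"
proof -
  have fin: "finite (carrier G)" using G p by (metis card.infinite order_def power_not_zero not_prime_0)
  have M: "subgroup M G" "M \<noteq> carrier G" and all: "\<And>K. subgroup K G \<Longrightarrow> M \<subseteq> K \<Longrightarrow> K = M \<or> K = carrier G"
    using max unfolding maximal_subgroup_def by auto
  have finM: "finite M" using M(1) fin by (metis finite_subset subgroup.subset)
  have mc: "m \<in> carrier G" if "m \<in> M" for m using M(1) that subgroup.mem_carrier by metis
  obtain x where x: "x \<in> carrier G" "x \<notin> M" "\<And>m. m \<in> M \<Longrightarrow> x \<otimes> m \<otimes> inv x \<in> M"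
    using proper_subgroup_of_p_group_normalized_outside[OF p G M] by blast
  define T where "T = {g \<in> carrier G. \<forall>m \<in> M. g \<otimes> m \<otimes> inv g \<in> M}"
  have T: "subgroup T G"
  proof (rule subgroupI)
    show "T \<noteq> {}" using x unfolding T_def by blast
  next
    fix a assume a: "a \<in> T"
    then show "inv a \<in> T"
      using conjugate_subset_imp_inverse_conjugate[OF M(1) finM, of a] unfolding T_def by simp
  next
    fix a b assume ab: "a \<in> T" "b \<in> T"
    then have "a \<otimes> b \<otimes> m \<otimes> inv (a \<otimes> b) = a \<otimes> (b \<otimes> m \<otimes> inv b) \<otimes> inv a" if "m \<in> M" for m
      using that mc unfolding T_def by (simp add: inv_mult_group m_assoc)
    then show "a \<otimes> b \<in> T" using ab unfolding T_def by simp
  qed (auto simp: T_def)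
  have "M \<subseteq> T" using M(1) mc unfolding T_def by (auto intro: subgroup.m_closed subgroup.m_inv_closed)
  moreover have "x \<in> T" using x unfolding T_def by blast
  ultimately have TG: "T = carrier G" using all[OF T] x by blast
  have N: "M \<lhd> G" unfolding normal_inv_iff using M(1) TG unfolding T_def by blast
  interpret M: normal M G by fact
  let ?H = "G Mod M"
  interpret H: group ?H by (rule M.factorgroup_is_group)
  interpret \<pi>: group_hom G ?H "\<lambda>a. M #> a"
    by (simp add: group_hom_def group_hom_axioms_def M.factorgroup_is_group M.r_coset_hom_Mod)
  have centralized: "\<forall>g \<in> carrier G. (M #> g) \<otimes>\<^bsub>?H\<^esub> Y = Y \<otimes>\<^bsub>?H\<^esub> (M #> g)"
    if Y: "Y \<in> carrier ?H" and xY: "(M #> x) \<otimes>\<^bsub>?H\<^esub> Y = Y \<otimes>\<^bsub>?H\<^esub> (M #> x)" for Y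
  proof -
    let ?S = "{g \<in> carrier G. (M #> g) \<otimes>\<^bsub>?H\<^esub> Y = Y \<otimes>\<^bsub>?H\<^esub> (M #> g)}"
    have S: "subgroup ?S G" by (rule \<pi>.centralizer_of_image_subgroup[OF Y])
    have "M \<subseteq> ?S"
    proof
      fix m assume m: "m \<in> M"
      then have "M #> m = \<one>\<^bsub>?H\<^esub>" by (simp add: FactGroup_def M.rcos_const)
      then have "(M #> m) \<otimes>\<^bsub>?H\<^esub> Y = Y \<otimes>\<^bsub>?H\<^esub> (M #> m)" by (simp only: H.l_one[OF Y] H.r_one[OF Y])
      then show "m \<in> ?S" using mc[OF m] by (simp only: mem_Collect_eq)
    qed
    moreover have "x \<in> ?S" using x(1) xY by (simp only: mem_Collect_eq)
    ultimately have eq: "?S = carrier G" using all[OF S] x(2) by metis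
    show ?thesis
    proof
      fix g assume "g \<in> carrier G"
      then have "g \<in> ?S" by (rule subsetD[OF equalityD2[OF eq]])
      then show "(M #> g) \<otimes>\<^bsub>?H\<^esub> Y = Y \<otimes>\<^bsub>?H\<^esub> (M #> g)" unfolding mem_Collect_eq by (elim conjE)
    qed
  qed
  have xcent: "\<forall>g \<in> carrier G. (M #> g) \<otimes>\<^bsub>?H\<^esub> (M #> x) = (M #> x) \<otimes>\<^bsub>?H\<^esub> (M #> g)"
    by (rule centralized[OF \<pi>.hom_closed[OF x(1)] refl])
  have "comm_group ?H"
  proof (rule H.group_comm_groupI)
    fix X Y assume XY: "X \<in> carrier ?H" "Y \<in> carrier ?H"
    obtain g where g: "g \<in> carrier G" "X = M #> g" using XY by (auto simp: FactGroup_def RCOSETS_def)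
    obtain h where h: "h \<in> carrier G" "Y = M #> h" using XY by (auto simp: FactGroup_def RCOSETS_def)
    have "(M #> x) \<otimes>\<^bsub>?H\<^esub> Y = Y \<otimes>\<^bsub>?H\<^esub> (M #> x)" unfolding h(2) by (rule bspec[OF xcent h(1), symmetric])
    from bspec[OF centralized[OF XY(2) this] g(1)] show "X \<otimes>\<^bsub>?H\<^esub> Y = Y \<otimes>\<^bsub>?H\<^esub> X" unfolding g(2) .
  qed
  then show ?thesis by (rule derived_minimal[OF N])
qed

lemma (in group) normal_if_contains_derived:
  assumes M: "subgroup M G" and D: "derived G (carrier G) \<subseteq> M"
  shows "M \<lhd> G"
  unfolding normal_inv_iff
proof (intro conjI ballI)
  fix x h assume x: "x \<in> carrier G" and h: "h \<in> M"
  have hc: "h \<in> carrier G" using M h subgroup.mem_carrier by metis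
  have "x \<otimes> h \<otimes> inv x \<otimes> inv h \<in> derived_set G (carrier G)" using x hc by auto
  then have "x \<otimes> h \<otimes> inv x \<otimes> inv h \<in> M" using D unfolding derived_def by (auto intro: generate.incl)
  then have "x \<otimes> h \<otimes> inv x \<otimes> inv h \<otimes> h \<in> M" using h M subgroup.m_closed by metis
  then show "x \<otimes> h \<otimes> inv x \<in> M" using x hc by (simp add: m_assoc)
qed (rule M)

text \<open>For \<open>x\<close> outside \<open>N\<close>, a subgroup \<open>M\<close> that is maximal among those containing \<open>N\<close> but not \<open>x\<close> is a
  maximal subgroup: adjoining any \<open>y\<close> outside \<open>M\<close> produces \<open>x = m y\<^sup>i\<close> with \<open>i\<close> prime to \<open>p\<close>, so a
  subgroup that contains \<open>M\<close> and \<open>x\<close> also contains \<open>y\<close>.\<close>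

lemma (in group) frattini_subset_if_elementary_abelian_quotient:
  fixes p :: nat
  assumes fin: "finite (carrier G)" and p: "prime p" and N: "subgroup N G"
    and D: "derived G (carrier G) \<subseteq> N" and pow: "\<And>x. x \<in> carrier G \<Longrightarrow> x [^] p \<in> N"
  shows "frattini G \<subseteq> N"
proof (rule ccontr)
  assume "\<not> frattini G \<subseteq> N"
  then obtain x where x: "x \<in> frattini G" "x \<notin> N" by blast
  then have xc: "x \<in> carrier G" by (simp add: frattini_def)
  let ?\<M> = "{M. subgroup M G \<and> N \<subseteq> M \<and> x \<notin> M}"
  have "?\<M> \<subseteq> Pow (carrier G)" by (auto dest: subgroup.subset)
  then have "finite ?\<M>" using fin by (meson finite_Pow_iff finite_subset)
  then obtain M where M: "M \<in> ?\<M>" and Mmax: "\<And>L. L \<in> ?\<M> \<Longrightarrow> M \<subseteq> L \<Longrightarrow> M = L"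
    using finite_has_maximal2[of ?\<M> N] N x by auto
  then have sM: "subgroup M G" and NM: "N \<subseteq> M" and xM: "x \<notin> M" by auto
  have normM: "M \<lhd> G" using normal_if_contains_derived[OF sM] D NM by blast
  have "maximal_subgroup M G" unfolding maximal_subgroup_def
  proof (intro conjI allI impI)
    show "subgroup M G" by fact
    show "M \<noteq> carrier G" using xM xc by blast
  next
    fix K assume K: "subgroup K G \<and> M \<subseteq> K"
    show "K = M \<or> K = carrier G"
    proof (cases "K = M")
      case KM: False
      then have xK: "x \<in> K" using Mmax[of K] K NM by blast
      have "K = carrier G"
      proof
        show "K \<subseteq> carrier G" using K subgroup.subset by blast
        show "carrier G \<subseteq> K"
        proof
          fix y assume y: "y \<in> carrier G"
          show "y \<in> K"
          proof (cases "y \<in> M")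
            case False
            let ?L = "M <#> generate G {y}"
            have gy: "subgroup (generate G {y}) G" using y generate_is_subgroup by simp
            have sL: "subgroup ?L G" by (rule mult_norm_subgroup[OF normM gy])
            have subML: "M \<subseteq> ?L"
            proof
              fix m assume m: "m \<in> M"
              then have "m \<otimes> \<one> \<in> ?L" using subgroup.one_closed[OF gy] unfolding set_mult_def by blast
              then show "m \<in> ?L" using m sM subgroup.mem_carrier by (metis r_one)
            qed
            have "\<one> \<otimes> y \<in> ?L"
              using subgroup.one_closed[OF sM] generate.incl[of y "{y}" G] unfolding set_mult_def by blast
            then have "y \<in> ?L" using y by simp
            then have "?L \<noteq> M" using False by blast
            then have "x \<in> ?L" using Mmax[of ?L] sL subML NM by blast
            then obtain m i where mi: "m \<in> M" "x = m \<otimes> y [^] (i::int)"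
              unfolding set_mult_def generate_pow[OF y] by blast
            have mc: "m \<in> carrier G" using mi sM subgroup.mem_carrier by metis
            have yp: "y [^] (int p) \<in> M" using pow[OF y] NM by (auto simp: int_pow_int)
            have cop: "coprime i (int p)"
            proof (rule ccontr)
              assume "\<not> coprime i (int p)"
              then have "int p dvd i"
                using p prime_imp_coprime[of "int p" i] by (auto simp: coprime_commute)
              then obtain t where "i = int p * t" by blast
              then have "y [^] i = (y [^] int p) [^] t" using y by (simp add: int_pow_pow)
              then have "y [^] i \<in> M" using subgroup_int_pow_closed[OF sM yp] by simp
              then show False using xM subgroup.m_closed[OF sM mi(1), of "y [^] i"] unfolding mi(2) by simp
            qed
            have "inv m \<otimes> x = y [^] i" unfolding mi(2) using mc y by (simp flip: m_assoc)
            moreover have "inv m \<in> K" using mi(1) conjunct2[OF K] subgroup.m_inv_closed[OF conjunct1[OF K]] by blast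
            ultimately have "y [^] i \<in> K" using subgroup.m_closed[OF conjunct1[OF K], of "inv m" x] xK by simp
            moreover have "y [^] int p \<in> K" using yp conjunct2[OF K] by blast
            ultimately show ?thesis by (rule subgroup_coprime_powers[OF conjunct1[OF K] y _ _ cop])
          qed (use K in blast)
        qed
      qed
      then show ?thesis ..
    qed blast
  qed
  then show False using x xM unfolding frattini_def by blast
qed

section \<open>Elementary abelian groups\<close>

lemma order_Zmod_power:
  assumes "p > 0"
  shows "order (Zmod_power p m) = p ^ m"
  using assms by (simp add: order_def Zmod_power_def card_PiE carrier_integer_mod_group)

text \<open>The new coordinate is sent to a power of \<open>x\<close>. Injectivity holds because a nontrivial power of \<open>x\<close> in
  the old image would put \<open>x\<close> itself there, the exponent being invertible modulo \<open>p\<close>.\<close>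

lemma (in comm_group) extend_Zmod_power_embedding:
  assumes p: "prime p" and pow: "\<And>x. x \<in> carrier G \<Longrightarrow> x [^] p = \<one>"
    and h: "h \<in> mon (Zmod_power p k) G" and x: "x \<in> carrier G" "x \<notin> h ` carrier (Zmod_power p k)"
  shows "(\<lambda>c. h (restrict c {..<k}) \<otimes> x [^] (c k)) \<in> mon (Zmod_power p (Suc k)) G"
proof -
  let ?Z = "Zmod_power p k" and ?Z' = "Zmod_power p (Suc k)"
  have p0: "p > 0" using p prime_gt_0_nat by blast
  have carZ: "c \<in> carrier (Zmod_power p j) \<longleftrightarrow> c \<in> extensional {..<j} \<and> (\<forall>i<j. 0 \<le> c i \<and> c i < int p)" for c j
    using p0 by (auto simp: Zmod_power_def carrier_integer_mod_group PiE_iff Pi_iff)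
  have multZ: "c \<otimes>\<^bsub>Zmod_power p j\<^esub> d = (\<lambda>i\<in>{..<j}. (c i + d i) mod int p)" for c d j
    by (simp add: Zmod_power_def)
  interpret Z: group ?Z by (simp add: Zmod_power_def)
  interpret Z': group ?Z' by (simp add: Zmod_power_def)
  interpret h: group_hom ?Z G h using h by unfold_locales (simp add: mon_def)
  have inj: "inj_on h (carrier ?Z)" using h by (simp add: mon_def)
  have res: "restrict c {..<k} \<in> carrier ?Z" "0 \<le> c k" "c k < int p" if "c \<in> carrier ?Z'" for c
    using that by (auto simp: carZ)
  have powmod: "x [^] (z mod int p) = x [^] z" for z :: int
  proof -
    have "x [^] z = x [^] (int p * (z div int p) + z mod int p)" by simp
    also have "\<dots> = (x [^] int p) [^] (z div int p) \<otimes> x [^] (z mod int p)"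
      using x(1) by (simp only: int_pow_mult int_pow_pow)
    also have "\<dots> = x [^] (z mod int p)" using pow[OF x(1)] x(1) by (simp add: int_pow_int)
    finally show ?thesis by simp
  qed
  let ?h = "\<lambda>c. h (restrict c {..<k}) \<otimes> x [^] (c k)"
  have hom: "?h \<in> hom ?Z' G"
  proof (rule homI)
    fix c assume "c \<in> carrier ?Z'" then show "?h c \<in> carrier G" using res x(1) by simp
  next
    fix c d assume cd: "c \<in> carrier ?Z'" "d \<in> carrier ?Z'"
    have "restrict (c \<otimes>\<^bsub>?Z'\<^esub> d) {..<k} = restrict c {..<k} \<otimes>\<^bsub>?Z\<^esub> restrict d {..<k}"
      by (auto simp: multZ fun_eq_iff)
    moreover have "(c \<otimes>\<^bsub>?Z'\<^esub> d) k = (c k + d k) mod int p" by (simp add: multZ)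
    ultimately have "?h (c \<otimes>\<^bsub>?Z'\<^esub> d) = h (restrict c {..<k}) \<otimes> h (restrict d {..<k}) \<otimes> (x [^] c k \<otimes> x [^] d k)"
      using res cd x(1) by (simp add: powmod int_pow_mult)
    also have "\<dots> = ?h c \<otimes> ?h d" using res cd x(1) by (simp add: m_ac)
    finally show "?h (c \<otimes>\<^bsub>?Z'\<^esub> d) = ?h c \<otimes> ?h d" .
  qed
  then interpret h': group_hom ?Z' G ?h by unfold_locales
  have "inj_on ?h (carrier ?Z')"
  proof (rule h'.inj_iff_trivial_ker[THEN iffD2])
    have "c = \<one>\<^bsub>?Z'\<^esub>" if c: "c \<in> carrier ?Z'" "?h c = \<one>" for c
    proof -
      have hc: "h (restrict c {..<k}) \<in> carrier G" using res c by simp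
      have "x [^] c k \<otimes> h (restrict c {..<k}) = \<one>" using c(2) m_comm[OF hc, of "x [^] c k"] x(1) by simp
      then have "inv (h (restrict c {..<k})) = x [^] c k" using hc x(1) by (simp add: inv_equality)
      then have "x [^] c k = h (inv\<^bsub>?Z\<^esub> (restrict c {..<k}))" using h.hom_inv[OF res(1)[OF c(1)]] by metis
      then have xk: "x [^] c k \<in> h ` carrier ?Z" using res(1)[OF c(1)] Z.inv_closed by blast
      have ck: "c k = 0"
      proof (rule ccontr)
        assume "c k \<noteq> 0"
        then have "\<not> int p dvd c k" using res(2,3)[OF c(1)] zdvd_not_zless by force
        then have "coprime (c k) (int p)"
          using p prime_imp_coprime[of "int p" "c k"] by (auto simp: coprime_commute)
        moreover have "x [^] int p \<in> h ` carrier ?Z"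
          using pow[OF x(1)] h.hom_one Z.one_closed by (metis imageI int_pow_int)
        ultimately show False
          using subgroup_coprime_powers[OF h.img_is_subgroup x(1) xk] x(2) by blast
      qed
      then have "h (restrict c {..<k}) = h \<one>\<^bsub>?Z\<^esub>" using c(2) hc by simp
      then have r: "restrict c {..<k} = \<one>\<^bsub>?Z\<^esub>" by (rule inj_onD[OF inj _ res(1)[OF c(1)] Z.one_closed])
      have "c i = 0" if "i < Suc k" for i
        using fun_cong[OF r, of i] ck that by (cases "i = k") (auto simp: Zmod_power_def)
      then show ?thesis using c(1) by (auto simp: Zmod_power_def fun_eq_iff PiE_iff extensional_def)
    qed
    then show "kernel ?Z' G ?h = {\<one>\<^bsub>?Z'\<^esub>}" using h'.hom_one by (auto simp: kernel_def)
  qed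
  then show ?thesis using hom by (simp add: mon_def)
qed

text \<open>An embedding of the largest possible rank is onto, since otherwise it extends.\<close>

lemma (in comm_group) elementary_abelian_iso_Zmod_power:
  assumes fin: "finite (carrier G)" and p: "prime p"
    and pow: "\<And>x. x \<in> carrier G \<Longrightarrow> x [^] p = \<one>"
  shows "\<exists>k. order G = p ^ k \<and> G \<cong> Zmod_power p k"
proof -
  have p1: "p > 1" using p prime_gt_1_nat by blast
  let ?P = "\<lambda>k. \<exists>h. h \<in> mon (Zmod_power p k) G"
  have bound: "k \<le> order G" if Pk: "?P k" for k
  proof -
    obtain h where h: "h \<in> hom (Zmod_power p k) G" "inj_on h (carrier (Zmod_power p k))"
      using Pk by (auto simp: mon_def)
    have "p ^ k \<le> order G"
      using card_inj_on_le[OF h(2) hom_carrier[OF h(1)] fin] p1 order_Zmod_power[of p k] by (simp add: order_def)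
    moreover have "k < p ^ k" using p1 by (simp add: power_gt_expt)
    ultimately show ?thesis by linarith
  qed
  have "(\<lambda>_. \<one>) \<in> mon (Zmod_power p 0) G" by (auto simp: mon_def hom_def Zmod_power_def)
  then have P0: "?P 0" by blast
  define k where "k = (GREATEST k. ?P k)"
  have "?P k" unfolding k_def by (rule GreatestI_nat[of ?P, OF P0]) (rule bound)
  moreover have "j \<le> k" if "?P j" for j unfolding k_def by (rule Greatest_le_nat[of ?P, OF that]) (rule bound)
  ultimately have k: "?P k" "\<And>j. ?P j \<Longrightarrow> j \<le> k" .
  then obtain h where h: "h \<in> mon (Zmod_power p k) G" by blast
  have "carrier G \<subseteq> h ` carrier (Zmod_power p k)"
  proof (rule ccontr)
    assume "\<not> ?thesis"
    then obtain x where "x \<in> carrier G" "x \<notin> h ` carrier (Zmod_power p k)" by blast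
    then have "?P (Suc k)" using extend_Zmod_power_embedding[OF p pow h] by blast
    then show False using k(2) by fastforce
  qed
  then have "h \<in> iso (Zmod_power p k) G"
    using h by (auto simp: mon_def iso_def bij_betw_def dest: hom_in_carrier)
  then have iso: "Zmod_power p k \<cong> G" by (rule is_isoI)
  then have "order G = p ^ k" using iso_same_card[OF iso] order_Zmod_power[of p k] p1 by (simp add: order_def)
  moreover have "G \<cong> Zmod_power p k"
    by (rule group.iso_sym[OF _ iso]) (simp add: Zmod_power_def)
  ultimately show ?thesis by blast
qed

section \<open>Permutation groups and quandle automorphisms\<close>

lemma Bij_mult_apply:
  assumes "f \<in> Bij S" "g \<in> Bij S" "x \<in> S"
  shows "(f \<otimes>\<^bsub>BijGroup S\<^esub> g) x = f (g x)"
  using assms by (simp add: BijGroup_def compose_def)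

lemma Bij_mem: "f \<in> Bij S \<Longrightarrow> x \<in> S \<Longrightarrow> f x \<in> S"
  using Bij_imp_funcset by blast

lemma Bij_one_apply: "x \<in> S \<Longrightarrow> \<one>\<^bsub>BijGroup S\<^esub> x = x"
  by (simp add: BijGroup_def)

lemma carrier_BijGroup: "carrier (BijGroup S) = Bij S"
  by (simp add: BijGroup_def)

lemma Bij_inv_closed: "f \<in> Bij S \<Longrightarrow> inv\<^bsub>BijGroup S\<^esub> f \<in> Bij S"
  using group.inv_closed[OF group_BijGroup] by (metis carrier_BijGroup)

lemma Bij_inv_apply:
  assumes f: "f \<in> Bij S" and x: "x \<in> S"
  shows "(inv\<^bsub>BijGroup S\<^esub> f) (f x) = x" "f ((inv\<^bsub>BijGroup S\<^esub> f) x) = x"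
proof -
  interpret group "BijGroup S" by (rule group_BijGroup)
  have c: "f \<in> carrier (BijGroup S)" using f by (simp add: carrier_BijGroup)
  show "(inv\<^bsub>BijGroup S\<^esub> f) (f x) = x"
    using Bij_mult_apply[OF Bij_inv_closed[OF f] f x] l_inv[OF c] x by (simp add: Bij_one_apply)
  show "f ((inv\<^bsub>BijGroup S\<^esub> f) x) = x"
    using Bij_mult_apply[OF f Bij_inv_closed[OF f] x] r_inv[OF c] x by (simp add: Bij_one_apply)
qed

lemma Bij_inv_mem: "f \<in> Bij S \<Longrightarrow> x \<in> S \<Longrightarrow> (inv\<^bsub>BijGroup S\<^esub> f) x \<in> S"
  by (rule Bij_mem[OF Bij_inv_closed])

lemma Bij_eqI:
  assumes "f \<in> Bij S" "g \<in> Bij S" "\<And>x. x \<in> S \<Longrightarrow> f x = g x"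
  shows "f = g"
  using assms by (auto intro: extensionalityI dest: Bij_imp_extensional)

lemma finite_Bij: "finite S \<Longrightarrow> finite (Bij S)"
  using Bij_imp_extensional Bij_mem by (intro finite_subset[OF _ finite_PiE[of S "\<lambda>_. S"]]) (auto simp: PiE_def)

lemma permutation_group_action:
  assumes "subgroup H (BijGroup S)"
  shows "group_action (BijGroup S\<lparr>carrier := H\<rparr>) S id"
proof (rule group_actionI)
  show "group (BijGroup S\<lparr>carrier := H\<rparr>)"
    by (rule group.subgroup_imp_group[OF group_BijGroup assms])
  have H: "g \<in> Bij S" if "g \<in> H" for g
    using subgroup.mem_carrier[OF assms that] by (simp add: carrier_BijGroup)
  fix g h x
  assume a: "g \<in> carrier (BijGroup S\<lparr>carrier := H\<rparr>)"
  then show "id g \<in> extensional S" using H Bij_imp_extensional by auto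
  assume "x \<in> S"
  then show "id g x \<in> S" using a H by (auto intro: Bij_mem)
  assume "h \<in> carrier (BijGroup S\<lparr>carrier := H\<rparr>)"
  with a \<open>x \<in> S\<close> show "id (g \<otimes>\<^bsub>BijGroup S\<lparr>carrier := H\<rparr>\<^esub> h) x = id g (id h x)"
    using H by (auto simp: Bij_mult_apply)
qed (simp add: Bij_one_apply)

definition quandle_aut :: "'a set \<Rightarrow> ('a \<Rightarrow> 'a \<Rightarrow> 'a) \<Rightarrow> ('a \<Rightarrow> 'a) set" where
  "quandle_aut Q mul = {g \<in> Bij Q. \<forall>x\<in>Q. \<forall>y\<in>Q. g (mul x y) = mul (g x) (g y)}"

context quandle
begin

abbreviation "B \<equiv> BijGroup Q"
abbreviation "L a \<equiv> left_mult Q mul a"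

lemma mul_closed: "a \<in> Q \<Longrightarrow> b \<in> Q \<Longrightarrow> a \<star> b \<in> Q"
  using left_bij bij_betwE by blast

lemma L_Bij: "a \<in> Q \<Longrightarrow> L a \<in> Bij Q"
  using left_bij[of a] by (auto simp: Bij_def left_mult_def)

lemma L_apply: "b \<in> Q \<Longrightarrow> L a b = a \<star> b"
  by (simp add: left_mult_def)

lemma L_aut: "a \<in> Q \<Longrightarrow> L a \<in> quandle_aut Q mul"
  unfolding quandle_aut_def by (simp add: L_Bij L_apply mul_closed) (metis left_distrib)

lemma aut_Bij: "g \<in> quandle_aut Q mul \<Longrightarrow> g \<in> Bij Q"
  by (simp add: quandle_aut_def)

lemma aut_mul: "g \<in> quandle_aut Q mul \<Longrightarrow> x \<in> Q \<Longrightarrow> y \<in> Q \<Longrightarrow> g (x \<star> y) = g x \<star> g y"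
  by (simp add: quandle_aut_def)

lemma aut_subgroup: "subgroup (quandle_aut Q mul) B"
proof -
  interpret B: group B by (rule group_BijGroup)
  show ?thesis
  proof (rule B.subgroupI)
    show "quandle_aut Q mul \<subseteq> carrier B" by (auto simp: carrier_BijGroup aut_Bij)
    have "\<one>\<^bsub>B\<^esub> \<in> quandle_aut Q mul"
      using B.one_closed by (simp add: quandle_aut_def Bij_one_apply mul_closed carrier_BijGroup)
    then show "quandle_aut Q mul \<noteq> {}" by blast
  next
    fix g assume g: "g \<in> quandle_aut Q mul"
    have gB: "g \<in> Bij Q" by (rule aut_Bij[OF g])
    have "(inv\<^bsub>B\<^esub> g) (x \<star> y) = (inv\<^bsub>B\<^esub> g) x \<star> (inv\<^bsub>B\<^esub> g) y" if xy: "x \<in> Q" "y \<in> Q" for x y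
    proof -
      let ?x = "(inv\<^bsub>B\<^esub> g) x" and ?y = "(inv\<^bsub>B\<^esub> g) y"
      have Q: "?x \<in> Q" "?y \<in> Q" using Bij_inv_mem[OF gB] xy by auto
      have "g (?x \<star> ?y) = x \<star> y" using aut_mul[OF g Q] Bij_inv_apply(2)[OF gB] xy by simp
      then show ?thesis using Bij_inv_apply(1)[OF gB mul_closed[OF Q]] by simp
    qed
    then show "inv\<^bsub>B\<^esub> g \<in> quandle_aut Q mul"
      using B.inv_closed gB by (simp add: quandle_aut_def carrier_BijGroup)
  next
    fix g h assume gh: "g \<in> quandle_aut Q mul" "h \<in> quandle_aut Q mul"
    then have "g \<otimes>\<^bsub>B\<^esub> h \<in> Bij Q" using B.m_closed aut_Bij by (simp add: carrier_BijGroup)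
    then show "g \<otimes>\<^bsub>B\<^esub> h \<in> quandle_aut Q mul"
      using gh aut_Bij[OF gh(1)] aut_Bij[OF gh(2)]
      by (simp add: quandle_aut_def Bij_mult_apply mul_closed Bij_mem)
  qed
qed

text \<open>The automorphism property of \<open>g\<close>, written as an identity between permutations.\<close>

lemma conj_L:
  assumes g: "g \<in> quandle_aut Q mul" and a: "a \<in> Q"
  shows "g \<otimes>\<^bsub>B\<^esub> L a \<otimes>\<^bsub>B\<^esub> inv\<^bsub>B\<^esub> g = L (g a)"
proof -
  interpret B: group B by (rule group_BijGroup)
  have gB: "g \<in> Bij Q" by (rule aut_Bij[OF g])
  have ga: "g a \<in> Q" by (rule Bij_mem[OF gB a])
  have c: "g \<in> carrier B" "L a \<in> carrier B" "L (g a) \<in> carrier B"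
    using gB a L_Bij ga by (auto simp: carrier_BijGroup)
  have "g \<otimes>\<^bsub>B\<^esub> L a = L (g a) \<otimes>\<^bsub>B\<^esub> g"
  proof (rule Bij_eqI)
    show "g \<otimes>\<^bsub>B\<^esub> L a \<in> Bij Q" "L (g a) \<otimes>\<^bsub>B\<^esub> g \<in> Bij Q"
      using c B.m_closed by (simp_all add: carrier_BijGroup)
    fix x assume "x \<in> Q"
    then show "(g \<otimes>\<^bsub>B\<^esub> L a) x = (L (g a) \<otimes>\<^bsub>B\<^esub> g) x"
      using gB a ga by (simp add: Bij_mult_apply L_Bij L_apply aut_mul[OF g] Bij_mem)
  qed
  then show ?thesis using c by (simp add: B.m_assoc)
qed

text \<open>By finiteness, an injective left translation of \<open>S\<close> into itself is onto.\<close>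

lemma subquandleI:
  assumes fin: "finite Q" and S: "S \<subseteq> Q" and clo: "\<And>x y. x \<in> S \<Longrightarrow> y \<in> S \<Longrightarrow> x \<star> y \<in> S"
  shows "quandle S mul"
proof
  fix a assume a: "a \<in> S"
  have "inj_on ((\<star>) a) S" using left_bij[of a] a S by (meson bij_betw_def inj_on_subset subsetD)
  moreover have "(\<star>) a ` S \<subseteq> S" using clo a by blast
  ultimately show "bij_betw ((\<star>) a) S S"
    using endo_inj_surj[of S "(\<star>) a"] finite_subset[OF S fin] by (simp add: bij_betw_def)
next
  fix a b c assume "a \<in> S" "b \<in> S" "c \<in> S"
  then show "a \<star> (b \<star> c) = a \<star> b \<star> (a \<star> c)" using S by (intro left_distrib) auto
qed (use S idem in auto)

end

section \<open>Strictly simple quandles of prime power size\<close>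

locale strictly_simple_p_quandle = quandle E mul for E :: "'a set" and mul (infixl \<open>\<star>\<close> 70) +
  fixes p k :: nat
  assumes finite_E: "finite E" and simple: "strictly_simple E mul"
    and prime_p: "prime p" and card_E: "card E = p ^ k" and k_pos: "k \<ge> 1"
    and homogeneous: "\<And>x y. x \<in> E \<Longrightarrow> y \<in> E \<Longrightarrow> \<exists>g \<in> quandle_aut E mul. g x = y"
begin

abbreviation "A \<equiv> quandle_aut E mul"

sublocale B: group B by (rule group_BijGroup)

lemma closed_subset_eq:
  assumes "S \<subseteq> E" "\<And>x y. x \<in> S \<Longrightarrow> y \<in> S \<Longrightarrow> x \<star> y \<in> S" "a \<in> S" "b \<in> S" "a \<noteq> b"
  shows "S = E"
  using simple subquandleI[OF finite_E assms(1,2)] assms(1,3-5)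
  unfolding strictly_simple_def proper_subquandle_def by blast

lemma automorphism_fixing_two_points:
  assumes g: "g \<in> A" and "x \<in> E" "y \<in> E" "x \<noteq> y" "g x = x" "g y = y"
  shows "g = \<one>\<^bsub>B\<^esub>"
proof (rule Bij_eqI[OF aut_Bij[OF g]])
  have "{z \<in> E. g z = z} = E"
    by (rule closed_subset_eq[of _ x y]) (use assms aut_mul[OF g] mul_closed in auto)
  then show "g z = \<one>\<^bsub>B\<^esub> z" if "z \<in> E" for z using that by (auto simp: Bij_one_apply)
  show "\<one>\<^bsub>B\<^esub> \<in> Bij E" using B.one_closed by (simp add: carrier_BijGroup)
qed

definition stab :: "'a \<Rightarrow> ('a \<Rightarrow> 'a) set" where "stab x = {g \<in> A. g x = x}"

text \<open>The Frobenius kernel of the automorphism group.\<close>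

definition T :: "('a \<Rightarrow> 'a) set" where "T = {g \<in> A. g = \<one>\<^bsub>B\<^esub> \<or> (\<forall>x\<in>E. g x \<noteq> x)}"

lemma action: "group_action (B\<lparr>carrier := A\<rparr>) E id"
  by (rule permutation_group_action[OF aut_subgroup])

lemma stab_eq_stabilizer: "stab x = stabilizer (B\<lparr>carrier := A\<rparr>) id x"
  by (auto simp: stab_def stabilizer_def)

lemma A_carrier: "g \<in> A \<Longrightarrow> g \<in> carrier B"
  using aut_Bij by (simp add: carrier_BijGroup)

lemma stab_subgroup: "x \<in> E \<Longrightarrow> subgroup (stab x) B"
  using group_action.stabilizer_subgroup[OF action] B.incl_subgroup[OF aut_subgroup]
  by (simp add: stab_eq_stabilizer)

lemma finite_A: "finite A"
  by (rule finite_subset[OF _ finite_Bij[OF finite_E]]) (auto simp: aut_Bij)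

lemma card_A: "x \<in> E \<Longrightarrow> card A = card E * card (stab x)"
proof -
  assume x: "x \<in> E"
  have "orbit (B\<lparr>carrier := A\<rparr>) id x = E"
    using homogeneous[OF x] Bij_mem[OF aut_Bij x] by (auto simp: orbit_def)
  then show ?thesis
    using group_action.orbit_stabilizer_theorem[OF action x] by (simp add: order_def stab_eq_stabilizer)
qed

text \<open>A subgroup of order \<open>p\<close> fixing \<open>x\<close> would fix a second point, as its fixed points
  are divisible by \<open>p\<close> in number; then it would be trivial.\<close>

lemma coprime_stab:
  assumes x: "x \<in> E"
  shows "coprime p (card (stab x))"
proof (rule ccontr)
  assume "\<not> ?thesis"
  then have "p dvd card (stab x)" using prime_p prime_imp_coprime by blast
  then obtain m where m: "card (stab x) = p ^ 1 * m" by auto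
  have grp: "group (B\<lparr>carrier := stab x\<rparr>)" by (rule B.subgroup_imp_group[OF stab_subgroup[OF x]])
  have "finite (stab x)" using finite_A by (rule finite_subset[rotated]) (auto simp: stab_def)
  then obtain R where R: "subgroup R (B\<lparr>carrier := stab x\<rparr>)" "card R = p"
    using sylow_thm[OF prime_p grp, of 1 m] m by (auto simp: order_def)
  have RB: "subgroup R B" by (rule B.incl_subgroup[OF stab_subgroup[OF x] R(1)])
  have Rs: "R \<subseteq> stab x" using subgroup.subset[OF R(1)] by simp
  let ?F = "{y \<in> E. \<forall>r \<in> R. r y = y}"
  have "p dvd card {y \<in> E. \<forall>g \<in> carrier (B\<lparr>carrier := R\<rparr>). id g y = y}"
    by (rule group_action.p_dvd_card_fixed_points[OF permutation_group_action[OF RB] prime_p, of 1])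
      (use R k_pos finite_E card_E in \<open>auto simp: order_def\<close>)
  then have "p dvd card ?F" by simp
  moreover have "x \<in> ?F" using Rs x by (auto simp: stab_def)
  ultimately have "?F \<noteq> {x}" using prime_p by auto
  with \<open>x \<in> ?F\<close> obtain y where y: "y \<in> ?F" "y \<noteq> x" by blast
  have "R \<subseteq> {\<one>\<^bsub>B\<^esub>}"
  proof
    fix r assume r: "r \<in> R"
    then have "r \<in> A" "r x = x" using Rs by (auto simp: stab_def)
    then show "r \<in> {\<one>\<^bsub>B\<^esub>}" using automorphism_fixing_two_points[of r x y] x y r by auto
  qed
  then have "card R \<le> 1" using card_mono[of "{\<one>\<^bsub>B\<^esub>}" R] by simp
  then show False using R(2) prime_gt_1_nat[OF prime_p] by simp
qed

lemma p_element_with_fixed_point: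
  assumes g: "g \<in> A" and x: "x \<in> E" "g x = x" and pow: "g [^]\<^bsub>B\<^esub> (p ^ j) = \<one>\<^bsub>B\<^esub>"
  shows "g = \<one>\<^bsub>B\<^esub>"
proof (rule B.pow_prime_powers_coprime[OF A_carrier[OF g] pow])
  interpret S: group "B\<lparr>carrier := stab x\<rparr>" by (rule B.subgroup_imp_group[OF stab_subgroup[OF x(1)]])
  have "g [^]\<^bsub>B\<lparr>carrier := stab x\<rparr>\<^esub> order (B\<lparr>carrier := stab x\<rparr>) = \<one>\<^bsub>B\<^esub>"
    using S.pow_order_eq_1[of g] g x by (simp add: stab_def)
  then show "g [^]\<^bsub>B\<^esub> card (stab x) = \<one>\<^bsub>B\<^esub>"
    by (simp add: order_def B.nat_pow_consistent[symmetric])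
  show "coprime (p ^ j) (card (stab x))" using coprime_stab[OF x(1)] by simp
qed

lemma E_nonempty: "E \<noteq> {}"
  using card_E prime_p by (metis card.empty power_not_zero not_prime_0)

text \<open>Counting: the nontrivial parts of the point stabilizers are disjoint and all of the same size \<open>h - 1\<close>,
  and the whole group has order \<open>p\<^sup>k h\<close>.\<close>

lemma card_T: "card T = p ^ k"
proof -
  obtain e where e: "e \<in> E" using E_nonempty by blast
  define h where "h = card (stab e)"
  have hx: "card (stab x) = h" if "x \<in> E" for x
    using card_A[OF that] card_A[OF e] card_E prime_p unfolding h_def by (metis mult_cancel1 power_not_zero not_prime_0)
  have one: "\<one>\<^bsub>B\<^esub> \<in> stab x" if "x \<in> E" for x using subgroup.one_closed[OF stab_subgroup[OF that]] .
  have fin: "finite (stab x)" for x using finite_A by (rule finite_subset[rotated]) (auto simp: stab_def)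
  have h0: "h > 0" using one[OF e] fin[of e] unfolding h_def by (auto simp: card_gt_0_iff)
  let ?U = "\<Union>x\<in>E. stab x - {\<one>\<^bsub>B\<^esub>}"
  have "card ?U = (\<Sum>x\<in>E. card (stab x - {\<one>\<^bsub>B\<^esub>}))"
  proof (rule card_UN_disjoint)
    show "\<forall>x\<in>E. \<forall>y\<in>E. x \<noteq> y \<longrightarrow> (stab x - {\<one>\<^bsub>B\<^esub>}) \<inter> (stab y - {\<one>\<^bsub>B\<^esub>}) = {}"
    proof (intro ballI impI equals0I)
      fix x y g assume a: "x \<in> E" "y \<in> E" "x \<noteq> y" "g \<in> (stab x - {\<one>\<^bsub>B\<^esub>}) \<inter> (stab y - {\<one>\<^bsub>B\<^esub>})"
      then have "g \<in> A" "g x = x" "g y = y" "g \<noteq> \<one>\<^bsub>B\<^esub>" by (auto simp: stab_def)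
      with automorphism_fixing_two_points[OF _ a(1-3)] show False by blast
    qed
  qed (use finite_E fin in auto)
  also have "\<dots> = p ^ k * (h - 1)"
    using one hx fin card_E by (simp add: card_Diff_singleton)
  finally have U: "card ?U = p ^ k * (h - 1)" .
  have TU: "A = T \<union> ?U" "T \<inter> ?U = {}"
    unfolding T_def stab_def by auto
  have finU: "finite T" "finite ?U" using finite_A TU(1) by (metis finite_Un)+
  have "card A = card T + card ?U" using card_Un_disjoint[OF finU TU(2)] TU(1) by simp
  then have "p ^ k * h = card T + p ^ k * (h - 1)" using card_A[OF e] card_E U by (simp add: h_def)
  then show ?thesis using h0 by (cases h) auto
qed

text \<open>A Sylow \<open>p\<close>-subgroup meets every point stabilizer trivially, so it is contained in \<open>T\<close>; both have
  \<open>p\<^sup>k\<close> elements.\<close>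

lemma T_subgroup: "subgroup T B"
proof -
  obtain e where e: "e \<in> E" using E_nonempty by blast
  interpret GA: group "B\<lparr>carrier := A\<rparr>" by (rule B.subgroup_imp_group[OF aut_subgroup])
  have "order (B\<lparr>carrier := A\<rparr>) = p ^ k * card (stab e)"
    using card_A[OF e] card_E by (simp add: order_def)
  then obtain P where P: "subgroup P (B\<lparr>carrier := A\<rparr>)" "card P = p ^ k"
    using sylow_thm[OF prime_p GA.is_group] finite_A by auto
  have PB: "subgroup P B" by (rule B.incl_subgroup[OF aut_subgroup P(1)])
  have PA: "P \<subseteq> A" using subgroup.subset[OF P(1)] by simp
  interpret GP: group "B\<lparr>carrier := P\<rparr>" by (rule B.subgroup_imp_group[OF PB])
  have "P \<subseteq> T"
  proof
    fix r assume r: "r \<in> P"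
    have "r [^]\<^bsub>B\<lparr>carrier := P\<rparr>\<^esub> order (B\<lparr>carrier := P\<rparr>) = \<one>\<^bsub>B\<^esub>"
      using GP.pow_order_eq_1[of r] r by simp
    then have "r [^]\<^bsub>B\<^esub> (p ^ k) = \<one>\<^bsub>B\<^esub>"
      using P(2) by (simp add: order_def B.nat_pow_consistent[symmetric])
    then show "r \<in> T" using p_element_with_fixed_point[of r] PA r unfolding T_def by blast
  qed
  moreover have "finite T" using finite_A by (rule finite_subset[rotated]) (auto simp: T_def)
  ultimately have "P = T" using P(2) card_T card_subset_eq by metis
  then show ?thesis using PB by simp
qed

lemma T_sub_A: "t \<in> T \<Longrightarrow> t \<in> A" by (simp add: T_def)

lemma A_Bij: "g \<in> A \<Longrightarrow> g \<in> Bij E" by (rule aut_Bij)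

lemma T_eqI:
  assumes "t \<in> T" "s \<in> T" "x \<in> E" "t x = s x"
  shows "t = s"
proof -
  have Bij: "t \<in> Bij E" "s \<in> Bij E" using assms T_sub_A A_Bij by auto
  have c: "t \<in> carrier B" "s \<in> carrier B" using Bij by (auto simp: carrier_BijGroup)
  have "inv\<^bsub>B\<^esub> s \<otimes>\<^bsub>B\<^esub> t \<in> T"
    using assms T_subgroup by (simp add: subgroup.m_closed subgroup.m_inv_closed)
  moreover have "(inv\<^bsub>B\<^esub> s \<otimes>\<^bsub>B\<^esub> t) x = x"
    using assms Bij Bij_inv_closed[OF Bij(2)] Bij_inv_apply(1)[OF Bij(2) assms(3)] by (simp add: Bij_mult_apply)
  ultimately have "inv\<^bsub>B\<^esub> s \<otimes>\<^bsub>B\<^esub> t = \<one>\<^bsub>B\<^esub>" using assms(3) unfolding T_def by blast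
  then show ?thesis using c by (metis B.inv_equality B.inv_inv B.inv_closed)
qed

lemma T_transitive:
  assumes "x \<in> E" "y \<in> E"
  shows "\<exists>t \<in> T. t x = y"
proof -
  have inj: "inj_on (\<lambda>t. t x) T" using T_eqI assms(1) by (auto intro: inj_onI)
  have sub: "(\<lambda>t. t x) ` T \<subseteq> E" by (rule image_subsetI) (rule Bij_mem[OF A_Bij[OF T_sub_A] assms(1)])
  have "(\<lambda>t. t x) ` T = E"
    by (rule card_subset_eq[OF finite_E sub]) (simp add: card_image[OF inj] card_T card_E)
  then have "y \<in> (\<lambda>t. t x) ` T" using assms(2) by simp
  then show ?thesis by auto
qed

lemma conj_apply:
  assumes "g \<in> A" "t \<in> A" "x \<in> E"
  shows "(g \<otimes>\<^bsub>B\<^esub> t \<otimes>\<^bsub>B\<^esub> inv\<^bsub>B\<^esub> g) (g x) = g (t x)"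
proof -
  have Bij: "g \<in> Bij E" "t \<in> Bij E" using assms A_Bij by auto
  have "g \<otimes>\<^bsub>B\<^esub> t \<in> Bij E" using Bij B.m_closed by (simp add: carrier_BijGroup)
  then show ?thesis using Bij assms(3) by (simp add: Bij_mult_apply Bij_inv_closed Bij_inv_apply Bij_mem)
qed

lemma T_normal:
  assumes g: "g \<in> A" and t: "t \<in> T"
  shows "g \<otimes>\<^bsub>B\<^esub> t \<otimes>\<^bsub>B\<^esub> inv\<^bsub>B\<^esub> g \<in> T"
proof -
  let ?c = "g \<otimes>\<^bsub>B\<^esub> t \<otimes>\<^bsub>B\<^esub> inv\<^bsub>B\<^esub> g"
  have tA: "t \<in> A" by (rule T_sub_A[OF t])
  have cA: "?c \<in> A" using g tA aut_subgroup by (simp add: subgroup.m_closed subgroup.m_inv_closed)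
  have "?c = \<one>\<^bsub>B\<^esub>" if y: "y \<in> E" "?c y = y" for y
  proof -
    let ?x = "(inv\<^bsub>B\<^esub> g) y"
    have gB: "g \<in> Bij E" by (rule A_Bij[OF g])
    have x: "?x \<in> E" "g ?x = y" using Bij_inv_apply(2)[OF gB y(1)] Bij_inv_mem[OF gB y(1)] by auto
    have "g (t ?x) = g ?x" using conj_apply[OF g tA x(1)] x y by simp
    then have "t ?x = ?x"
      using Bij_inv_apply(1)[OF gB x(1)] Bij_inv_apply(1)[OF gB Bij_mem[OF A_Bij[OF tA] x(1)]] by simp
    then have "t = \<one>\<^bsub>B\<^esub>" using t x(1) unfolding T_def by blast
    then show ?thesis using A_carrier[OF g] by simp
  qed
  then show ?thesis using cA unfolding T_def by blast
qed

text \<open>Writing \<open>L\<^sub>y\<close> as a conjugate of \<open>L\<^sub>x\<close> by some \<open>t\<close> in \<open>T\<close> exhibits a product of elements of \<open>T\<close>.\<close>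

lemma displacement_in_T:
  assumes "x \<in> E" "y \<in> E"
  shows "L x \<otimes>\<^bsub>B\<^esub> inv\<^bsub>B\<^esub> (L y) \<in> T"
proof -
  obtain t where t: "t \<in> T" "t x = y" using T_transitive[OF assms] by blast
  have tA: "t \<in> A" by (rule T_sub_A[OF t(1)])
  have c: "t \<in> carrier B" "L x \<in> carrier B" using A_carrier[OF tA] A_carrier[OF L_aut[OF assms(1)]] by auto
  have Ly: "L y = t \<otimes>\<^bsub>B\<^esub> L x \<otimes>\<^bsub>B\<^esub> inv\<^bsub>B\<^esub> t" using conj_L[OF tA assms(1)] t(2) by simp
  have "L x \<otimes>\<^bsub>B\<^esub> inv\<^bsub>B\<^esub> (L y) = (L x \<otimes>\<^bsub>B\<^esub> t \<otimes>\<^bsub>B\<^esub> inv\<^bsub>B\<^esub> (L x)) \<otimes>\<^bsub>B\<^esub> inv\<^bsub>B\<^esub> t"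
    unfolding Ly using c by (simp add: B.inv_mult_group B.m_assoc)
  then show ?thesis
    using T_normal[OF L_aut[OF assms(1)] t(1)] t(1) T_subgroup
    by (simp add: subgroup.m_closed subgroup.m_inv_closed)
qed

definition central_torsion :: "('a \<Rightarrow> 'a) set" where
  "central_torsion = {z \<in> T. (\<forall>t\<in>T. z \<otimes>\<^bsub>B\<^esub> t = t \<otimes>\<^bsub>B\<^esub> z) \<and> z [^]\<^bsub>B\<^esub> p = \<one>\<^bsub>B\<^esub>}"

lemma central_torsionI:
  assumes "z \<in> T" "\<And>t. t \<in> T \<Longrightarrow> z \<otimes>\<^bsub>B\<^esub> t = t \<otimes>\<^bsub>B\<^esub> z" "z [^]\<^bsub>B\<^esub> p = \<one>\<^bsub>B\<^esub>"
  shows "z \<in> central_torsion"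
  unfolding central_torsion_def mem_Collect_eq by (intro conjI ballI assms)

lemma central_torsionD:
  assumes "z \<in> central_torsion"
  shows "z \<in> T" "t \<in> T \<Longrightarrow> z \<otimes>\<^bsub>B\<^esub> t = t \<otimes>\<^bsub>B\<^esub> z" "z [^]\<^bsub>B\<^esub> p = \<one>\<^bsub>B\<^esub>"
  using assms unfolding central_torsion_def by blast+

lemma T_carrier: "t \<in> T \<Longrightarrow> t \<in> carrier B" using A_carrier T_sub_A by blast

text \<open>The central elements of \<open>T\<close> of order dividing \<open>p\<close> form a nontrivial subgroup that is invariant under
  all automorphisms. The orbit of a point \<open>e\<close> under it is closed under the quandle operation, because
  \<open>(u e) \<star> (v e) = (u r) e\<close> where \<open>r\<close> is the conjugate of \<open>u\<inverse>v\<close> by \<open>L\<^sub>e\<close>. By strict simplicity the orbit is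
  everything, and \<open>T\<close> is regular.\<close>

lemma central_torsion_eq_T: "central_torsion = T"
proof -
  interpret GT: group "B\<lparr>carrier := T\<rparr>" by (rule B.subgroup_imp_group[OF T_subgroup])
  let ?Z = "group_center (B\<lparr>carrier := T\<rparr>)"
  have oT: "order (B\<lparr>carrier := T\<rparr>) = p ^ k" using card_T by (simp add: order_def)
  have sZ: "subgroup ?Z (B\<lparr>carrier := T\<rparr>)" by (rule GT.group_center_subgroup)
  then have sZB: "subgroup ?Z B" by (rule B.incl_subgroup[OF T_subgroup])
  have finT: "finite T" using finite_A by (rule finite_subset[rotated]) (auto simp: T_def)
  have finZ: "finite ?Z" by (rule finite_subset[OF _ finT]) (auto simp: group_center_def)
  obtain z where z: "z \<in> ?Z" "z \<noteq> \<one>\<^bsub>B\<^esub>" using GT.p_group_center_nontrivial[OF prime_p oT k_pos] by auto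
  have "card ?Z dvd p ^ k"
    using GT.lagrange[OF sZ] oT by (metis dvd_triv_right)
  then obtain i where i: "card ?Z = p ^ i" using prime_p by (auto simp: divides_primepow_nat)
  have "\<one>\<^bsub>B\<^esub> \<in> ?Z" using subgroup.one_closed[OF sZB] .
  then have "card ?Z \<noteq> 1" using z by (metis card_1_singletonE singletonD)
  then have pZ: "p dvd card ?Z" using i by (cases i) auto
  interpret GZ: group "B\<lparr>carrier := ?Z\<rparr>" by (rule B.subgroup_imp_group[OF sZB])
  obtain w where w: "w \<in> ?Z" "w \<noteq> \<one>\<^bsub>B\<^esub>" "w [^]\<^bsub>B\<lparr>carrier := ?Z\<rparr>\<^esub> p = \<one>\<^bsub>B\<^esub>"
    using GZ.prime_dvd_order_imp_element[of p] finZ prime_p pZ by (auto simp: order_def)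
  have wc: "w \<otimes>\<^bsub>B\<^esub> t = t \<otimes>\<^bsub>B\<^esub> w" if "t \<in> T" for t
    using group_centerD(2)[OF w(1), of t] that by simp
  have "w \<in> T" using group_centerD(1)[OF w(1)] by simp
  moreover have "w [^]\<^bsub>B\<^esub> p = \<one>\<^bsub>B\<^esub>" using w(3) by (simp add: B.nat_pow_consistent[symmetric])
  ultimately have wOm: "w \<in> central_torsion" using wc by (intro central_torsionI)
  have Om_mult: "u \<otimes>\<^bsub>B\<^esub> v \<in> central_torsion" if uv: "u \<in> central_torsion" "v \<in> central_torsion" for u v
  proof -
    have T: "u \<in> T" "v \<in> T" using uv by (auto dest: central_torsionD(1))
    have c: "u \<in> carrier B" "v \<in> carrier B" using T T_carrier by auto
    have com: "u \<otimes>\<^bsub>B\<^esub> v \<otimes>\<^bsub>B\<^esub> t = t \<otimes>\<^bsub>B\<^esub> (u \<otimes>\<^bsub>B\<^esub> v)" if t: "t \<in> T" for t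
    proof -
      have tc: "t \<in> carrier B" by (rule T_carrier[OF t])
      have ut: "u \<otimes>\<^bsub>B\<^esub> t = t \<otimes>\<^bsub>B\<^esub> u" and vt: "v \<otimes>\<^bsub>B\<^esub> t = t \<otimes>\<^bsub>B\<^esub> v" using central_torsionD(2)[OF _ t] uv by auto
      have "u \<otimes>\<^bsub>B\<^esub> v \<otimes>\<^bsub>B\<^esub> t = (u \<otimes>\<^bsub>B\<^esub> t) \<otimes>\<^bsub>B\<^esub> v" using c tc by (simp add: B.m_assoc vt)
      then show ?thesis unfolding ut using c tc by (simp add: B.m_assoc)
    qed
    have "(u \<otimes>\<^bsub>B\<^esub> v) [^]\<^bsub>B\<^esub> p = \<one>\<^bsub>B\<^esub>"
      using B.pow_mult_distrib[OF central_torsionD(2)[OF uv(1) T(2)] c, of p] central_torsionD(3)[OF uv(1)] central_torsionD(3)[OF uv(2)] by simp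
    with com show ?thesis by (intro central_torsionI subgroup.m_closed[OF T_subgroup] T)
  qed
  have Om_conj: "g \<otimes>\<^bsub>B\<^esub> u \<otimes>\<^bsub>B\<^esub> inv\<^bsub>B\<^esub> g \<in> central_torsion" if g: "g \<in> A" and u: "u \<in> central_torsion" for g u
  proof -
    let ?c = "g \<otimes>\<^bsub>B\<^esub> u \<otimes>\<^bsub>B\<^esub> inv\<^bsub>B\<^esub> g"
    have gc: "g \<in> carrier B" and uT: "u \<in> T" and uc: "u \<in> carrier B"
      using A_carrier[OF g] central_torsionD(1)[OF u] T_carrier by auto
    have giA: "inv\<^bsub>B\<^esub> g \<in> A" using g aut_subgroup by (simp add: subgroup.m_inv_closed)
    have com: "?c \<otimes>\<^bsub>B\<^esub> t = t \<otimes>\<^bsub>B\<^esub> ?c" if t: "t \<in> T" for t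
    proof -
      have tc: "t \<in> carrier B" by (rule T_carrier[OF t])
      let ?t = "inv\<^bsub>B\<^esub> g \<otimes>\<^bsub>B\<^esub> t \<otimes>\<^bsub>B\<^esub> g"
      have t': "?t \<in> T" using T_normal[OF giA t] gc by simp
      have "?c \<otimes>\<^bsub>B\<^esub> t = g \<otimes>\<^bsub>B\<^esub> (u \<otimes>\<^bsub>B\<^esub> ?t) \<otimes>\<^bsub>B\<^esub> inv\<^bsub>B\<^esub> g" using gc uc tc by (simp add: B.m_assoc)
      also have "u \<otimes>\<^bsub>B\<^esub> ?t = ?t \<otimes>\<^bsub>B\<^esub> u" by (rule central_torsionD(2)[OF u t'])
      also have "g \<otimes>\<^bsub>B\<^esub> (?t \<otimes>\<^bsub>B\<^esub> u) \<otimes>\<^bsub>B\<^esub> inv\<^bsub>B\<^esub> g = t \<otimes>\<^bsub>B\<^esub> ?c" using gc uc tc by (simp flip: B.m_assoc)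
      finally show ?thesis .
    qed
    have "?c [^]\<^bsub>B\<^esub> n = g \<otimes>\<^bsub>B\<^esub> u [^]\<^bsub>B\<^esub> n \<otimes>\<^bsub>B\<^esub> inv\<^bsub>B\<^esub> g" for n :: nat
    proof (induction n)
      case (Suc n) then show ?case using gc uc by (simp add: B.m_assoc) (simp flip: B.m_assoc)
    qed (use gc in simp)
    then have "?c [^]\<^bsub>B\<^esub> p = \<one>\<^bsub>B\<^esub>" using central_torsionD(3)[OF u] gc by simp
    with com T_normal[OF g uT] show ?thesis by (intro central_torsionI)
  qed
  have oneOm: "\<one>\<^bsub>B\<^esub> \<in> central_torsion"
    using T_carrier by (intro central_torsionI subgroup.one_closed[OF T_subgroup]) auto
  have Om_inv: "inv\<^bsub>B\<^esub> u \<in> central_torsion" if u: "u \<in> central_torsion" for u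
  proof -
    have uT: "u \<in> T" and uc: "u \<in> carrier B" using central_torsionD(1)[OF u] T_carrier by auto
    have "u [^]\<^bsub>B\<^esub> n \<in> central_torsion" for n :: nat
    proof (induction n)
      case 0 then show ?case using oneOm by simp
    next
      case (Suc n) then show ?case using Om_mult u by simp
    qed
    moreover have "inv\<^bsub>B\<^esub> u = u [^]\<^bsub>B\<^esub> (p - 1)"
    proof (rule B.inv_equality)
      have "Suc (p - 1) = p" using prime_gt_0_nat[OF prime_p] by simp
      then show "u [^]\<^bsub>B\<^esub> (p - 1) \<otimes>\<^bsub>B\<^esub> u = \<one>\<^bsub>B\<^esub>"
        using B.nat_pow_Suc[of u "p - 1"] central_torsionD(3)[OF u] by simp
    qed (use uc in auto)
    ultimately show ?thesis by simp
  qed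
  obtain e where e: "e \<in> E" using E_nonempty by blast
  have OmT: "central_torsion \<subseteq> T" by (auto dest: central_torsionD(1))
  have OmBij: "u \<in> Bij E" if "u \<in> central_torsion" for u using that OmT T_sub_A A_Bij by blast
  let ?S = "(\<lambda>z. z e) ` central_torsion"
  have "?S = E"
  proof (rule closed_subset_eq)
    show "?S \<subseteq> E" by (rule image_subsetI) (rule Bij_mem[OF OmBij e])
    show "e \<in> ?S" using imageI[OF oneOm, of "\<lambda>z. z e"] e by (simp add: Bij_one_apply)
    show "w e \<in> ?S" using wOm by blast
    show "e \<noteq> w e" using w(2) \<open>w \<in> T\<close> e unfolding T_def by auto
  next
    fix x y assume "x \<in> ?S" "y \<in> ?S"
    then obtain u v where uv: "u \<in> central_torsion" "v \<in> central_torsion" "x = u e" "y = v e" by blast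
    let ?s = "inv\<^bsub>B\<^esub> u \<otimes>\<^bsub>B\<^esub> v"
    let ?r = "L e \<otimes>\<^bsub>B\<^esub> ?s \<otimes>\<^bsub>B\<^esub> inv\<^bsub>B\<^esub> (L e)"
    have s: "?s \<in> central_torsion" using uv Om_inv Om_mult by blast
    have LA: "L e \<in> A" by (rule L_aut[OF e])
    have r: "?r \<in> central_torsion" by (rule Om_conj[OF LA s])
    have ur: "u \<otimes>\<^bsub>B\<^esub> ?r \<in> central_torsion" using uv r Om_mult by blast
    have uB: "u \<in> Bij E" and vB: "v \<in> Bij E" using OmBij uv by auto
    have ve: "v e \<in> E" by (rule Bij_mem[OF vB e])
    have se: "?s e = (inv\<^bsub>B\<^esub> u) (v e)" by (rule Bij_mult_apply[OF Bij_inv_closed[OF uB] vB e])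
    have "?r (L e e) = L e (?s e)" by (rule conj_apply[OF LA _ e]) (use s OmT T_sub_A in blast)
    then have re: "?r e = e \<star> ?s e" using e idem Bij_mem[OF OmBij[OF s] e] by (simp add: L_apply)
    have "(u \<otimes>\<^bsub>B\<^esub> ?r) e = u (?r e)" by (rule Bij_mult_apply[OF uB OmBij[OF r] e])
    also have "\<dots> = u e \<star> u (?s e)"
      unfolding re by (rule aut_mul[OF _ e Bij_mem[OF OmBij[OF s] e]]) (use uv OmT T_sub_A in blast)
    also have "u (?s e) = v e" unfolding se by (rule Bij_inv_apply(2)[OF uB ve])
    finally have "x \<star> y = (u \<otimes>\<^bsub>B\<^esub> ?r) e" using uv by simp
    then show "x \<star> y \<in> ?S" using ur by blast
  qed
  show ?thesis
  proof
    show "T \<subseteq> central_torsion"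
    proof
      fix t assume t: "t \<in> T"
      have "t e \<in> ?S" unfolding \<open>?S = E\<close> by (rule Bij_mem[OF A_Bij[OF T_sub_A[OF t]] e])
      then obtain z where z: "z \<in> central_torsion" "t e = z e" by auto
      then have "t = z" using T_eqI[OF t _ e] OmT by blast
      then show "t \<in> central_torsion" using z by simp
    qed
  qed (rule OmT)
qed

lemma T_comm: "s \<in> T \<Longrightarrow> t \<in> T \<Longrightarrow> s \<otimes>\<^bsub>B\<^esub> t = t \<otimes>\<^bsub>B\<^esub> s"
  using central_torsionD(2)[of s t] by (simp only: central_torsion_eq_T)

lemma T_pow: "t \<in> T \<Longrightarrow> t [^]\<^bsub>B\<^esub> p = \<one>\<^bsub>B\<^esub>"
  using central_torsionD(3)[of t] by (simp only: central_torsion_eq_T)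

text \<open>Then \<open>L\<^sub>x\<close> has two fixed points, so it is trivial, and all left translations are conjugate to it.\<close>

lemma projection_if_fixed_point:
  assumes xy: "x \<in> E" "y \<in> E" "x \<noteq> y" "x \<star> y = y" and uv: "u \<in> E" "v \<in> E"
  shows "u \<star> v = v"
proof -
  have Lx: "L x = \<one>\<^bsub>B\<^esub>"
    by (rule automorphism_fixing_two_points[OF L_aut[OF xy(1)] xy(1-3)])
      (simp_all add: L_apply xy idem)
  obtain g where g: "g \<in> A" "g x = u" using homogeneous[OF xy(1) uv(1)] by blast
  have "L u = \<one>\<^bsub>B\<^esub>" using conj_L[OF g(1) xy(1)] Lx g A_carrier[OF g(1)] by simp
  then show ?thesis using L_apply[OF uv(2), of u] by (simp add: Bij_one_apply uv(2))
qed

text \<open>For \<open>t\<close> in \<open>T\<close>, the element \<open>(t a) \<star> a\<close> is the image of \<open>a\<close> under \<open>t\<close> times the conjugate of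
  \<open>t\<inverse>\<close> by \<open>L\<^sub>a\<close>. If \<open>t\<close> and \<open>s\<close> give the same element, then by regularity \<open>s\<inverse>t\<close> commutes with \<open>L\<^sub>a\<close>.
  So \<open>L\<^sub>a\<close> fixes the image of \<open>a\<close> under \<open>s\<inverse>t\<close>, which therefore is \<open>a\<close>.\<close>

lemma right_cancel:
  assumes nontriv: "u \<in> E" "v \<in> E" "u \<star> v \<noteq> v"
    and E: "x \<in> E" "y \<in> E" "a \<in> E" and eq: "x \<star> a = y \<star> a"
  shows "x = y"
proof -
  let ?l = "L a"
  have lA: "?l \<in> A" by (rule L_aut[OF E(3)])
  have la: "?l a = a" using E(3) idem by (simp add: L_apply)
  have lc: "?l \<in> carrier B" by (rule A_carrier[OF lA])
  define F where "F = (\<lambda>t. ?l \<otimes>\<^bsub>B\<^esub> inv\<^bsub>B\<^esub> t \<otimes>\<^bsub>B\<^esub> inv\<^bsub>B\<^esub> ?l)"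
  have F: "t \<otimes>\<^bsub>B\<^esub> F t \<in> T \<and> (t \<otimes>\<^bsub>B\<^esub> F t) a = t a \<star> a" if t: "t \<in> T" for t
  proof -
    have ti: "inv\<^bsub>B\<^esub> t \<in> T" by (rule subgroup.m_inv_closed[OF T_subgroup t])
    have FT: "F t \<in> T" unfolding F_def by (rule T_normal[OF lA ti])
    have tB: "t \<in> Bij E" by (rule A_Bij[OF T_sub_A[OF t]])
    have tia: "(inv\<^bsub>B\<^esub> t) a \<in> E" by (rule Bij_inv_mem[OF tB E(3)])
    have "F t a = ?l ((inv\<^bsub>B\<^esub> t) a)" using conj_apply[OF lA T_sub_A[OF ti] E(3)] unfolding la F_def .
    then have "(t \<otimes>\<^bsub>B\<^esub> F t) a = t (a \<star> (inv\<^bsub>B\<^esub> t) a)"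
      using Bij_mult_apply[OF tB A_Bij[OF T_sub_A[OF FT]] E(3)] tia by (simp add: L_apply)
    also have "\<dots> = t a \<star> a" using aut_mul[OF T_sub_A[OF t] E(3) tia] Bij_inv_apply(2)[OF tB E(3)] by simp
    finally show ?thesis using subgroup.m_closed[OF T_subgroup t FT] by blast
  qed
  obtain t where t: "t \<in> T" "t a = x" using T_transitive[OF E(3,1)] by blast
  obtain s where s: "s \<in> T" "s a = y" using T_transitive[OF E(3,2)] by blast
  have c: "t \<in> carrier B" "s \<in> carrier B" using T_carrier t s by auto
  have Fc: "F t \<in> carrier B" "F s \<in> carrier B" unfolding F_def using lc c by auto
  have eqT: "t \<otimes>\<^bsub>B\<^esub> F t = s \<otimes>\<^bsub>B\<^esub> F s"
    by (rule T_eqI[OF _ _ E(3)]) (use F[OF t(1)] F[OF s(1)] t s eq in auto)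
  let ?w = "inv\<^bsub>B\<^esub> s \<otimes>\<^bsub>B\<^esub> t"
  have "?w = inv\<^bsub>B\<^esub> s \<otimes>\<^bsub>B\<^esub> (t \<otimes>\<^bsub>B\<^esub> F t) \<otimes>\<^bsub>B\<^esub> inv\<^bsub>B\<^esub> (F t)" using c Fc by (simp add: B.m_assoc)
  also have "\<dots> = F s \<otimes>\<^bsub>B\<^esub> inv\<^bsub>B\<^esub> (F t)" unfolding eqT using c Fc by (simp flip: B.m_assoc)
  also have "\<dots> = ?l \<otimes>\<^bsub>B\<^esub> ?w \<otimes>\<^bsub>B\<^esub> inv\<^bsub>B\<^esub> ?l"
    unfolding F_def using c lc by (simp add: B.inv_mult_group B.m_assoc) (simp flip: B.m_assoc)
  finally have w: "?w = ?l \<otimes>\<^bsub>B\<^esub> ?w \<otimes>\<^bsub>B\<^esub> inv\<^bsub>B\<^esub> ?l" .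
  have wT: "?w \<in> T" using s t T_subgroup by (simp add: subgroup.m_closed subgroup.m_inv_closed)
  have wa: "?w a \<in> E" by (rule Bij_mem[OF A_Bij[OF T_sub_A[OF wT]] E(3)])
  have "?w a = ?l (?w a)" using conj_apply[OF lA T_sub_A[OF wT] E(3)] unfolding la w[symmetric] .
  then have "a \<star> ?w a = ?w a" using wa by (simp add: L_apply)
  then have "?w a = a" using projection_if_fixed_point[OF E(3) wa _ _ nontriv(1,2)] nontriv(3) by metis
  moreover have "?w a = (inv\<^bsub>B\<^esub> s) (t a)"
    by (rule Bij_mult_apply[OF Bij_inv_closed A_Bij[OF T_sub_A[OF t(1)]] E(3)]) (rule A_Bij[OF T_sub_A[OF s(1)]])
  ultimately have "s ((inv\<^bsub>B\<^esub> s) x) = y" using t s by simp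
  then show ?thesis using Bij_inv_apply(2)[OF A_Bij[OF T_sub_A[OF s(1)]] E(1)] by simp
qed

end

section \<open>Locally strictly simple quandles with one proper congruence\<close>

locale lss_p_quandle = quandle Q mul for Q :: "'a set" and mul (infixl \<open>\<star>\<close> 70) +
  fixes \<alpha> :: "('a \<times> 'a) set" and p m n :: nat
  assumes finite_Q: "finite Q"
    and transitive: "transitive_action (Dis Q mul) Q id"
    and nonabelian: "\<not> abelian_quandle Q mul"
    and lss: "locally_strictly_simple Q mul"
    and congruences: "{\<beta>. quandle_congruence Q mul \<beta> \<and> \<beta> \<noteq> Id_on Q \<and> \<beta> \<noteq> Q \<times> Q} = {\<alpha>}"
    and card_factor: "card (Q // \<alpha>) = p ^ n"
    and card_block: "\<And>C. C \<in> Q // \<alpha> \<Longrightarrow> card C = p ^ m"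
    and prime_p: "prime p" and m_pos: "m \<ge> 1" and n_pos: "n \<ge> 1" and block_gt_2: "p ^ m > 2"
begin

sublocale B: group B by (rule group_BijGroup)

abbreviation "G \<equiv> Dis_rel Q mul (Q \<times> Q)"

lemma alpha_congruence: "quandle_congruence Q mul \<alpha>" "\<alpha> \<noteq> Id_on Q" "\<alpha> \<noteq> Q \<times> Q"
  using congruences by auto

lemma alpha_equiv: "equiv Q \<alpha>"
  using alpha_congruence(1) by (simp add: quandle_congruence_def)

lemma alpha_sub: "(x, y) \<in> \<alpha> \<Longrightarrow> x \<in> Q \<and> y \<in> Q"
  using equiv_type[OF alpha_equiv] by blast

lemma alpha_refl: "x \<in> Q \<Longrightarrow> (x, x) \<in> \<alpha>"
  using alpha_equiv by (simp add: equiv_def refl_on_def)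

lemma alpha_sym: "(x, y) \<in> \<alpha> \<Longrightarrow> (y, x) \<in> \<alpha>"
  using alpha_equiv unfolding equiv_def by (blast dest: symD)

lemma alpha_trans: "(x, y) \<in> \<alpha> \<Longrightarrow> (y, z) \<in> \<alpha> \<Longrightarrow> (x, z) \<in> \<alpha>"
  using alpha_equiv unfolding equiv_def by (blast dest: transD)

lemma alpha_mul: "(a, b) \<in> \<alpha> \<Longrightarrow> (c, d) \<in> \<alpha> \<Longrightarrow> (a \<star> c, b \<star> d) \<in> \<alpha>"
  using alpha_congruence(1) by (simp add: quandle_congruence_def)

lemma alpha_unique: "quandle_congruence Q mul \<beta> \<Longrightarrow> \<beta> \<noteq> Id_on Q \<Longrightarrow> \<beta> \<noteq> Q \<times> Q \<Longrightarrow> \<beta> = \<alpha>"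
  using congruences by auto

section \<open>Automorphisms preserving the congruence\<close>

text \<open>Conjugation by \<open>H\<close> plays the role of conjugation by all left translations: \<open>H\<close> contains them,
  normalizes \<open>G\<close> and acts on the set of blocks.\<close>

definition H :: "('a \<Rightarrow> 'a) set" where
  "H = {g \<in> quandle_aut Q mul. \<forall>x\<in>Q. \<forall>y\<in>Q. (x, y) \<in> \<alpha> \<longleftrightarrow> (g x, g y) \<in> \<alpha>}"

lemma H_aut: "g \<in> H \<Longrightarrow> g \<in> quandle_aut Q mul" by (simp add: H_def)

lemma H_Bij: "g \<in> H \<Longrightarrow> g \<in> Bij Q" by (rule aut_Bij[OF H_aut])

lemma H_mem: "g \<in> H \<Longrightarrow> x \<in> Q \<Longrightarrow> g x \<in> Q" by (rule Bij_mem[OF H_Bij])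

lemma H_iff: "g \<in> H \<Longrightarrow> x \<in> Q \<Longrightarrow> y \<in> Q \<Longrightarrow> (g x, g y) \<in> \<alpha> \<longleftrightarrow> (x, y) \<in> \<alpha>"
  unfolding H_def by blast

lemma H_alpha: "g \<in> H \<Longrightarrow> (x, y) \<in> \<alpha> \<Longrightarrow> (g x, g y) \<in> \<alpha>"
  using H_iff[of g x y] alpha_sub[of x y] by simp

lemma H_subgroup: "subgroup H B"
proof (rule B.subgroupI)
  show "H \<subseteq> carrier B" using H_Bij by (auto simp: carrier_BijGroup)
  have "\<one>\<^bsub>B\<^esub> \<in> H" using subgroup.one_closed[OF aut_subgroup] by (simp add: H_def Bij_one_apply)
  then show "H \<noteq> {}" by blast
next
  fix g assume g: "g \<in> H"
  have gB: "g \<in> Bij Q" by (rule H_Bij[OF g])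
  have "(x, y) \<in> \<alpha> \<longleftrightarrow> ((inv\<^bsub>B\<^esub> g) x, (inv\<^bsub>B\<^esub> g) y) \<in> \<alpha>" if xy: "x \<in> Q" "y \<in> Q" for x y
    using H_iff[OF g Bij_inv_mem[OF gB xy(1)] Bij_inv_mem[OF gB xy(2)]]
    by (simp only: Bij_inv_apply(2)[OF gB xy(1)] Bij_inv_apply(2)[OF gB xy(2)])
  then show "inv\<^bsub>B\<^esub> g \<in> H"
    unfolding H_def by (intro CollectI conjI ballI subgroup.m_inv_closed[OF aut_subgroup H_aut[OF g]])
next
  fix g h assume gh: "g \<in> H" "h \<in> H"
  have "(x, y) \<in> \<alpha> \<longleftrightarrow> ((g \<otimes>\<^bsub>B\<^esub> h) x, (g \<otimes>\<^bsub>B\<^esub> h) y) \<in> \<alpha>" if xy: "x \<in> Q" "y \<in> Q" for x y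
    using H_iff[OF gh(1) H_mem[OF gh(2) xy(1)] H_mem[OF gh(2) xy(2)]] H_iff[OF gh(2) xy]
    by (simp only: Bij_mult_apply[OF H_Bij[OF gh(1)] H_Bij[OF gh(2)]] xy)
  then show "g \<otimes>\<^bsub>B\<^esub> h \<in> H"
    unfolding H_def by (intro CollectI conjI ballI subgroup.m_closed[OF aut_subgroup H_aut[OF gh(1)] H_aut[OF gh(2)]])
qed

lemma H_carrier: "g \<in> H \<Longrightarrow> g \<in> carrier B" using H_Bij by (simp add: carrier_BijGroup)

lemma left_div_eq: "a \<in> Q \<Longrightarrow> b \<in> Q \<Longrightarrow> left_div Q mul a b = (inv\<^bsub>B\<^esub> (L a)) b"
proof -
  assume a: "a \<in> Q" and b: "b \<in> Q"
  have "inv_into Q (mul a) b = inv_into Q (L a) b"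
    unfolding inv_into_def by (rule arg_cong[where f = Eps]) (auto simp: L_apply)
  then show ?thesis using b inv_BijGroup[OF L_Bij[OF a]] by (simp add: left_div_def)
qed

lemma L_H: "a \<in> Q \<Longrightarrow> L a \<in> H"
proof -
  assume a: "a \<in> Q"
  have refl: "(x, y) \<in> \<alpha>" if xy: "x \<in> Q" "y \<in> Q" "(L a x, L a y) \<in> \<alpha>" for x y
  proof -
    have "(left_div Q mul a (L a x), left_div Q mul a (L a y)) \<in> \<alpha>"
      using alpha_congruence(1) alpha_refl[OF a] xy(3) unfolding quandle_congruence_def by blast
    then show ?thesis
      using xy a Bij_inv_apply(1)[OF L_Bij[OF a]] Bij_mem[OF L_Bij[OF a]] by (simp add: left_div_eq)
  qed
  have pres: "(L a x, L a y) \<in> \<alpha>" if "x \<in> Q" "y \<in> Q" "(x, y) \<in> \<alpha>" for x y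
    using alpha_mul[OF alpha_refl[OF a] that(3)] that by (simp add: L_apply)
  show ?thesis unfolding H_def
    by (intro CollectI conjI ballI iffI L_aut[OF a]) (rule pres refl; assumption)+
qed

lemma displacement_def': "displacement Q mul a b = L a \<otimes>\<^bsub>B\<^esub> inv\<^bsub>B\<^esub> (L b)"
  by (simp add: displacement_def)

lemma displacement_H: "a \<in> Q \<Longrightarrow> b \<in> Q \<Longrightarrow> displacement Q mul a b \<in> H"
  using H_subgroup L_H by (simp add: displacement_def' subgroup.m_closed subgroup.m_inv_closed)

lemma Dis_rel_subgroup: "\<beta> \<subseteq> Q \<times> Q \<Longrightarrow> subgroup (Dis_rel Q mul \<beta>) B"
  unfolding Dis_rel_def using displacement_H H_carrier by (intro B.generate_is_subgroup) blast

lemma G_subgroup: "subgroup G B" by (rule Dis_rel_subgroup) simp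

lemma G_subset_if_displacements:
  assumes "subgroup S B" "\<And>x y. x \<in> Q \<Longrightarrow> y \<in> Q \<Longrightarrow> displacement Q mul x y \<in> S"
  shows "G \<subseteq> S"
  unfolding Dis_rel_def by (rule B.generate_subgroup_incl) (use assms in auto)

lemma displacement_G: "x \<in> Q \<Longrightarrow> y \<in> Q \<Longrightarrow> displacement Q mul x y \<in> G"
  unfolding Dis_rel_def by (rule generate.incl) blast

lemma G_H: "g \<in> G \<Longrightarrow> g \<in> H"
  using G_subset_if_displacements[OF H_subgroup displacement_H] by blast

lemma G_transitive: "x \<in> Q \<Longrightarrow> y \<in> Q \<Longrightarrow> \<exists>g \<in> G. g x = y"
  using transitive_action.unique_orbit[OF transitive, of x y] by (simp add: Dis_def)

lemma conj_hom:
  assumes "g \<in> carrier B"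
  shows "(\<lambda>h. g \<otimes>\<^bsub>B\<^esub> h \<otimes>\<^bsub>B\<^esub> inv\<^bsub>B\<^esub> g) \<in> hom B B"
proof (rule homI)
  fix x y assume "x \<in> carrier B" "y \<in> carrier B"
  then show "g \<otimes>\<^bsub>B\<^esub> (x \<otimes>\<^bsub>B\<^esub> y) \<otimes>\<^bsub>B\<^esub> inv\<^bsub>B\<^esub> g = g \<otimes>\<^bsub>B\<^esub> x \<otimes>\<^bsub>B\<^esub> inv\<^bsub>B\<^esub> g \<otimes>\<^bsub>B\<^esub> (g \<otimes>\<^bsub>B\<^esub> y \<otimes>\<^bsub>B\<^esub> inv\<^bsub>B\<^esub> g)"
    using assms by (simp add: B.m_assoc) (simp flip: B.m_assoc)
qed (use assms in simp)

lemma G_normal: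
  assumes g: "g \<in> H" and x: "x \<in> G"
  shows "g \<otimes>\<^bsub>B\<^esub> x \<otimes>\<^bsub>B\<^esub> inv\<^bsub>B\<^esub> g \<in> G"
proof -
  have gc: "g \<in> carrier B" by (rule H_carrier[OF g])
  interpret c: group_hom B B "\<lambda>h. g \<otimes>\<^bsub>B\<^esub> h \<otimes>\<^bsub>B\<^esub> inv\<^bsub>B\<^esub> g"
    by unfold_locales (rule conj_hom[OF gc])
  let ?S = "{h \<in> carrier B. g \<otimes>\<^bsub>B\<^esub> h \<otimes>\<^bsub>B\<^esub> inv\<^bsub>B\<^esub> g \<in> G}"
  have "subgroup ?S B"
  proof (rule B.subgroupI)
    have "\<one>\<^bsub>B\<^esub> \<in> ?S" using subgroup.one_closed[OF G_subgroup] gc by simp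
    then show "?S \<noteq> {}" by blast
  next
    fix a assume "a \<in> ?S"
    then show "inv\<^bsub>B\<^esub> a \<in> ?S"
      using subgroup.m_inv_closed[OF G_subgroup, of "g \<otimes>\<^bsub>B\<^esub> a \<otimes>\<^bsub>B\<^esub> inv\<^bsub>B\<^esub> g"] c.hom_inv[of a] by simp
  next
    fix a b assume "a \<in> ?S" "b \<in> ?S"
    then show "a \<otimes>\<^bsub>B\<^esub> b \<in> ?S"
      using subgroup.m_closed[OF G_subgroup, of "g \<otimes>\<^bsub>B\<^esub> a \<otimes>\<^bsub>B\<^esub> inv\<^bsub>B\<^esub> g" "g \<otimes>\<^bsub>B\<^esub> b \<otimes>\<^bsub>B\<^esub> inv\<^bsub>B\<^esub> g"] c.hom_mult[of a b]
      by simp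
  qed auto
  moreover have "displacement Q mul u v \<in> ?S" if uv: "u \<in> Q" "v \<in> Q" for u v
  proof -
    have c: "L u \<in> carrier B" "L v \<in> carrier B" using uv L_H H_carrier by auto
    have "g \<otimes>\<^bsub>B\<^esub> displacement Q mul u v \<otimes>\<^bsub>B\<^esub> inv\<^bsub>B\<^esub> g = displacement Q mul (g u) (g v)"
      using c.hom_mult[of "L u" "inv\<^bsub>B\<^esub> L v"] c.hom_inv[of "L v"] c conj_L[OF H_aut[OF g]] uv
      by (simp add: displacement_def')
    then show ?thesis using displacement_G H_mem[OF g] uv displacement_H H_carrier by simp
  qed
  ultimately have "G \<subseteq> ?S" by (rule G_subset_if_displacements)
  then show ?thesis using x by blast
qed

section \<open>Blocks and the factor\<close>

lemma block_sub: "C \<in> Q // \<alpha> \<Longrightarrow> C \<subseteq> Q"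
  using alpha_equiv by (rule in_quotient_imp_subset)

lemma block_alpha:
  assumes C: "C \<in> Q // \<alpha>" and x: "x \<in> C"
  shows "y \<in> C \<longleftrightarrow> (x, y) \<in> \<alpha>"
proof -
  from C obtain z where z: "C = \<alpha> `` {z}" by (rule quotientE)
  then have zx: "(z, x) \<in> \<alpha>" using x by simp
  have "(z, y) \<in> \<alpha> \<longleftrightarrow> (x, y) \<in> \<alpha>"
    using alpha_trans[OF zx, of y] alpha_trans[OF alpha_sym[OF zx], of y] by (rule iffI[rotated])
  then show ?thesis using z by simp
qed

abbreviation "cls x \<equiv> \<alpha> `` {x}"

lemma cls_block: "x \<in> Q \<Longrightarrow> cls x \<in> Q // \<alpha>" by (rule quotientI)

lemma cls_self: "x \<in> Q \<Longrightarrow> x \<in> cls x" using alpha_refl by simp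

lemma cls_eq_iff: "x \<in> Q \<Longrightarrow> y \<in> Q \<Longrightarrow> cls x = cls y \<longleftrightarrow> (x, y) \<in> \<alpha>"
  using eq_equiv_class_iff[OF alpha_equiv] .

lemma blockE: "C \<in> Q // \<alpha> \<Longrightarrow> (\<And>x. x \<in> Q \<Longrightarrow> C = cls x \<Longrightarrow> thesis) \<Longrightarrow> thesis"
  by (rule quotientE)

lemma block_nonempty:
  assumes "C \<in> Q // \<alpha>"
  obtains x where "x \<in> C" "x \<in> Q"
proof -
  from assms obtain x where "x \<in> Q" "C = cls x" by (rule quotientE)
  then show thesis using that[of x] cls_self[of x] by simp
qed

lemma pn_gt_1: "p ^ n > 1" using prime_gt_1_nat[OF prime_p] n_pos by (metis one_less_power less_le_trans zero_less_one)

lemma block_neq_Q: "C \<in> Q // \<alpha> \<Longrightarrow> C \<noteq> Q"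
proof
  assume C: "C \<in> Q // \<alpha>" "C = Q"
  have "D = Q" if D: "D \<in> Q // \<alpha>" for D
  proof -
    from D obtain x where x: "x \<in> D" "x \<in> Q" by (rule block_nonempty)
    have "y \<in> D" if y: "y \<in> Q" for y
      using block_alpha[OF D x(1), of y] block_alpha[OF C(1), of x y] C(2) x(2) y by simp
    then show ?thesis using block_sub[OF D] by blast
  qed
  then have "card (Q // \<alpha>) \<le> 1" using card_mono[of "{Q}" "Q // \<alpha>"] by auto
  then show False using card_factor pn_gt_1 by simp
qed

lemma block_closed: "C \<in> Q // \<alpha> \<Longrightarrow> x \<in> C \<Longrightarrow> y \<in> C \<Longrightarrow> x \<star> y \<in> C"
proof -
  assume C: "C \<in> Q // \<alpha>" and xy: "x \<in> C" "y \<in> C"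
  have xQ: "x \<in> Q" using block_sub[OF C] xy by blast
  have "(x, y) \<in> \<alpha>" using block_alpha[OF C xy(1)] xy(2) by blast
  then have "(x \<star> x, x \<star> y) \<in> \<alpha>" by (rule alpha_mul[OF alpha_refl[OF xQ]])
  then show "x \<star> y \<in> C" using idem[OF xQ] block_alpha[OF C xy(1)] by simp
qed

lemma block_two:
  assumes C: "C \<in> Q // \<alpha>" and x: "x \<in> C"
  shows "\<exists>y \<in> C. x \<noteq> y"
proof (rule ccontr)
  assume nex: "\<not> ?thesis"
  have "C \<subseteq> {x}"
  proof
    fix y assume "y \<in> C"
    show "y \<in> {x}"
    proof (rule ccontr)
      assume "y \<notin> {x}"
      then have "x \<noteq> y" by simp
      with nex \<open>y \<in> C\<close> show False by (meson bexI)
    qed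
  qed
  then have "card C \<le> 1" using card_mono[of "{x}" C] by simp
  then show False using card_block[OF C] block_gt_2 by simp
qed

lemma block_proper: "C \<in> Q // \<alpha> \<Longrightarrow> proper_subquandle C Q mul"
proof -
  assume C: "C \<in> Q // \<alpha>"
  from C obtain x where x: "x \<in> C" by (rule block_nonempty)
  from block_two[OF C x] obtain y where y: "y \<in> C" "x \<noteq> y" ..
  show ?thesis unfolding proper_subquandle_def
    by (intro conjI block_sub[OF C] subquandleI[OF finite_Q block_sub[OF C] block_closed[OF C]] block_neq_Q[OF C]
        bexI[OF _ x] bexI[OF _ y(1)] y(2))
qed

text \<open>A proper subquandle has no room for a block as a smaller subquandle, since it is strictly simple.\<close>

lemma proper_subquandle_block:
  assumes S: "S \<subseteq> Q" "\<And>x y. x \<in> S \<Longrightarrow> y \<in> S \<Longrightarrow> x \<star> y \<in> S" "S \<noteq> Q"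
    and C: "C \<in> Q // \<alpha>" "C \<subseteq> S"
  shows "C = S"
proof (rule ccontr)
  assume CS: "C \<noteq> S"
  have PC: "quandle C mul" "\<exists>x\<in>C. \<exists>y\<in>C. x \<noteq> y"
    using block_proper[OF C(1)] unfolding proper_subquandle_def by auto
  have qS: "quandle S mul" by (rule subquandleI[OF finite_Q S(1,2)])
  from PC(2) have two: "\<exists>x\<in>S. \<exists>y\<in>S. x \<noteq> y" using C(2) by blast
  have "proper_subquandle S Q mul" unfolding proper_subquandle_def
    by (intro conjI S(1) qS two S(3))
  then have "strictly_simple S mul" using lss unfolding locally_strictly_simple_def by blast
  moreover have "proper_subquandle C S mul" unfolding proper_subquandle_def by (intro conjI C(2) PC CS)
  ultimately show False unfolding strictly_simple_def by blast
qed

definition setwise_stab :: "'a set \<Rightarrow> ('a \<Rightarrow> 'a) set" where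
  "setwise_stab C = {g \<in> H. \<forall>x\<in>C. g x \<in> C}"

lemma setwise_stabI:
  assumes C: "C \<in> Q // \<alpha>" and g: "g \<in> H" and x: "x \<in> C" "g x \<in> C"
  shows "g \<in> setwise_stab C"
  unfolding setwise_stab_def
proof (intro CollectI conjI ballI)
  fix y assume y: "y \<in> C"
  have "(x, y) \<in> \<alpha>" using block_alpha[OF C x(1)] y by blast
  then have "(g x, g y) \<in> \<alpha>" by (rule H_alpha[OF g])
  then show "g y \<in> C" using block_alpha[OF C x(2)] by blast
qed (rule g)

lemma setwise_stab_subgroup: "C \<in> Q // \<alpha> \<Longrightarrow> subgroup (setwise_stab C) B"
proof -
  assume C: "C \<in> Q // \<alpha>"
  from C obtain x where x: "x \<in> C" by (rule block_nonempty)
  have xQ: "x \<in> Q" using block_sub[OF C] x by blast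
  show ?thesis
  proof (rule B.subgroupI)
    show "setwise_stab C \<subseteq> carrier B" using H_carrier by (auto simp: setwise_stab_def)
    have "\<one>\<^bsub>B\<^esub> \<in> setwise_stab C"
      by (rule setwise_stabI[OF C subgroup.one_closed[OF H_subgroup] x]) (simp add: Bij_one_apply xQ x)
    then show "setwise_stab C \<noteq> {}" by blast
  next
    fix g assume "g \<in> setwise_stab C"
    then have g: "g \<in> H" "g x \<in> C" using x by (auto simp: setwise_stab_def)
    have "(inv\<^bsub>B\<^esub> g) (g x) = x" by (rule Bij_inv_apply(1)[OF H_Bij[OF g(1)] xQ])
    then show "inv\<^bsub>B\<^esub> g \<in> setwise_stab C"
      using setwise_stabI[OF C subgroup.m_inv_closed[OF H_subgroup g(1)] g(2)] x by simp
  next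
    fix g h assume gh: "g \<in> setwise_stab C" "h \<in> setwise_stab C"
    then have H: "g \<in> H" "h \<in> H" by (auto simp: setwise_stab_def)
    have "(g \<otimes>\<^bsub>B\<^esub> h) x = g (h x)" by (rule Bij_mult_apply[OF H_Bij[OF H(1)] H_Bij[OF H(2)] xQ])
    then show "g \<otimes>\<^bsub>B\<^esub> h \<in> setwise_stab C"
      using setwise_stabI[OF C subgroup.m_closed[OF H_subgroup H] x] gh x by (simp add: setwise_stab_def)
  qed
qed

lemma block_action:
  assumes C: "C \<in> Q // \<alpha>"
  shows "group_action (B\<lparr>carrier := setwise_stab C\<rparr>) C (\<lambda>g. restrict g C)"
proof (rule group_actionI)
  show "group (B\<lparr>carrier := setwise_stab C\<rparr>)" by (rule B.subgroup_imp_group[OF setwise_stab_subgroup[OF C]])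
  fix g h x assume g: "g \<in> carrier (B\<lparr>carrier := setwise_stab C\<rparr>)" and h: "h \<in> carrier (B\<lparr>carrier := setwise_stab C\<rparr>)" and x: "x \<in> C"
  then have xQ: "x \<in> Q" "g \<in> Bij Q" "h \<in> Bij Q" "h x \<in> C" using block_sub[OF C] H_Bij by (auto simp: setwise_stab_def)
  then show "restrict (g \<otimes>\<^bsub>B\<lparr>carrier := setwise_stab C\<rparr>\<^esub> h) C x = restrict g C (restrict h C x)"
    using x by (simp add: Bij_mult_apply)
next
  fix x assume "x \<in> C"
  then show "restrict \<one>\<^bsub>B\<lparr>carrier := setwise_stab C\<rparr>\<^esub> C x = x" using block_sub[OF C] by (auto simp: Bij_one_apply)
qed (auto simp: setwise_stab_def)

lemma restrict_aut:
  assumes C: "C \<in> Q // \<alpha>" and g: "g \<in> setwise_stab C"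
  shows "restrict g C \<in> quandle_aut C mul"
proof -
  have "restrict g C \<in> Bij C"
    using group_action.bij_prop0[OF block_action[OF C], of g] g by (simp add: Bij_def)
  moreover have "restrict g C (x \<star> y) = restrict g C x \<star> restrict g C y" if "x \<in> C" "y \<in> C" for x y
    using that g block_closed[OF C] block_sub[OF C] aut_mul[OF H_aut, of g x y] by (auto simp: setwise_stab_def)
  ultimately show ?thesis by (simp add: quandle_aut_def)
qed

lemma block_strictly_simple:
  assumes C: "C \<in> Q // \<alpha>"
  shows "strictly_simple_p_quandle C mul p m"
proof -
  interpret C: quandle C mul using block_proper[OF C] by (simp add: proper_subquandle_def)
  show ?thesis
  proof
    show "finite C" using block_sub[OF C] finite_Q finite_subset by blast
    show "strictly_simple C mul"
      using block_proper[OF C] lss unfolding locally_strictly_simple_def by blast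
    fix x y assume xy: "x \<in> C" "y \<in> C"
    then obtain g where g: "g \<in> G" "g x = y" using G_transitive block_sub[OF C] by blast
    have "g \<in> setwise_stab C" by (rule setwise_stabI[OF C G_H[OF g(1)] xy(1)]) (simp add: g xy)
    then show "\<exists>g\<in>quandle_aut C mul. g x = y"
      by (rule bexI[OF _ restrict_aut[OF C], rotated]) (simp add: g xy)
  qed (use prime_p m_pos card_block[OF C] in auto)
qed

text \<open>Otherwise the block is a projection quandle, all of whose subsets are subquandles; but it has more than
  two elements.\<close>

lemma block_not_projection:
  assumes ab: "(a, b) \<in> \<alpha>" and fp: "a \<star> b = b"
  shows "a = b"
proof (rule ccontr)
  assume ne: "a \<noteq> b"
  have aQ: "a \<in> Q" using alpha_sub ab by blast
  have C: "cls a \<in> Q // \<alpha>" by (rule cls_block[OF aQ])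
  interpret C: strictly_simple_p_quandle "cls a" mul p m by (rule block_strictly_simple[OF C])
  have mem: "a \<in> cls a" "b \<in> cls a" using cls_self[OF aQ] ab by auto
  have proj: "u \<star> v = v" if "u \<in> cls a" "v \<in> cls a" for u v
    by (rule C.projection_if_fixed_point[OF mem ne fp that])
  have "{a, b} = cls a"
    by (rule C.closed_subset_eq[OF _ _ _ _ ne]) (use mem proj in auto)
  then have "card (cls a) \<le> 2" by (metis card_2_iff ne order_refl)
  then show False using card_block[OF C] block_gt_2 by simp
qed


text \<open>The choice of representatives does not matter since \<open>\<alpha>\<close> is a congruence (\<open>factor_mul_cls\<close>).\<close>

definition factor_mul :: "'a set \<Rightarrow> 'a set \<Rightarrow> 'a set" where
  "factor_mul X Y = cls ((SOME x. x \<in> X) \<star> (SOME y. y \<in> Y))"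

lemma some_in_cls: "x \<in> Q \<Longrightarrow> (x, SOME y. y \<in> cls x) \<in> \<alpha>"
proof -
  assume "x \<in> Q"
  then have "\<exists>y. y \<in> cls x" using cls_self by (intro exI)
  then have "(SOME y. y \<in> cls x) \<in> cls x" by (rule someI_ex)
  then show ?thesis by simp
qed

lemma factor_mul_cls: "x \<in> Q \<Longrightarrow> y \<in> Q \<Longrightarrow> factor_mul (cls x) (cls y) = cls (x \<star> y)"
  unfolding factor_mul_def
  by (rule equiv_class_eq[OF alpha_equiv, symmetric]) (rule alpha_mul[OF some_in_cls some_in_cls])

lemma factor_quandle: "quandle (Q // \<alpha>) factor_mul"
proof
  fix X assume X: "X \<in> Q // \<alpha>"
  then obtain a where a: "a \<in> Q" "X = cls a" by (rule blockE)
  have fin: "finite (Q // \<alpha>)" by (rule finite_quotient[OF finite_Q equiv_type[OF alpha_equiv]])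
  have "factor_mul X ` (Q // \<alpha>) \<subseteq> Q // \<alpha>"
  proof (rule image_subsetI)
    fix Y assume "Y \<in> Q // \<alpha>"
    then obtain y where "y \<in> Q" "Y = cls y" by (rule blockE)
    then show "factor_mul X Y \<in> Q // \<alpha>" using factor_mul_cls[OF a(1)] a(2) cls_block mul_closed[OF a(1)] by simp
  qed
  moreover have "inj_on (factor_mul X) (Q // \<alpha>)"
  proof (rule inj_onI)
    fix Y Z assume Y: "Y \<in> Q // \<alpha>" and Z: "Z \<in> Q // \<alpha>" and eq: "factor_mul X Y = factor_mul X Z"
    from Y obtain y where y: "y \<in> Q" "Y = cls y" by (rule blockE)
    from Z obtain z where z: "z \<in> Q" "Z = cls z" by (rule blockE)
    have "cls (a \<star> y) = cls (a \<star> z)" using eq y z a factor_mul_cls by simp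
    then have "(L a y, L a z) \<in> \<alpha>"
      using cls_eq_iff[OF mul_closed[OF a(1) y(1)] mul_closed[OF a(1) z(1)]] y z by (simp add: L_apply)
    then have "(y, z) \<in> \<alpha>" using H_iff[OF L_H[OF a(1)] y(1) z(1)] by simp
    then show "Y = Z" using cls_eq_iff y z by simp
  qed
  ultimately show "bij_betw (factor_mul X) (Q // \<alpha>) (Q // \<alpha>)"
    using endo_inj_surj[OF fin] by (simp add: bij_betw_def)
next
  fix X Y Z assume "X \<in> Q // \<alpha>" "Y \<in> Q // \<alpha>" "Z \<in> Q // \<alpha>"
  then obtain x y z where "x \<in> Q" "X = cls x" "y \<in> Q" "Y = cls y" "z \<in> Q" "Z = cls z"
    by (elim blockE)
  then show "factor_mul X (factor_mul Y Z) = factor_mul (factor_mul X Y) (factor_mul X Z)"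
    using factor_mul_cls mul_closed left_distrib[of x y z] by simp
next
  fix X assume "X \<in> Q // \<alpha>"
  then obtain x where "x \<in> Q" "X = cls x" by (rule blockE)
  then show "factor_mul X X = X" using factor_mul_cls idem by simp
qed

definition factor_map :: "('a \<Rightarrow> 'a) \<Rightarrow> 'a set \<Rightarrow> 'a set" where
  "factor_map g = (\<lambda>X \<in> Q // \<alpha>. cls (g (SOME x. x \<in> X)))"

lemma factor_map_cls:
  assumes g: "g \<in> H" and x: "x \<in> Q"
  shows "factor_map g (cls x) = cls (g x)"
proof -
  have "factor_map g (cls x) = cls (g (SOME y. y \<in> cls x))" using cls_block[OF x] by (simp add: factor_map_def)
  also have "\<dots> = cls (g x)"
    by (rule equiv_class_eq[OF alpha_equiv H_alpha[OF g some_in_cls[OF x]], symmetric])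
  finally show ?thesis .
qed

lemma factor_action: "group_action (B\<lparr>carrier := H\<rparr>) (Q // \<alpha>) factor_map"
proof (rule group_actionI)
  show "group (B\<lparr>carrier := H\<rparr>)" by (rule B.subgroup_imp_group[OF H_subgroup])
  fix g assume "g \<in> carrier (B\<lparr>carrier := H\<rparr>)"
  then have g: "g \<in> H" by simp
  show "factor_map g \<in> extensional (Q // \<alpha>)" by (simp add: factor_map_def)
  fix X assume "X \<in> Q // \<alpha>"
  then obtain x where x: "x \<in> Q" "X = cls x" by (rule blockE)
  then show "factor_map g X \<in> Q // \<alpha>" using factor_map_cls[OF g] H_mem[OF g] cls_block by simp
  fix h assume "h \<in> carrier (B\<lparr>carrier := H\<rparr>)"
  then have h: "h \<in> H" by simp
  have gh: "g \<otimes>\<^bsub>B\<^esub> h \<in> H" by (rule subgroup.m_closed[OF H_subgroup g h])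
  show "factor_map (g \<otimes>\<^bsub>B\<lparr>carrier := H\<rparr>\<^esub> h) X = factor_map g (factor_map h X)"
    using x factor_map_cls[OF g H_mem[OF h x(1)]] factor_map_cls[OF h x(1)] factor_map_cls[OF gh x(1)]
    by (simp add: Bij_mult_apply[OF H_Bij[OF g] H_Bij[OF h]])
next
  fix X assume "X \<in> Q // \<alpha>"
  then obtain x where x: "x \<in> Q" "X = cls x" by (rule blockE)
  then show "factor_map \<one>\<^bsub>B\<lparr>carrier := H\<rparr>\<^esub> X = X"
    using factor_map_cls[OF subgroup.one_closed[OF H_subgroup]] by (simp add: Bij_one_apply)
qed

lemma factor_map_aut: "g \<in> H \<Longrightarrow> factor_map g \<in> quandle_aut (Q // \<alpha>) factor_mul"
proof -
  assume g: "g \<in> H"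
  have "factor_map g \<in> Bij (Q // \<alpha>)"
    using group_action.bij_prop0[OF factor_action, of g] g by (simp add: Bij_def factor_map_def)
  moreover have "factor_map g (factor_mul X Y) = factor_mul (factor_map g X) (factor_map g Y)" if XY: "X \<in> Q // \<alpha>" "Y \<in> Q // \<alpha>" for X Y
  proof -
    from XY(1) obtain x where x: "x \<in> Q" "X = cls x" by (rule blockE)
    from XY(2) obtain y where y: "y \<in> Q" "Y = cls y" by (rule blockE)
    show ?thesis
      using x y factor_map_cls[OF g] factor_mul_cls H_mem[OF g] mul_closed aut_mul[OF H_aut[OF g] x(1) y(1)] by simp
  qed
  ultimately show ?thesis by (simp add: quandle_aut_def)
qed

text \<open>The preimage of a proper subquandle of the factor would be a single block.\<close>

lemma factor_no_proper_subquandle: "\<not> proper_subquandle S (Q // \<alpha>) factor_mul"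
proof
  assume "proper_subquandle S (Q // \<alpha>) factor_mul"
  then obtain X Y where S: "S \<subseteq> Q // \<alpha>" "quandle S factor_mul" "S \<noteq> Q // \<alpha>" and XY: "X \<in> S" "Y \<in> S" "X \<noteq> Y"
    unfolding proper_subquandle_def by blast
  let ?U = "\<Union>S"
  have sub: "?U \<subseteq> Q" using S(1) block_sub by blast
  have clo: "x \<star> y \<in> ?U" if xy: "x \<in> ?U" "y \<in> ?U" for x y
  proof -
    obtain X' where X': "X' \<in> S" "x \<in> X'" using xy(1) by (rule UnionE)
    obtain Y' where Y': "Y' \<in> S" "y \<in> Y'" using xy(2) by (rule UnionE)
    have q: "x \<in> Q" "y \<in> Q" using sub xy by auto
    have "cls x = X'" using block_alpha[OF subsetD[OF S(1) X'(1)] X'(2)] by auto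
    moreover have "cls y = Y'" using block_alpha[OF subsetD[OF S(1) Y'(1)] Y'(2)] by auto
    ultimately have "cls (x \<star> y) \<in> S"
      using quandle.mul_closed[OF S(2) X'(1) Y'(1)] factor_mul_cls[OF q] by simp
    then show ?thesis using cls_self[OF mul_closed[OF q]] by (rule UnionI)
  qed
  have ne: "?U \<noteq> Q"
  proof
    assume U: "?U = Q"
    have "Q // \<alpha> \<subseteq> S"
    proof
      fix Z assume Z: "Z \<in> Q // \<alpha>"
      then obtain z where z: "z \<in> Q" "Z = cls z" by (rule blockE)
      then obtain X' where X': "X' \<in> S" "z \<in> X'" using U by blast
      have "cls z = X'" using block_alpha[OF subsetD[OF S(1) X'(1)] X'(2)] by auto
      then show "Z \<in> S" using X'(1) z(2) by simp
    qed
    then show False using S(1,3) by blast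
  qed
  have "C = ?U" if C: "C \<in> S" for C
    by (rule proper_subquandle_block[OF sub clo ne subsetD[OF S(1) C] Union_upper[OF C]])
  then have "X = Y" using XY(1,2) by metis
  then show False using XY(3) by simp
qed

lemma factor_strictly_simple: "strictly_simple_p_quandle (Q // \<alpha>) factor_mul p n"
proof -
  interpret F: quandle "Q // \<alpha>" factor_mul by (rule factor_quandle)
  show ?thesis
  proof
    show "finite (Q // \<alpha>)" by (rule finite_quotient[OF finite_Q equiv_type[OF alpha_equiv]])
    have "\<not> card (Q // \<alpha>) \<le> Suc 0" using card_factor pn_gt_1 by simp
    then have "\<exists>X\<in>Q // \<alpha>. \<exists>Y\<in>Q // \<alpha>. X \<noteq> Y"
      using card_le_Suc0_iff_eq[OF finite_quotient[OF finite_Q equiv_type[OF alpha_equiv]]] by auto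
    then show "strictly_simple (Q // \<alpha>) factor_mul"
      unfolding strictly_simple_def using factor_quandle factor_no_proper_subquandle by simp
    fix X Y assume X: "X \<in> Q // \<alpha>" and Y: "Y \<in> Q // \<alpha>"
    from X obtain x where x: "x \<in> Q" "X = cls x" by (rule blockE)
    from Y obtain y where y: "y \<in> Q" "Y = cls y" by (rule blockE)
    from G_transitive[OF x(1) y(1)] obtain g where g: "g \<in> G" "g x = y" ..
    have gH: "g \<in> H" by (rule G_H[OF g(1)])
    show "\<exists>g\<in>quandle_aut (Q // \<alpha>) factor_mul. g X = Y"
      by (rule bexI[OF _ factor_map_aut[OF gH]]) (simp add: x y g factor_map_cls[OF gH])
  qed (use prime_p n_pos card_factor in auto)
qed

sublocale F: strictly_simple_p_quandle "Q // \<alpha>" factor_mul p n by (rule factor_strictly_simple)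

lemma factor_map_L: "a \<in> Q \<Longrightarrow> factor_map (L a) = left_mult (Q // \<alpha>) factor_mul (cls a)"
proof (rule Bij_eqI)
  assume a: "a \<in> Q"
  show "factor_map (L a) \<in> Bij (Q // \<alpha>)" by (rule F.aut_Bij[OF factor_map_aut[OF L_H[OF a]]])
  show "left_mult (Q // \<alpha>) factor_mul (cls a) \<in> Bij (Q // \<alpha>)" by (rule F.L_Bij[OF cls_block[OF a]])
  fix X assume X: "X \<in> Q // \<alpha>"
  then obtain x where x: "x \<in> Q" "X = cls x" by (rule blockE)
  show "factor_map (L a) X = left_mult (Q // \<alpha>) factor_mul (cls a) X"
    using X x a factor_map_cls[OF L_H[OF a]] factor_mul_cls by (simp add: L_apply left_mult_def)
qed

sublocale q: group_hom "B\<lparr>carrier := H\<rparr>" "BijGroup (Q // \<alpha>)" factor_map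
  using factor_action by (rule group_action.group_hom)

lemma factor_map_mult: "g \<in> H \<Longrightarrow> h \<in> H \<Longrightarrow> factor_map (g \<otimes>\<^bsub>B\<^esub> h) = factor_map g \<otimes>\<^bsub>BijGroup (Q // \<alpha>)\<^esub> factor_map h"
  using q.hom_mult[of g h] by simp

lemma factor_map_inv: "g \<in> H \<Longrightarrow> factor_map (inv\<^bsub>B\<^esub> g) = inv\<^bsub>BijGroup (Q // \<alpha>)\<^esub> (factor_map g)"
  using q.hom_inv[of g] B.m_inv_consistent[OF H_subgroup, of g] by simp

lemma factor_map_one: "factor_map \<one>\<^bsub>B\<^esub> = \<one>\<^bsub>BijGroup (Q // \<alpha>)\<^esub>"
  using q.hom_one by simp

lemma factor_map_pow: "g \<in> H \<Longrightarrow> factor_map (g [^]\<^bsub>B\<^esub> (k::nat)) = factor_map g [^]\<^bsub>BijGroup (Q // \<alpha>)\<^esub> k"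
  using q.hom_nat_pow[of g k] by (simp add: B.nat_pow_consistent[symmetric])

text \<open>The displacements act through the Frobenius kernel of the factor, hence so does the group that they generate.\<close>

lemma factor_map_T: "g \<in> G \<Longrightarrow> factor_map g \<in> F.T"
proof -
  let ?S = "{g \<in> H. factor_map g \<in> F.T}"
  have "subgroup ?S B"
  proof (rule B.subgroupI)
    show "?S \<subseteq> carrier B" using H_carrier by blast
    have "\<one>\<^bsub>B\<^esub> \<in> ?S" using subgroup.one_closed[OF H_subgroup] subgroup.one_closed[OF F.T_subgroup] factor_map_one by simp
    then show "?S \<noteq> {}" by blast
  next
    fix g assume "g \<in> ?S"
    then show "inv\<^bsub>B\<^esub> g \<in> ?S"
      using subgroup.m_inv_closed[OF H_subgroup, of g] subgroup.m_inv_closed[OF F.T_subgroup, of "factor_map g"] factor_map_inv[of g]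
      by simp
  next
    fix g h assume "g \<in> ?S" "h \<in> ?S"
    then show "g \<otimes>\<^bsub>B\<^esub> h \<in> ?S"
      using subgroup.m_closed[OF H_subgroup, of g h] subgroup.m_closed[OF F.T_subgroup, of "factor_map g" "factor_map h"] factor_map_mult[of g h]
      by simp
  qed
  moreover have "displacement Q mul x y \<in> ?S" if xy: "x \<in> Q" "y \<in> Q" for x y
  proof -
    have "factor_map (displacement Q mul x y) = left_mult (Q // \<alpha>) factor_mul (cls x) \<otimes>\<^bsub>BijGroup (Q // \<alpha>)\<^esub>
      inv\<^bsub>BijGroup (Q // \<alpha>)\<^esub> (left_mult (Q // \<alpha>) factor_mul (cls y))"
      using factor_map_mult[OF L_H[OF xy(1)] subgroup.m_inv_closed[OF H_subgroup L_H[OF xy(2)]]] factor_map_inv[OF L_H[OF xy(2)]]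
        factor_map_L xy by (simp add: displacement_def')
    then show ?thesis
      using F.displacement_in_T[OF cls_block[OF xy(1)] cls_block[OF xy(2)]] displacement_H[OF xy] by simp
  qed
  ultimately have "G \<subseteq> ?S" by (rule G_subset_if_displacements)
  then show "g \<in> G \<Longrightarrow> factor_map g \<in> F.T" by blast
qed

section \<open>The kernel of the action on the factor\<close>

definition K :: "('a \<Rightarrow> 'a) set" where "K = {g \<in> G. \<forall>x\<in>Q. (g x, x) \<in> \<alpha>}"

lemma K_G: "k \<in> K \<Longrightarrow> k \<in> G" by (simp add: K_def)
lemma K_H: "k \<in> K \<Longrightarrow> k \<in> H" using K_G G_H by blast
lemma K_alpha: "k \<in> K \<Longrightarrow> x \<in> Q \<Longrightarrow> (k x, x) \<in> \<alpha>" by (simp add: K_def)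

lemma K_iff_factor_map: "g \<in> G \<Longrightarrow> g \<in> K \<longleftrightarrow> factor_map g = \<one>\<^bsub>BijGroup (Q // \<alpha>)\<^esub>"
proof
  assume g: "g \<in> G"
  have gH: "g \<in> H" by (rule G_H[OF g])
  { assume k: "g \<in> K"
    show "factor_map g = \<one>\<^bsub>BijGroup (Q // \<alpha>)\<^esub>"
    proof (rule Bij_eqI[OF F.aut_Bij[OF factor_map_aut[OF gH]]])
      show "\<one>\<^bsub>BijGroup (Q // \<alpha>)\<^esub> \<in> Bij (Q // \<alpha>)" using F.B.one_closed by (simp add: carrier_BijGroup)
      fix X assume X: "X \<in> Q // \<alpha>"
      then obtain x where x: "x \<in> Q" "X = cls x" by (rule blockE)
      then have "cls (g x) = cls x" using cls_eq_iff[OF H_mem[OF gH x(1)] x(1)] K_alpha[OF k x(1)] by simp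
      then show "factor_map g X = \<one>\<^bsub>BijGroup (Q // \<alpha>)\<^esub> X" using X x factor_map_cls[OF gH x(1)] by (simp add: Bij_one_apply)
    qed }
  { assume q1: "factor_map g = \<one>\<^bsub>BijGroup (Q // \<alpha>)\<^esub>"
    have "(g x, x) \<in> \<alpha>" if x: "x \<in> Q" for x
    proof -
      have "cls (g x) = cls x" using factor_map_cls[OF gH x] q1 cls_block[OF x] by (simp add: Bij_one_apply)
      then show ?thesis using cls_eq_iff[OF H_mem[OF gH x] x] by simp
    qed
    then show "g \<in> K" using g by (simp add: K_def) }
qed

text \<open>An element of the Frobenius kernel of the factor with a fixed point is trivial.\<close>

lemma K_if_fixes_block: "g \<in> G \<Longrightarrow> x \<in> Q \<Longrightarrow> (g x, x) \<in> \<alpha> \<Longrightarrow> g \<in> K"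
proof -
  assume g: "g \<in> G" and x: "x \<in> Q" and gx: "(g x, x) \<in> \<alpha>"
  have gH: "g \<in> H" by (rule G_H[OF g])
  have "factor_map g (cls x) = cls x" using factor_map_cls[OF gH x] cls_eq_iff[OF H_mem[OF gH x] x] gx by simp
  then have "factor_map g = \<one>\<^bsub>BijGroup (Q // \<alpha>)\<^esub>" using factor_map_T[OF g] cls_block[OF x] unfolding F.T_def by blast
  then show ?thesis using K_iff_factor_map[OF g] by simp
qed

lemma K_subgroup: "subgroup K B"
proof (rule B.subgroupI)
  show "K \<subseteq> carrier B" using K_H H_carrier by blast
  have "\<one>\<^bsub>B\<^esub> \<in> K" using K_iff_factor_map[OF subgroup.one_closed[OF G_subgroup]] factor_map_one by simp
  then show "K \<noteq> {}" by blast
next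
  fix g assume g: "g \<in> K"
  then have q1: "factor_map g = \<one>\<^bsub>BijGroup (Q // \<alpha>)\<^esub>" using K_iff_factor_map K_G by blast
  have "factor_map (inv\<^bsub>B\<^esub> g) = \<one>\<^bsub>BijGroup (Q // \<alpha>)\<^esub>" using factor_map_inv[OF K_H[OF g]] q1 by simp
  then show "inv\<^bsub>B\<^esub> g \<in> K" using K_iff_factor_map[OF subgroup.m_inv_closed[OF G_subgroup K_G[OF g]]] by simp
next
  fix g h assume g: "g \<in> K" and h: "h \<in> K"
  have q1: "factor_map g = \<one>\<^bsub>BijGroup (Q // \<alpha>)\<^esub>" "factor_map h = \<one>\<^bsub>BijGroup (Q // \<alpha>)\<^esub>"
    using K_iff_factor_map K_G g h by blast+
  have "factor_map (g \<otimes>\<^bsub>B\<^esub> h) = \<one>\<^bsub>BijGroup (Q // \<alpha>)\<^esub>" using factor_map_mult[OF K_H[OF g] K_H[OF h]] q1 by simp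
  then show "g \<otimes>\<^bsub>B\<^esub> h \<in> K" using K_iff_factor_map[OF subgroup.m_closed[OF G_subgroup K_G[OF g] K_G[OF h]]] by simp
qed

lemma conj_apply:
  assumes "g \<in> H" "t \<in> H" "x \<in> Q"
  shows "(g \<otimes>\<^bsub>B\<^esub> t \<otimes>\<^bsub>B\<^esub> inv\<^bsub>B\<^esub> g) x = g (t ((inv\<^bsub>B\<^esub> g) x))"
proof -
  have Bij: "g \<in> Bij Q" "t \<in> Bij Q" using assms H_Bij by auto
  have "g \<otimes>\<^bsub>B\<^esub> t \<in> Bij Q" using Bij B.m_closed by (simp add: carrier_BijGroup)
  then show ?thesis using Bij assms(3) by (simp add: Bij_mult_apply Bij_inv_closed Bij_inv_mem)
qed

lemma H_inv_mem: "g \<in> H \<Longrightarrow> x \<in> Q \<Longrightarrow> (inv\<^bsub>B\<^esub> g) x \<in> Q" by (rule Bij_inv_mem[OF H_Bij])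

lemma H_inv_apply:
  "g \<in> H \<Longrightarrow> x \<in> Q \<Longrightarrow> (inv\<^bsub>B\<^esub> g) (g x) = x"
  "g \<in> H \<Longrightarrow> x \<in> Q \<Longrightarrow> g ((inv\<^bsub>B\<^esub> g) x) = x"
  using Bij_inv_apply[OF H_Bij] by auto

lemma K_normal:
  assumes g: "g \<in> H" and k: "k \<in> K"
  shows "g \<otimes>\<^bsub>B\<^esub> k \<otimes>\<^bsub>B\<^esub> inv\<^bsub>B\<^esub> g \<in> K"
  unfolding K_def
proof (intro CollectI conjI ballI G_normal[OF g K_G[OF k]])
  fix x assume x: "x \<in> Q"
  have "(g (k ((inv\<^bsub>B\<^esub> g) x)), g ((inv\<^bsub>B\<^esub> g) x)) \<in> \<alpha>"
    by (rule H_alpha[OF g K_alpha[OF k H_inv_mem[OF g x]]])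
  then show "((g \<otimes>\<^bsub>B\<^esub> k \<otimes>\<^bsub>B\<^esub> inv\<^bsub>B\<^esub> g) x, x) \<in> \<alpha>"
    using conj_apply[OF g K_H[OF k] x] H_inv_apply(2)[OF g x] by simp
qed

lemma commutator_K:
  assumes g: "g \<in> G" and h: "h \<in> G"
  shows "g \<otimes>\<^bsub>B\<^esub> h \<otimes>\<^bsub>B\<^esub> inv\<^bsub>B\<^esub> g \<otimes>\<^bsub>B\<^esub> inv\<^bsub>B\<^esub> h \<in> K"
proof -
  let ?F = "BijGroup (Q // \<alpha>)"
  have H: "g \<in> H" "h \<in> H" using G_H g h by auto
  have Hi: "inv\<^bsub>B\<^esub> g \<in> H" "inv\<^bsub>B\<^esub> h \<in> H" "g \<otimes>\<^bsub>B\<^esub> h \<in> H" "g \<otimes>\<^bsub>B\<^esub> h \<otimes>\<^bsub>B\<^esub> inv\<^bsub>B\<^esub> g \<in> H"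
    using H H_subgroup by (simp_all add: subgroup.m_closed subgroup.m_inv_closed)
  have c: "factor_map g \<in> carrier ?F" "factor_map h \<in> carrier ?F" using factor_map_T g h F.T_carrier by auto
  have "factor_map (g \<otimes>\<^bsub>B\<^esub> h \<otimes>\<^bsub>B\<^esub> inv\<^bsub>B\<^esub> g \<otimes>\<^bsub>B\<^esub> inv\<^bsub>B\<^esub> h)
      = (factor_map g \<otimes>\<^bsub>?F\<^esub> factor_map h) \<otimes>\<^bsub>?F\<^esub> inv\<^bsub>?F\<^esub> (factor_map g) \<otimes>\<^bsub>?F\<^esub> inv\<^bsub>?F\<^esub> (factor_map h)"
    using H Hi by (simp only: factor_map_mult factor_map_inv)
  also have "factor_map g \<otimes>\<^bsub>?F\<^esub> factor_map h = factor_map h \<otimes>\<^bsub>?F\<^esub> factor_map g" by (rule F.T_comm[OF factor_map_T[OF g] factor_map_T[OF h]])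
  also have "(factor_map h \<otimes>\<^bsub>?F\<^esub> factor_map g) \<otimes>\<^bsub>?F\<^esub> inv\<^bsub>?F\<^esub> (factor_map g) \<otimes>\<^bsub>?F\<^esub> inv\<^bsub>?F\<^esub> (factor_map h) = \<one>\<^bsub>?F\<^esub>"
    using c by (simp add: F.B.m_assoc)
  finally show ?thesis
    using K_iff_factor_map[of "g \<otimes>\<^bsub>B\<^esub> h \<otimes>\<^bsub>B\<^esub> inv\<^bsub>B\<^esub> g \<otimes>\<^bsub>B\<^esub> inv\<^bsub>B\<^esub> h"] g h G_subgroup
    by (simp add: subgroup.m_closed subgroup.m_inv_closed)
qed

lemma subgroup_nat_pow: "subgroup S B \<Longrightarrow> g \<in> S \<Longrightarrow> g [^]\<^bsub>B\<^esub> (k::nat) \<in> S"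
  by (induction k) (auto simp: subgroup.one_closed subgroup.m_closed)

lemma p_power_K: "g \<in> G \<Longrightarrow> g [^]\<^bsub>B\<^esub> p \<in> K"
  using K_iff_factor_map[OF subgroup_nat_pow[OF G_subgroup]] factor_map_pow[OF G_H] F.T_pow[OF factor_map_T] by simp

text \<open>Otherwise every displacement would fix all blocks, against transitivity.\<close>

lemma factor_not_projection: "\<exists>X \<in> Q // \<alpha>. \<exists>Y \<in> Q // \<alpha>. factor_mul X Y \<noteq> Y"
proof (rule ccontr)
  assume nex: "\<not> ?thesis"
  have L1: "factor_map (L a) = \<one>\<^bsub>BijGroup (Q // \<alpha>)\<^esub>" if a: "a \<in> Q" for a
  proof (rule Bij_eqI[OF F.aut_Bij[OF factor_map_aut[OF L_H[OF a]]]])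
    show "\<one>\<^bsub>BijGroup (Q // \<alpha>)\<^esub> \<in> Bij (Q // \<alpha>)" using F.B.one_closed by (simp add: carrier_BijGroup)
    fix X assume X: "X \<in> Q // \<alpha>"
    have "factor_mul (cls a) X = X" using nex X cls_block[OF a] by meson
    then show "factor_map (L a) X = \<one>\<^bsub>BijGroup (Q // \<alpha>)\<^esub> X" using X factor_map_L[OF a] by (simp add: left_mult_def Bij_one_apply)
  qed
  have "displacement Q mul x y \<in> K" if xy: "x \<in> Q" "y \<in> Q" for x y
  proof -
    have "factor_map (displacement Q mul x y) = \<one>\<^bsub>BijGroup (Q // \<alpha>)\<^esub>"
      using factor_map_mult[OF L_H[OF xy(1)] subgroup.m_inv_closed[OF H_subgroup L_H[OF xy(2)]]] factor_map_inv[OF L_H[OF xy(2)]]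
        L1 xy by (simp add: displacement_def')
    then show ?thesis using K_iff_factor_map[OF displacement_G[OF xy]] by simp
  qed
  then have GK: "G \<subseteq> K" by (rule G_subset_if_displacements[OF K_subgroup])
  have "(x, y) \<in> \<alpha>" if xy: "x \<in> Q" "y \<in> Q" for x y
  proof -
    from G_transitive[OF xy] obtain g where g: "g \<in> G" "g x = y" ..
    then have "(y, x) \<in> \<alpha>" using K_alpha[OF subsetD[OF GK g(1)] xy(1)] by simp
    then show ?thesis by (rule alpha_sym)
  qed
  then have "\<alpha> = Q \<times> Q" using alpha_sub by auto
  then show False using alpha_congruence(3) by simp
qed

lemma factor_right_cancel:
  assumes Q: "b \<in> Q" "c \<in> Q" "a \<in> Q" and eq: "b \<star> a = c \<star> a"
  shows "(b, c) \<in> \<alpha>"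
proof -
  obtain X Y where XY: "X \<in> Q // \<alpha>" "Y \<in> Q // \<alpha>" "factor_mul X Y \<noteq> Y" using factor_not_projection by blast
  have "cls b = cls c"
    by (rule F.right_cancel[OF XY cls_block[OF Q(1)] cls_block[OF Q(2)] cls_block[OF Q(3)]])
      (simp add: factor_mul_cls Q eq)
  then show ?thesis using cls_eq_iff Q by simp
qed


section \<open>Orbits of invariant subgroups\<close>

text \<open>If \<open>b = s a\<close> and \<open>d = t c\<close>, then \<open>b \<star> d\<close> is the image of \<open>a \<star> c\<close> under \<open>s\<close> times the conjugate of
  \<open>s\<inverse>t\<close> by \<open>L\<^sub>a\<close>. The same computation with the inverse of \<open>L\<^sub>a\<close> handles left division.\<close>

lemma orbit_congruence:
  assumes S: "subgroup S B" "S \<subseteq> H" and normal: "\<And>g s. g \<in> H \<Longrightarrow> s \<in> S \<Longrightarrow> g \<otimes>\<^bsub>B\<^esub> s \<otimes>\<^bsub>B\<^esub> inv\<^bsub>B\<^esub> g \<in> S"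
  shows "quandle_congruence Q mul {(x, y) \<in> Q \<times> Q. \<exists>s\<in>S. s x = y}" (is "quandle_congruence Q mul ?R")
proof -
  have SH: "s \<in> H" if "s \<in> S" for s using S(2) that by blast
  have RI: "(x, y) \<in> ?R" if "x \<in> Q" "s \<in> S" "s x = y" for x y s
    using that H_mem[OF SH[OF that(2)] that(1)] by auto
  have eqv: "equiv Q ?R"
  proof (rule equivI)
    show "?R \<subseteq> Q \<times> Q" by blast
    show "refl_on Q ?R"
    proof (rule refl_onI)
      fix x assume x: "x \<in> Q"
      show "(x, x) \<in> ?R" by (rule RI[OF x subgroup.one_closed[OF S(1)]]) (simp add: Bij_one_apply x)
    qed
    show "sym ?R"
    proof (rule symI)
      fix x y assume "(x, y) \<in> ?R"
      then obtain s where s: "x \<in> Q" "y \<in> Q" "s \<in> S" "s x = y" by blast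
      show "(y, x) \<in> ?R"
        by (rule RI[OF s(2) subgroup.m_inv_closed[OF S(1) s(3)]])
          (use H_inv_apply(1)[OF SH[OF s(3)] s(1)] s(4) in simp)
    qed
    show "trans ?R"
    proof (rule transI)
      fix x y z assume "(x, y) \<in> ?R" "(y, z) \<in> ?R"
      then obtain s t where s: "x \<in> Q" "s \<in> S" "s x = y" and t: "t \<in> S" "t y = z" by blast
      show "(x, z) \<in> ?R"
        by (rule RI[OF s(1) subgroup.m_closed[OF S(1) t(1) s(2)]])
          (use Bij_mult_apply[OF H_Bij[OF SH[OF t(1)]] H_Bij[OF SH[OF s(2)]] s(1)] s t in simp)
    qed
  qed
  have compat: "(a \<star> c, b \<star> d) \<in> ?R \<and> (left_div Q mul a c, left_div Q mul b d) \<in> ?R"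
    if ab: "(a, b) \<in> ?R" and cd: "(c, d) \<in> ?R" for a b c d
  proof -
    from ab obtain s where s: "a \<in> Q" "s \<in> S" "s a = b" by blast
    from cd obtain t where t: "c \<in> Q" "t \<in> S" "t c = d" by blast
    have bQ: "b \<in> Q" and dQ: "d \<in> Q" using ab cd by auto
    let ?i = "inv\<^bsub>B\<^esub> s"
    let ?w = "?i \<otimes>\<^bsub>B\<^esub> t"
    have iS: "?i \<in> S" by (rule subgroup.m_inv_closed[OF S(1) s(2)])
    have wS: "?w \<in> S" by (rule subgroup.m_closed[OF S(1) iS t(2)])
    have La: "L a \<in> H" by (rule L_H[OF s(1)])
    have Lai: "inv\<^bsub>B\<^esub> (L a) \<in> H" by (rule subgroup.m_inv_closed[OF H_subgroup La])
    have sQ: "s x \<in> Q" if "x \<in> Q" for x by (rule H_mem[OF SH[OF s(2)] that])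
    have wc: "?w c = ?i d"
      using Bij_mult_apply[OF H_Bij[OF SH[OF iS]] H_Bij[OF SH[OF t(2)]] t(1)] t(3) by simp
    have idQ: "?i d \<in> Q" by (rule H_inv_mem[OF SH[OF s(2)] dQ])
    have sid: "s (?i d) = d" by (rule H_inv_apply(2)[OF SH[OF s(2)] dQ])
    \<comment> \<open>With \<open>g = L a\<close> this is the case of multiplication, with the inverse of \<open>L a\<close> that of division.\<close>
    have step: "\<exists>r \<in> S. r (g c) = s (g (?i d))" if g: "g \<in> H" for g
    proof -
      have gc: "g c \<in> Q" by (rule H_mem[OF g t(1)])
      let ?v = "g \<otimes>\<^bsub>B\<^esub> ?w \<otimes>\<^bsub>B\<^esub> inv\<^bsub>B\<^esub> g"
      have vS: "?v \<in> S" by (rule normal[OF g wS])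
      have "?v (g c) = g (?i d)"
        using conj_apply[OF g SH[OF wS] gc] H_inv_apply(1)[OF g t(1)] wc by simp
      then have "(s \<otimes>\<^bsub>B\<^esub> ?v) (g c) = s (g (?i d))"
        using Bij_mult_apply[OF H_Bij[OF SH[OF s(2)]] H_Bij[OF SH[OF vS]] gc] by simp
      then show ?thesis using subgroup.m_closed[OF S(1) s(2) vS] by (rule bexI)
    qed
    from step[OF La] obtain r where r: "r \<in> S" "r (L a c) = s (L a (?i d))" ..
    have "s (L a (?i d)) = b \<star> d"
      using aut_mul[OF H_aut[OF SH[OF s(2)]] s(1) idQ] sid s(3) idQ by (simp add: L_apply)
    then have "r (a \<star> c) = b \<star> d" using r(2) t(1) by (simp add: L_apply)
    then have 1: "(a \<star> c, b \<star> d) \<in> ?R" using RI[OF mul_closed[OF s(1) t(1)] r(1)] by simp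
    from step[OF Lai] obtain r where r: "r \<in> S" "r ((inv\<^bsub>B\<^esub> (L a)) c) = s ((inv\<^bsub>B\<^esub> (L a)) (?i d))" ..
    let ?u = "(inv\<^bsub>B\<^esub> (L a)) (?i d)"
    have uQ: "?u \<in> Q" by (rule H_mem[OF Lai idQ])
    have "L b (s ?u) = s (L a ?u)"
      using aut_mul[OF H_aut[OF SH[OF s(2)]] s(1) uQ] s(3) uQ sQ[OF uQ] by (simp add: L_apply)
    also have "\<dots> = d" using H_inv_apply(2)[OF La idQ] sid by simp
    finally have "s ?u = (inv\<^bsub>B\<^esub> (L b)) d" using H_inv_apply(1)[OF L_H[OF bQ] sQ[OF uQ]] by simp
    then have eq: "r (left_div Q mul a c) = left_div Q mul b d"
      using r(2) left_div_eq[OF s(1) t(1)] left_div_eq[OF bQ dQ] by simp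
    have ldQ: "left_div Q mul a c \<in> Q" using left_div_eq[OF s(1) t(1)] H_mem[OF Lai t(1)] by simp
    from 1 RI[OF ldQ r(1) eq] show ?thesis by (rule conjI)
  qed
  show ?thesis
    unfolding quandle_congruence_def
  proof (rule conjI[OF eqv], intro allI impI)
    fix a b c d assume r: "(a, b) \<in> ?R \<and> (c, d) \<in> ?R"
    show "(a \<star> c, b \<star> d) \<in> ?R \<and> (left_div Q mul a c, left_div Q mul b d) \<in> ?R"
      by (rule compat[OF conjunct1[OF r] conjunct2[OF r]])
  qed
qed

text \<open>The orbit relation is a congruence; it is not equality because of \<open>s\<close>, nor total because of \<open>u\<close> and \<open>v\<close>.\<close>

lemma orbits_eq_alpha:
  assumes S: "subgroup S B" "S \<subseteq> H" and normal: "\<And>g s. g \<in> H \<Longrightarrow> s \<in> S \<Longrightarrow> g \<otimes>\<^bsub>B\<^esub> s \<otimes>\<^bsub>B\<^esub> inv\<^bsub>B\<^esub> g \<in> S"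
    and nontriv: "s \<in> S" "s \<noteq> \<one>\<^bsub>B\<^esub>"
    and intrans: "u \<in> Q" "v \<in> Q" "\<forall>t \<in> S. t u \<noteq> v"
  shows "x \<in> Q \<Longrightarrow> y \<in> Q \<Longrightarrow> (\<exists>s \<in> S. s x = y) \<longleftrightarrow> (x, y) \<in> \<alpha>"
proof -
  let ?R = "{(x, y) \<in> Q \<times> Q. \<exists>s\<in>S. s x = y}"
  have "?R = \<alpha>"
  proof (rule alpha_unique)
    show "quandle_congruence Q mul ?R" by (rule orbit_congruence[OF S normal])
    show "?R \<noteq> Q \<times> Q"
    proof
      assume R: "?R = Q \<times> Q"
      have "(u, v) \<in> ?R" unfolding R using intrans(1,2) by (rule SigmaI)
      then obtain t where t: "t \<in> S" "t u = v" by auto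
      from bspec[OF intrans(3) t(1)] t(2) show False by (rule notE)
    qed
    show "?R \<noteq> Id_on Q"
    proof
      assume R: "?R = Id_on Q"
      have "s = \<one>\<^bsub>B\<^esub>"
      proof (rule Bij_eqI)
        show "s \<in> Bij Q" by (rule H_Bij[OF subsetD[OF S(2) nontriv(1)]])
        show "\<one>\<^bsub>B\<^esub> \<in> Bij Q" using B.one_closed by (simp add: carrier_BijGroup)
        fix x assume x: "x \<in> Q"
        have "s x \<in> Q" by (rule H_mem[OF subsetD[OF S(2) nontriv(1)] x])
        then have "(x, s x) \<in> ?R" using x nontriv(1) by auto
        then have "(x, s x) \<in> Id_on Q" unfolding R .
        then show "s x = \<one>\<^bsub>B\<^esub> x" using x by (simp add: Bij_one_apply Id_on_iff)
      qed
      then show False using nontriv(2) by simp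
    qed
  qed
  then have "(x, y) \<in> ?R \<longleftrightarrow> (x, y) \<in> \<alpha>" by simp
  then show "x \<in> Q \<Longrightarrow> y \<in> Q \<Longrightarrow> (\<exists>s \<in> S. s x = y) \<longleftrightarrow> (x, y) \<in> \<alpha>" by simp
qed

lemma alpha_intransitive: "\<exists>u \<in> Q. \<exists>v \<in> Q. (u, v) \<notin> \<alpha>"
proof (rule ccontr)
  assume "\<not> ?thesis"
  then have "\<alpha> = Q \<times> Q" using alpha_sub by auto
  then show False using alpha_congruence(3) by simp
qed

lemma transitive_on_blocks:
  assumes S: "subgroup S B" "S \<subseteq> K" and normal: "\<And>g s. g \<in> H \<Longrightarrow> s \<in> S \<Longrightarrow> g \<otimes>\<^bsub>B\<^esub> s \<otimes>\<^bsub>B\<^esub> inv\<^bsub>B\<^esub> g \<in> S"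
    and nontriv: "s \<in> S" "s \<noteq> \<one>\<^bsub>B\<^esub>" and xy: "(x, y) \<in> \<alpha>"
  shows "\<exists>s \<in> S. s x = y"
proof -
  obtain u v where uv: "u \<in> Q" "v \<in> Q" "(u, v) \<notin> \<alpha>" using alpha_intransitive by blast
  have SH: "S \<subseteq> H" using S(2) K_H by blast
  have intrans: "\<forall>t \<in> S. t u \<noteq> v"
  proof (rule ballI, rule notI)
    fix t assume t: "t \<in> S"
    assume "t u = v"
    then have "(v, u) \<in> \<alpha>" using K_alpha[OF subsetD[OF S(2) t] uv(1)] by simp
    then show False using uv(3) alpha_sym by blast
  qed
  have "(\<exists>s \<in> S. s x = y) \<longleftrightarrow> (x, y) \<in> \<alpha>"
    by (rule orbits_eq_alpha[OF S(1) SH normal nontriv uv(1,2) intrans])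
      (use alpha_sub[OF xy] in auto)
  then show ?thesis using xy by (rule iffD2)
qed

section \<open>The subgroup acting by translations on each block\<close>

text \<open>The condition says that on each block \<open>k\<close> is the identity or has no fixed point, that is, it belongs
  to the Frobenius kernel of the block.\<close>

definition N :: "('a \<Rightarrow> 'a) set" where
  "N = {k \<in> K. \<forall>x y. k x = x \<longrightarrow> (x, y) \<in> \<alpha> \<longrightarrow> k y = y}"

lemma N_K: "k \<in> N \<Longrightarrow> k \<in> K" by (simp add: N_def)

lemma K_setwise_stab: "k \<in> K \<Longrightarrow> C \<in> Q // \<alpha> \<Longrightarrow> k \<in> setwise_stab C"
proof -
  assume k: "k \<in> K" and C: "C \<in> Q // \<alpha>"
  from C obtain x where x: "x \<in> C" "x \<in> Q" by (rule block_nonempty)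
  show "k \<in> setwise_stab C"
    by (rule setwise_stabI[OF C K_H[OF k] x(1)]) (simp add: block_alpha[OF C x(1)] alpha_sym[OF K_alpha[OF k x(2)]])
qed

lemma restrict_mult:
  "C \<in> Q // \<alpha> \<Longrightarrow> g \<in> setwise_stab C \<Longrightarrow> h \<in> setwise_stab C \<Longrightarrow>
    restrict (g \<otimes>\<^bsub>B\<^esub> h) C = restrict g C \<otimes>\<^bsub>BijGroup C\<^esub> restrict h C"
  using group_hom.hom_mult[OF group_action.group_hom[OF block_action], of C g h] by simp

lemma restrict_inv:
  "C \<in> Q // \<alpha> \<Longrightarrow> g \<in> setwise_stab C \<Longrightarrow> restrict (inv\<^bsub>B\<^esub> g) C = inv\<^bsub>BijGroup C\<^esub> (restrict g C)"
  using group_hom.hom_inv[OF group_action.group_hom[OF block_action], of C g]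
    B.m_inv_consistent[OF setwise_stab_subgroup, of C g] by simp

lemma restrict_one: "C \<in> Q // \<alpha> \<Longrightarrow> restrict \<one>\<^bsub>B\<^esub> C = \<one>\<^bsub>BijGroup C\<^esub>"
  using group_hom.hom_one[OF group_action.group_hom[OF block_action], of C] by simp

lemma restrict_pow:
  "C \<in> Q // \<alpha> \<Longrightarrow> g \<in> setwise_stab C \<Longrightarrow> restrict (g [^]\<^bsub>B\<^esub> (i::nat)) C = restrict g C [^]\<^bsub>BijGroup C\<^esub> i"
  using group_hom.hom_nat_pow[OF group_action.group_hom[OF block_action], of C g i]
  by (simp add: B.nat_pow_consistent[symmetric])

lemma N_iff_T:
  assumes k: "k \<in> K"
  shows "k \<in> N \<longleftrightarrow> (\<forall>C \<in> Q // \<alpha>. restrict k C \<in> strictly_simple_p_quandle.T C mul)"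
proof
  assume kN: "k \<in> N"
  show "\<forall>C \<in> Q // \<alpha>. restrict k C \<in> strictly_simple_p_quandle.T C mul"
  proof
    fix C assume C: "C \<in> Q // \<alpha>"
    interpret C: strictly_simple_p_quandle C mul p m by (rule block_strictly_simple[OF C])
    have aut: "restrict k C \<in> quandle_aut C mul" by (rule restrict_aut[OF C K_setwise_stab[OF k C]])
    have "restrict k C = \<one>\<^bsub>BijGroup C\<^esub>" if x: "x \<in> C" "k x = x" for x
    proof (rule Bij_eqI[OF C.aut_Bij[OF aut]])
      show "\<one>\<^bsub>BijGroup C\<^esub> \<in> Bij C" using C.B.one_closed by (simp add: carrier_BijGroup)
      fix y assume y: "y \<in> C"
      then have "(x, y) \<in> \<alpha>" using block_alpha[OF C x(1)] by simp
      then have "k y = y" using kN x(2) unfolding N_def by blast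
      then show "restrict k C y = \<one>\<^bsub>BijGroup C\<^esub> y" using y by (simp add: Bij_one_apply)
    qed
    then show "restrict k C \<in> C.T" using aut unfolding C.T_def by fastforce
  qed
next
  assume T: "\<forall>C \<in> Q // \<alpha>. restrict k C \<in> strictly_simple_p_quandle.T C mul"
  show "k \<in> N" unfolding N_def
  proof (intro CollectI conjI allI impI k)
    fix x y assume x: "k x = x" and xy: "(x, y) \<in> \<alpha>"
    have xQ: "x \<in> Q" using alpha_sub[OF xy] by blast
    let ?C = "cls x"
    have C: "?C \<in> Q // \<alpha>" by (rule cls_block[OF xQ])
    interpret C: strictly_simple_p_quandle ?C mul p m by (rule block_strictly_simple[OF C])
    have "restrict k ?C \<in> C.T" using T C by blast
    moreover have "restrict k ?C x = x" using x cls_self[OF xQ] by simp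
    ultimately have "restrict k ?C = \<one>\<^bsub>BijGroup ?C\<^esub>" using cls_self[OF xQ] unfolding C.T_def by blast
    then have "restrict k ?C y = y" using xy by (simp add: Bij_one_apply)
    then show "k y = y" using xy by simp
  qed
qed

lemma N_restrict_T: "k \<in> N \<Longrightarrow> C \<in> Q // \<alpha> \<Longrightarrow> restrict k C \<in> strictly_simple_p_quandle.T C mul"
  using N_iff_T[OF N_K] by blast

lemma N_subgroup: "subgroup N B"
proof (rule B.subgroupI)
  show "N \<subseteq> carrier B" using N_K K_H H_carrier by blast
  have "\<one>\<^bsub>B\<^esub> \<in> N"
    unfolding N_def using subgroup.one_closed[OF K_subgroup] alpha_sub by (auto simp: Bij_one_apply)
  then show "N \<noteq> {}" by blast
next
  fix g assume g: "g \<in> N"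
  have "restrict (inv\<^bsub>B\<^esub> g) C \<in> strictly_simple_p_quandle.T C mul" if C: "C \<in> Q // \<alpha>" for C
  proof -
    interpret C: strictly_simple_p_quandle C mul p m by (rule block_strictly_simple[OF C])
    show ?thesis
      using restrict_inv[OF C K_setwise_stab[OF N_K[OF g] C]] subgroup.m_inv_closed[OF C.T_subgroup N_restrict_T[OF g C]] by simp
  qed
  then show "inv\<^bsub>B\<^esub> g \<in> N" using N_iff_T[OF subgroup.m_inv_closed[OF K_subgroup N_K[OF g]]] by blast
next
  fix g h assume g: "g \<in> N" and h: "h \<in> N"
  have "restrict (g \<otimes>\<^bsub>B\<^esub> h) C \<in> strictly_simple_p_quandle.T C mul" if C: "C \<in> Q // \<alpha>" for C
  proof -
    interpret C: strictly_simple_p_quandle C mul p m by (rule block_strictly_simple[OF C])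
    show ?thesis
      using restrict_mult[OF C K_setwise_stab[OF N_K[OF g] C] K_setwise_stab[OF N_K[OF h] C]]
        subgroup.m_closed[OF C.T_subgroup N_restrict_T[OF g C] N_restrict_T[OF h C]] by simp
  qed
  then show "g \<otimes>\<^bsub>B\<^esub> h \<in> N" using N_iff_T[OF subgroup.m_closed[OF K_subgroup N_K[OF g] N_K[OF h]]] by blast
qed

lemma eq_if_eq_on_blocks:
  assumes "g \<in> K" "h \<in> K" "\<And>C. C \<in> Q // \<alpha> \<Longrightarrow> restrict g C = restrict h C"
  shows "g = h"
proof (rule Bij_eqI[OF H_Bij[OF K_H[OF assms(1)]] H_Bij[OF K_H[OF assms(2)]]])
  fix x assume x: "x \<in> Q"
  have "restrict g (cls x) x = restrict h (cls x) x" using assms(3)[OF cls_block[OF x]] by simp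
  then show "g x = h x" using cls_self[OF x] by simp
qed

lemma N_comm:
  assumes g: "g \<in> N" and h: "h \<in> N"
  shows "g \<otimes>\<^bsub>B\<^esub> h = h \<otimes>\<^bsub>B\<^esub> g"
proof (rule eq_if_eq_on_blocks)
  show "g \<otimes>\<^bsub>B\<^esub> h \<in> K" "h \<otimes>\<^bsub>B\<^esub> g \<in> K"
    using subgroup.m_closed[OF K_subgroup] N_K[OF g] N_K[OF h] by auto
  fix C assume C: "C \<in> Q // \<alpha>"
  interpret C: strictly_simple_p_quandle C mul p m by (rule block_strictly_simple[OF C])
  have HC: "g \<in> setwise_stab C" "h \<in> setwise_stab C" using K_setwise_stab[OF N_K C] g h by auto
  show "restrict (g \<otimes>\<^bsub>B\<^esub> h) C = restrict (h \<otimes>\<^bsub>B\<^esub> g) C"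
    unfolding restrict_mult[OF C HC] restrict_mult[OF C HC(2,1)]
    by (rule C.T_comm[OF N_restrict_T[OF g C] N_restrict_T[OF h C]])
qed

lemma N_pow:
  assumes g: "g \<in> N"
  shows "g [^]\<^bsub>B\<^esub> p = \<one>\<^bsub>B\<^esub>"
proof (rule eq_if_eq_on_blocks)
  show "g [^]\<^bsub>B\<^esub> p \<in> K" by (rule subgroup_nat_pow[OF K_subgroup N_K[OF g]])
  show "\<one>\<^bsub>B\<^esub> \<in> K" by (rule subgroup.one_closed[OF K_subgroup])
  fix C assume C: "C \<in> Q // \<alpha>"
  interpret C: strictly_simple_p_quandle C mul p m by (rule block_strictly_simple[OF C])
  show "restrict (g [^]\<^bsub>B\<^esub> p) C = restrict \<one>\<^bsub>B\<^esub> C"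
    unfolding restrict_pow[OF C K_setwise_stab[OF N_K[OF g] C]] restrict_one[OF C]
    by (rule C.T_pow[OF N_restrict_T[OF g C]])
qed

text \<open>In the automorphism group of a block, point stabilizers have order prime to \<open>p\<close>.\<close>

lemma p_element_N:
  assumes k: "k \<in> K" and pow: "k [^]\<^bsub>B\<^esub> (p ^ j) = \<one>\<^bsub>B\<^esub>"
  shows "k \<in> N"
  unfolding N_def
proof (intro CollectI conjI allI impI k)
  fix x y assume x: "k x = x" and xy: "(x, y) \<in> \<alpha>"
  have xQ: "x \<in> Q" using alpha_sub[OF xy] by blast
  let ?C = "cls x"
  have C: "?C \<in> Q // \<alpha>" by (rule cls_block[OF xQ])
  interpret C: strictly_simple_p_quandle ?C mul p m by (rule block_strictly_simple[OF C])
  have HC: "k \<in> setwise_stab ?C" by (rule K_setwise_stab[OF k C])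
  have "restrict k ?C = \<one>\<^bsub>BijGroup ?C\<^esub>"
  proof (rule C.p_element_with_fixed_point[OF restrict_aut[OF C HC] cls_self[OF xQ]])
    show "restrict k ?C x = x" using x cls_self[OF xQ] by simp
    show "restrict k ?C [^]\<^bsub>BijGroup ?C\<^esub> (p ^ j) = \<one>\<^bsub>BijGroup ?C\<^esub>"
      using restrict_pow[OF C HC, of "p ^ j"] restrict_one[OF C] pow by simp
  qed
  then have "restrict k ?C y = y" using xy by (simp add: Bij_one_apply)
  then show "k y = y" using xy by simp
qed

lemma N_normal:
  assumes g: "g \<in> H" and k: "k \<in> N"
  shows "g \<otimes>\<^bsub>B\<^esub> k \<otimes>\<^bsub>B\<^esub> inv\<^bsub>B\<^esub> g \<in> N"
  unfolding N_def
proof (intro CollectI conjI allI impI K_normal[OF g N_K[OF k]])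
  let ?c = "g \<otimes>\<^bsub>B\<^esub> k \<otimes>\<^bsub>B\<^esub> inv\<^bsub>B\<^esub> g" and ?i = "inv\<^bsub>B\<^esub> g"
  fix x y assume x: "?c x = x" and xy: "(x, y) \<in> \<alpha>"
  have Q: "x \<in> Q" "y \<in> Q" using alpha_sub[OF xy] by auto
  have kH: "k \<in> H" by (rule K_H[OF N_K[OF k]])
  have "g (k (?i x)) = x" using conj_apply[OF g kH Q(1)] x by simp
  then have "k (?i x) = ?i x" using H_inv_apply(1)[OF g H_mem[OF kH H_inv_mem[OF g Q(1)]]] by simp
  moreover have "(?i x, ?i y) \<in> \<alpha>" by (rule H_alpha[OF subgroup.m_inv_closed[OF H_subgroup g] xy])
  ultimately have "k (?i y) = ?i y" using k unfolding N_def by blast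
  then show "?c y = y" using conj_apply[OF g kH Q(2)] H_inv_apply(2)[OF g Q(2)] by simp
qed

lemma finite_G: "finite G"
  using finite_subset[OF _ finite_Bij[OF finite_Q]] G_H H_Bij by (metis subsetI)

lemma finite_K: "finite K"
  using finite_subset[OF _ finite_G] K_G by (metis subsetI)

lemma Q_nonempty: "Q \<noteq> {}"
  using alpha_intransitive by blast

text \<open>\<open>K\<close> is transitive on a block, so \<open>p\<close> divides its order, and its elements of order \<open>p\<close> lie in \<open>N\<close>.\<close>

lemma N_nontrivial: "\<exists>s \<in> N. s \<noteq> \<one>\<^bsub>B\<^esub>"
proof -
  obtain a where a: "a \<in> Q" using Q_nonempty by blast
  interpret K: group "B\<lparr>carrier := K\<rparr>" by (rule B.subgroup_imp_group[OF K_subgroup])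
  have act: "group_action (B\<lparr>carrier := K\<rparr>) Q id" by (rule permutation_group_action[OF K_subgroup])
  have orb: "orbit (B\<lparr>carrier := K\<rparr>) id a = cls a"
  proof
    show "orbit (B\<lparr>carrier := K\<rparr>) id a \<subseteq> cls a"
      using alpha_sym[OF K_alpha[OF _ a]] by (auto simp: orbit_def)
    show "cls a \<subseteq> orbit (B\<lparr>carrier := K\<rparr>) id a"
    proof
      fix x assume "x \<in> cls a"
      then have ax: "(a, x) \<in> \<alpha>" by simp
      obtain g where g: "g \<in> G" "g a = x" using G_transitive[OF a] alpha_sub[OF ax] by blast
      have "g \<in> K" by (rule K_if_fixes_block[OF g(1) a]) (simp add: g alpha_sym[OF ax])
      then show "x \<in> orbit (B\<lparr>carrier := K\<rparr>) id a" using g(2) by (auto simp: orbit_def)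
    qed
  qed
  have "p ^ m dvd order (B\<lparr>carrier := K\<rparr>)"
    using group_action.orbit_stabilizer_theorem[OF act a] orb card_block[OF cls_block[OF a]]
    by (metis dvd_triv_left)
  then have "p dvd order (B\<lparr>carrier := K\<rparr>)" using m_pos by (metis dvd_power dvd_trans less_le_trans zero_less_one)
  then obtain k where k: "k \<in> K" "k \<noteq> \<one>\<^bsub>B\<^esub>" "k [^]\<^bsub>B\<lparr>carrier := K\<rparr>\<^esub> p = \<one>\<^bsub>B\<^esub>"
    using K.prime_dvd_order_imp_element[of p] finite_K prime_p by auto
  have "k [^]\<^bsub>B\<^esub> p = \<one>\<^bsub>B\<^esub>" using k(3) by (simp add: B.nat_pow_consistent[symmetric])
  then have "k \<in> N" using p_element_N[OF k(1), of 1] by simp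
  then show ?thesis using k(2) by blast
qed

lemma N_transitive_on_blocks:
  assumes "(x, y) \<in> \<alpha>"
  shows "\<exists>s \<in> N. s x = y"
proof -
  obtain s where s: "s \<in> N" "s \<noteq> \<one>\<^bsub>B\<^esub>" using N_nontrivial by blast
  have "N \<subseteq> K" using N_K by blast
  from transitive_on_blocks[OF N_subgroup this N_normal s assms] show ?thesis .
qed

lemma G_carrier: "g \<in> G \<Longrightarrow> g \<in> carrier B" by (rule H_carrier[OF G_H])

lemma G_group: "group (B\<lparr>carrier := G\<rparr>)" by (rule B.subgroup_imp_group[OF G_subgroup])

text \<open>It suffices to treat \<open>g = L\<^sub>x\<close>: with \<open>s\<close> in \<open>N\<close> such that \<open>s x = k x\<close>, both \<open>k\<close> and \<open>s\<close> conjugate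
  \<open>L\<^sub>x\<close> to the same left translation, so the commutator of \<open>k\<close> equals that of \<open>s\<close>.\<close>

lemma commutator_N:
  assumes k: "k \<in> K" and g: "g \<in> G"
  shows "k \<otimes>\<^bsub>B\<^esub> g \<otimes>\<^bsub>B\<^esub> inv\<^bsub>B\<^esub> k \<otimes>\<^bsub>B\<^esub> inv\<^bsub>B\<^esub> g \<in> N"
proof -
  let ?com = "\<lambda>k g. k \<otimes>\<^bsub>B\<^esub> g \<otimes>\<^bsub>B\<^esub> inv\<^bsub>B\<^esub> k \<otimes>\<^bsub>B\<^esub> inv\<^bsub>B\<^esub> g"
  let ?S = "{g \<in> H. \<forall>k\<in>K. ?com k g \<in> N}"
  have SI: "g \<in> ?S" if "g \<in> H" "\<And>k. k \<in> K \<Longrightarrow> ?com k g \<in> N" for g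
    using that(1) by (intro CollectI conjI ballI that(2))
  have SD: "?com k g \<in> N" "g \<in> H" if "g \<in> ?S" "k \<in> K" for g k using that by auto
  have Kc: "k \<in> carrier B" if "k \<in> K" for k by (rule H_carrier[OF K_H[OF that]])
  have S: "subgroup ?S B"
  proof (rule B.subgroupI)
    show "?S \<subseteq> carrier B" using H_carrier by blast
    have "\<one>\<^bsub>B\<^esub> \<in> ?S"
      by (rule SI[OF subgroup.one_closed[OF H_subgroup]])
        (use Kc subgroup.one_closed[OF N_subgroup] in simp)
    then show "?S \<noteq> {}" by blast
  next
    fix g assume g: "g \<in> ?S"
    have gH: "g \<in> H" using g by blast
    have gi: "inv\<^bsub>B\<^esub> g \<in> H" by (rule subgroup.m_inv_closed[OF H_subgroup gH])
    show "inv\<^bsub>B\<^esub> g \<in> ?S"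
    proof (rule SI[OF gi])
      fix k assume k: "k \<in> K"
      have "inv\<^bsub>B\<^esub> (?com k g) \<in> N" by (rule subgroup.m_inv_closed[OF N_subgroup SD(1)[OF g k]])
      from N_normal[OF gi this] show "?com k (inv\<^bsub>B\<^esub> g) \<in> N"
        using Kc[OF k] H_carrier[OF gH] by (simp add: B.inv_mult_group B.m_assoc B.inv_mult_cancel)
    qed
  next
    fix g h assume g: "g \<in> ?S" and h: "h \<in> ?S"
    have H: "g \<in> H" "h \<in> H" using g h by auto
    show "g \<otimes>\<^bsub>B\<^esub> h \<in> ?S"
    proof (rule SI[OF subgroup.m_closed[OF H_subgroup H]])
      fix k assume k: "k \<in> K"
      from subgroup.m_closed[OF N_subgroup SD(1)[OF g k] N_normal[OF H(1) SD(1)[OF h k]]]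
      show "?com k (g \<otimes>\<^bsub>B\<^esub> h) \<in> N"
        using Kc[OF k] H_carrier[OF H(1)] H_carrier[OF H(2)]
        by (simp add: B.inv_mult_group B.m_assoc B.inv_mult_cancel)
    qed
  qed
  have LS: "L x \<in> ?S" if x: "x \<in> Q" for x
  proof (rule SI[OF L_H[OF x]])
    fix k assume k: "k \<in> K"
    obtain s where s: "s \<in> N" "s x = k x"
      using N_transitive_on_blocks[OF alpha_sym[OF K_alpha[OF k x]]] by blast
    have "k \<otimes>\<^bsub>B\<^esub> L x \<otimes>\<^bsub>B\<^esub> inv\<^bsub>B\<^esub> k = s \<otimes>\<^bsub>B\<^esub> L x \<otimes>\<^bsub>B\<^esub> inv\<^bsub>B\<^esub> s"
      using conj_L[OF H_aut[OF K_H[OF k]] x] conj_L[OF H_aut[OF K_H[OF N_K[OF s(1)]]] x] s(2) by simp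
    then have "?com k (L x) = s \<otimes>\<^bsub>B\<^esub> (L x \<otimes>\<^bsub>B\<^esub> inv\<^bsub>B\<^esub> s \<otimes>\<^bsub>B\<^esub> inv\<^bsub>B\<^esub> (L x))"
      using Kc[OF N_K[OF s(1)]] H_carrier[OF L_H[OF x]] by (simp add: B.m_assoc)
    then show "?com k (L x) \<in> N"
      using subgroup.m_closed[OF N_subgroup s(1) N_normal[OF L_H[OF x] subgroup.m_inv_closed[OF N_subgroup s(1)]]]
      by simp
  qed
  have "G \<subseteq> ?S"
  proof (rule G_subset_if_displacements[OF S])
    fix x y assume "x \<in> Q" "y \<in> Q"
    then show "displacement Q mul x y \<in> ?S"
      unfolding displacement_def' by (intro subgroup.m_closed[OF S] subgroup.m_inv_closed[OF S] LS)
  qed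
  then show ?thesis using SD(1) g k by blast
qed

section \<open>The derived subgroup\<close>

abbreviation "DG \<equiv> derived B G"

lemma derived_Dis: "derived (B\<lparr>carrier := G\<rparr>) G = DG"
  by (rule B.derived_consistent[OF subset_refl G_subgroup])

lemma DG_subgroup: "subgroup DG B"
  by (rule B.derived_is_subgroup[OF subgroup.subset[OF G_subgroup]])

lemma DG_K: "DG \<subseteq> K"
  unfolding derived_def
  by (rule B.generate_subgroup_incl[OF _ K_subgroup]) (use commutator_K in auto)

lemma DG_normal:
  assumes g: "g \<in> H" and d: "d \<in> DG"
  shows "g \<otimes>\<^bsub>B\<^esub> d \<otimes>\<^bsub>B\<^esub> inv\<^bsub>B\<^esub> g \<in> DG"
proof -
  let ?c = "\<lambda>h. g \<otimes>\<^bsub>B\<^esub> h \<otimes>\<^bsub>B\<^esub> inv\<^bsub>B\<^esub> g"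
  interpret c: group_hom B B ?c by unfold_locales (rule conj_hom[OF H_carrier[OF g]])
  have "?c ` G \<subseteq> G" using G_normal[OF g] by blast
  then have "derived B (?c ` G) \<subseteq> DG" by (rule B.mono_derived)
  moreover have "?c d \<in> derived B (?c ` G)"
    unfolding c.derived_img[OF subgroup.subset[OF G_subgroup]] using d by (rule imageI)
  ultimately show ?thesis by blast
qed

text \<open>A transitive commutative group has trivial point stabilizers, so the quandle would be abelian.\<close>

lemma not_commutative: "\<exists>g \<in> G. \<exists>h \<in> G. g \<otimes>\<^bsub>B\<^esub> h \<noteq> h \<otimes>\<^bsub>B\<^esub> g"
proof (rule ccontr)
  assume "\<not> ?thesis"
  then have com: "\<And>g h. g \<in> G \<Longrightarrow> h \<in> G \<Longrightarrow> g \<otimes>\<^bsub>B\<^esub> h = h \<otimes>\<^bsub>B\<^esub> g" by meson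
  interpret D: group "B\<lparr>carrier := G\<rparr>" by (rule G_group)
  have "comm_group (Dis Q mul)"
    unfolding Dis_def by (rule D.group_comm_groupI) (simp, rule com)
  moreover have "Dis_stab Q mul a = {\<one>\<^bsub>Dis Q mul\<^esub>}" if a: "a \<in> Q" for a
  proof
    show "{\<one>\<^bsub>Dis Q mul\<^esub>} \<subseteq> Dis_stab Q mul a"
      using subgroup.one_closed[OF G_subgroup] a
      by (simp add: Dis_stab_def stabilizer_def Dis_def Bij_one_apply)
    show "Dis_stab Q mul a \<subseteq> {\<one>\<^bsub>Dis Q mul\<^esub>}"
    proof
      fix g assume "g \<in> Dis_stab Q mul a"
      then have g: "g \<in> G" "g a = a" by (auto simp: Dis_stab_def stabilizer_def Dis_def)
      have "g = \<one>\<^bsub>B\<^esub>"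
      proof (rule Bij_eqI[OF H_Bij[OF G_H[OF g(1)]]])
        show "\<one>\<^bsub>B\<^esub> \<in> Bij Q" using B.one_closed by (simp add: carrier_BijGroup)
        fix x assume x: "x \<in> Q"
        from G_transitive[OF a x] obtain h where h: "h \<in> G" "h a = x" ..
        have "g (h a) = h (g a)"
          using com[OF g(1) h(1)] Bij_mult_apply[OF H_Bij[OF G_H[OF g(1)]] H_Bij[OF G_H[OF h(1)]] a]
            Bij_mult_apply[OF H_Bij[OF G_H[OF h(1)]] H_Bij[OF G_H[OF g(1)]] a] by simp
        then show "g x = \<one>\<^bsub>B\<^esub> x" using g(2) h(2) x by (simp add: Bij_one_apply)
      qed
      then show "g \<in> {\<one>\<^bsub>Dis Q mul\<^esub>}" by (simp add: Dis_def)
    qed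
  qed
  ultimately have "abelian_quandle Q mul" unfolding abelian_quandle_def using quandle_axioms by blast
  then show False using nonabelian by blast
qed

lemma DG_nontrivial: "\<exists>s \<in> DG. s \<noteq> \<one>\<^bsub>B\<^esub>"
proof -
  obtain g h where gh: "g \<in> G" "h \<in> G" "g \<otimes>\<^bsub>B\<^esub> h \<noteq> h \<otimes>\<^bsub>B\<^esub> g" using not_commutative by meson
  let ?s = "g \<otimes>\<^bsub>B\<^esub> h \<otimes>\<^bsub>B\<^esub> inv\<^bsub>B\<^esub> g \<otimes>\<^bsub>B\<^esub> inv\<^bsub>B\<^esub> h"
  have c: "g \<in> carrier B" "h \<in> carrier B" using G_carrier gh by auto
  have mem: "?s \<in> DG" unfolding derived_def using gh(1,2) by (intro generate.incl) auto
  have ne: "?s \<noteq> \<one>\<^bsub>B\<^esub>"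
  proof
    assume "?s = \<one>\<^bsub>B\<^esub>"
    then have "?s \<otimes>\<^bsub>B\<^esub> (h \<otimes>\<^bsub>B\<^esub> g) = h \<otimes>\<^bsub>B\<^esub> g" using c by simp
    then show False using gh(3) c by (simp add: B.m_assoc B.inv_mult_cancel)
  qed
  show ?thesis
  proof (rule bexI)
    show "?s \<noteq> \<one>\<^bsub>B\<^esub>" by (rule ne)
    show "?s \<in> DG" by (rule mem)
  qed
qed

text \<open>Let \<open>f\<close> be conjugation by \<open>L\<^sub>a\<close>. An element fixing \<open>a\<close> commutes with \<open>L\<^sub>a\<close>, so \<open>f\<close> fixes it, while
  the elements \<open>g f(g)\<inverse> = L\<^sub>x L\<^sub>a\<inverse>\<close> with \<open>x = g a\<close> generate \<open>G\<close>.\<close>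

lemma stab_derived:
  assumes a: "a \<in> Q" and c: "c \<in> G" "c a = a"
  shows "c \<in> DG"
proof -
  interpret D: group "B\<lparr>carrier := G\<rparr>" by (rule G_group)
  let ?D = "B\<lparr>carrier := G\<rparr>"
  let ?f = "\<lambda>g. L a \<otimes>\<^bsub>B\<^esub> g \<otimes>\<^bsub>B\<^esub> inv\<^bsub>B\<^esub> (L a)"
  have La: "L a \<in> H" by (rule L_H[OF a])
  have Lc: "L a \<in> carrier B" by (rule H_carrier[OF La])
  have f: "?f \<in> hom ?D ?D"
    using hom_mult[OF conj_hom[OF Lc]] G_carrier G_normal[OF La] by (auto intro!: homI)
  let ?S = "{g \<otimes>\<^bsub>B\<^esub> inv\<^bsub>B\<^esub> (?f g) | g. g \<in> G}"
  have fG: "?f g \<in> G" if "g \<in> G" for g by (rule G_normal[OF La that])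
  have SG: "?S \<subseteq> G" using subgroup.m_closed[OF G_subgroup] subgroup.m_inv_closed[OF G_subgroup fG] by auto
  have disp: "displacement Q mul x a \<in> ?S" if x: "x \<in> Q" for x
  proof -
    from G_transitive[OF a x] obtain g where g: "g \<in> G" "g a = x" ..
    have gc: "g \<in> carrier B" by (rule G_carrier[OF g(1)])
    have "displacement Q mul x a = (g \<otimes>\<^bsub>B\<^esub> L a \<otimes>\<^bsub>B\<^esub> inv\<^bsub>B\<^esub> g) \<otimes>\<^bsub>B\<^esub> inv\<^bsub>B\<^esub> (L a)"
      using conj_L[OF H_aut[OF G_H[OF g(1)]] a] g(2) by (simp add: displacement_def')
    also have "\<dots> = g \<otimes>\<^bsub>B\<^esub> inv\<^bsub>B\<^esub> (?f g)" using gc Lc by (simp add: B.inv_mult_group B.m_assoc)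
    finally show ?thesis using g(1) by blast
  qed
  have gS: "subgroup (generate B ?S) B" by (rule B.generate_is_subgroup) (use SG G_carrier in blast)
  have "displacement Q mul x y \<in> generate B ?S" if xy: "x \<in> Q" "y \<in> Q" for x y
  proof -
    have "displacement Q mul x y = displacement Q mul x a \<otimes>\<^bsub>B\<^esub> inv\<^bsub>B\<^esub> (displacement Q mul y a)"
      using H_carrier[OF L_H[OF xy(1)]] H_carrier[OF L_H[OF xy(2)]] Lc
      by (simp add: displacement_def' B.inv_mult_group B.m_assoc B.inv_mult_cancel)
    then show ?thesis
      using subgroup.m_closed[OF gS generate.incl[OF disp[OF xy(1)]] subgroup.m_inv_closed[OF gS generate.incl[OF disp[OF xy(2)]]]]
      by simp
  qed
  then have "G \<subseteq> generate B ?S" by (rule G_subset_if_displacements[OF gS])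
  moreover have "generate B ?S \<subseteq> G" by (rule B.generate_subgroup_incl[OF SG G_subgroup])
  ultimately have "generate B ?S = G" by blast
  then have "generate ?D ?S = G" using B.generate_consistent[OF SG G_subgroup] by simp
  moreover have "{g \<otimes>\<^bsub>?D\<^esub> inv\<^bsub>?D\<^esub> (?f g) | g. g \<in> carrier ?D} = ?S"
  proof -
    have "inv\<^bsub>?D\<^esub> (?f g) = inv\<^bsub>B\<^esub> (?f g)" if "g \<in> G" for g by (rule B.m_inv_consistent[OF G_subgroup fG[OF that]])
    then show ?thesis by auto metis
  qed
  ultimately have gen: "generate ?D {g \<otimes>\<^bsub>?D\<^esub> inv\<^bsub>?D\<^esub> (?f g) | g. g \<in> carrier ?D} = carrier ?D" by simp
  have cc: "c \<in> carrier B" by (rule G_carrier[OF c(1)])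
  have "c \<otimes>\<^bsub>B\<^esub> L a \<otimes>\<^bsub>B\<^esub> inv\<^bsub>B\<^esub> c = L a" using conj_L[OF H_aut[OF G_H[OF c(1)]] a] c(2) by simp
  then have "L a \<otimes>\<^bsub>B\<^esub> c = c \<otimes>\<^bsub>B\<^esub> L a" using cc Lc by (metis B.inv_solve_right B.m_closed)
  then have fc: "?f c = c" using cc Lc by (simp add: B.m_assoc)
  have "c \<in> derived ?D (carrier ?D)"
    by (rule D.fixed_points_in_derived[OF _ f gen _ fc]) (use finite_G c(1) in auto)
  then show ?thesis using derived_Dis by simp
qed

text \<open>Modulo \<open>N\<close>, all of \<open>K\<close> is central, and \<open>K\<close> contains the commutators and the \<open>p\<close>-th powers.\<close>

lemma derived_pow_N:
  assumes d: "d \<in> DG"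
  shows "d [^]\<^bsub>B\<^esub> p \<in> N"
proof -
  let ?D = "B\<lparr>carrier := G\<rparr>"
  interpret D: group ?D by (rule G_group)
  have NG: "N \<subseteq> G" using N_K K_G by blast
  have sN: "subgroup N ?D" by (rule B.subgroup_incl[OF N_subgroup G_subgroup NG])
  have nN: "N \<lhd> ?D"
    unfolding D.normal_inv_iff
    using sN N_normal G_H by (auto simp: B.m_inv_consistent[OF G_subgroup])
  interpret N: normal N ?D by (rule nN)
  let ?\<pi> = "\<lambda>x. N #>\<^bsub>?D\<^esub> x"
  interpret \<pi>: group_hom ?D "?D Mod N" ?\<pi>
    by (intro group_hom.intro group_hom_axioms.intro G_group N.factorgroup_is_group N.r_coset_hom_Mod)
  have central: "?\<pi> k \<in> group_center (?D Mod N)" if k: "k \<in> K" for k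
  proof (rule group_centerI)
    have kG: "k \<in> carrier ?D" using K_G[OF k] by simp
    then show "?\<pi> k \<in> carrier (?D Mod N)" by (rule \<pi>.hom_closed)
    fix X assume "X \<in> carrier (?D Mod N)"
    then obtain g where g: "g \<in> G" "X = ?\<pi> g" by (auto simp: FactGroup_def RCOSETS_def)
    have gD: "g \<in> carrier ?D" using g(1) by simp
    let ?com = "k \<otimes>\<^bsub>B\<^esub> g \<otimes>\<^bsub>B\<^esub> inv\<^bsub>B\<^esub> k \<otimes>\<^bsub>B\<^esub> inv\<^bsub>B\<^esub> g"
    have com: "?com \<in> N" by (rule commutator_N[OF k g(1)])
    have cD: "?com \<in> carrier ?D" using com NG by auto
    have gk: "g \<otimes>\<^bsub>?D\<^esub> k \<in> carrier ?D" by (rule D.m_closed[OF gD kG])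
    have "k \<otimes>\<^bsub>B\<^esub> g = ?com \<otimes>\<^bsub>B\<^esub> (g \<otimes>\<^bsub>B\<^esub> k)"
      using G_carrier[OF g(1)] G_carrier[OF K_G[OF k]] by (simp add: B.m_assoc B.inv_mult_cancel)
    then have "k \<otimes>\<^bsub>?D\<^esub> g = ?com \<otimes>\<^bsub>?D\<^esub> (g \<otimes>\<^bsub>?D\<^esub> k)" by simp
    then have "?\<pi> (k \<otimes>\<^bsub>?D\<^esub> g) = ?\<pi> ?com \<otimes>\<^bsub>?D Mod N\<^esub> ?\<pi> (g \<otimes>\<^bsub>?D\<^esub> k)"
      using \<pi>.hom_mult[OF cD gk] by (simp only:)
    also have "?\<pi> ?com = \<one>\<^bsub>?D Mod N\<^esub>" using D.coset_join2[OF cD sN com] by (simp add: FactGroup_def)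
    also have "\<one>\<^bsub>?D Mod N\<^esub> \<otimes>\<^bsub>?D Mod N\<^esub> ?\<pi> (g \<otimes>\<^bsub>?D\<^esub> k) = ?\<pi> (g \<otimes>\<^bsub>?D\<^esub> k)"
      by (rule \<pi>.H.l_one[OF \<pi>.hom_closed[OF gk]])
    finally show "?\<pi> k \<otimes>\<^bsub>?D Mod N\<^esub> X = X \<otimes>\<^bsub>?D Mod N\<^esub> ?\<pi> k"
      unfolding g(2) \<pi>.hom_mult[OF kG gD, symmetric] \<pi>.hom_mult[OF gD kG, symmetric] .
  qed
  have dG: "d \<in> carrier ?D" using d DG_K K_G by auto
  have "?\<pi> d [^]\<^bsub>?D Mod N\<^esub> p = \<one>\<^bsub>?D Mod N\<^esub>"
  proof (rule \<pi>.image_of_derived_exponent)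
    fix x y assume xy: "x \<in> carrier ?D" "y \<in> carrier ?D"
    have "x \<otimes>\<^bsub>B\<^esub> y \<otimes>\<^bsub>B\<^esub> inv\<^bsub>B\<^esub> x \<otimes>\<^bsub>B\<^esub> inv\<^bsub>B\<^esub> y \<in> K" by (rule commutator_K) (use xy in auto)
    from central[OF this]
    show "?\<pi> (x \<otimes>\<^bsub>?D\<^esub> y \<otimes>\<^bsub>?D\<^esub> inv\<^bsub>?D\<^esub> x \<otimes>\<^bsub>?D\<^esub> inv\<^bsub>?D\<^esub> y) \<in> group_center (?D Mod N)"
      using xy by (simp add: B.m_inv_consistent[OF G_subgroup])
  next
    fix x assume x: "x \<in> carrier ?D"
    have "x [^]\<^bsub>B\<^esub> p \<in> K" by (rule p_power_K) (use x in simp)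
    from central[OF this] show "?\<pi> (x [^]\<^bsub>?D\<^esub> p) \<in> group_center (?D Mod N)"
      by (simp add: B.nat_pow_consistent[symmetric])
  qed (use d derived_Dis in simp)
  then have "?\<pi> (d [^]\<^bsub>?D\<^esub> p) = \<one>\<^bsub>?D Mod N\<^esub>" using \<pi>.hom_nat_pow[OF dG, of p] by simp
  then have "?\<pi> (d [^]\<^bsub>?D\<^esub> p) = N" by (simp add: FactGroup_def)
  then have "d [^]\<^bsub>?D\<^esub> p \<in> N" by (rule D.coset_join1[OF _ D.nat_pow_closed[OF dG] sN])
  then show ?thesis by (simp add: B.nat_pow_consistent[symmetric])
qed

text \<open>An element of \<open>K\<close> moves \<open>a\<close> inside its block, so it differs by an element of \<open>S\<close> from one that
  fixes \<open>a\<close>.\<close>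

lemma K_eq_if_transitive_and_contains_stab:
  assumes S: "subgroup S B" "S \<subseteq> K" and a: "a \<in> Q"
    and trans: "\<And>x. (a, x) \<in> \<alpha> \<Longrightarrow> \<exists>s \<in> S. s a = x"
    and stab: "\<And>k. k \<in> K \<Longrightarrow> k a = a \<Longrightarrow> k \<in> S"
  shows "K = S"
proof
  show "K \<subseteq> S"
  proof
    fix k assume k: "k \<in> K"
    from trans[OF alpha_sym[OF K_alpha[OF k a]]] obtain s where s: "s \<in> S" "s a = k a" ..
    let ?c = "inv\<^bsub>B\<^esub> s \<otimes>\<^bsub>B\<^esub> k"
    have sK: "s \<in> K" using s(1) S(2) by blast
    have cK: "?c \<in> K" by (rule subgroup.m_closed[OF K_subgroup subgroup.m_inv_closed[OF K_subgroup sK] k])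
    have "?c a = (inv\<^bsub>B\<^esub> s) (k a)"
      by (rule Bij_mult_apply[OF Bij_inv_closed[OF H_Bij[OF K_H[OF sK]]] H_Bij[OF K_H[OF k]] a])
    also have "\<dots> = a" unfolding s(2)[symmetric] by (rule H_inv_apply(1)[OF K_H[OF sK] a])
    finally have "?c \<in> S" by (rule stab[OF cK])
    then have "s \<otimes>\<^bsub>B\<^esub> ?c \<in> S" by (rule subgroup.m_closed[OF S(1) s(1)])
    then show "k \<in> S" using H_carrier[OF K_H[OF sK]] H_carrier[OF K_H[OF k]] by (simp add: B.inv_mult_cancel)
  qed
qed (rule S(2))

text \<open>The elements of \<open>K\<close> fixing a point lie in the derived subgroup, so they are \<open>p\<close>-elements.\<close>

lemma K_eq_N: "K = N"
proof -
  obtain a where a: "a \<in> Q" using Q_nonempty by blast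
  show ?thesis
  proof (rule K_eq_if_transitive_and_contains_stab[OF N_subgroup _ a N_transitive_on_blocks])
    show "N \<subseteq> K" using N_K by blast
    fix k assume k: "k \<in> K" "k a = a"
    have "k [^]\<^bsub>B\<^esub> p \<in> N" by (rule derived_pow_N[OF stab_derived[OF a K_G[OF k(1)] k(2)]])
    then have "(k [^]\<^bsub>B\<^esub> p) [^]\<^bsub>B\<^esub> p = \<one>\<^bsub>B\<^esub>" by (rule N_pow)
    then have "k [^]\<^bsub>B\<^esub> (p ^ 2) = \<one>\<^bsub>B\<^esub>"
      using B.nat_pow_pow[OF H_carrier[OF K_H[OF k(1)]], of p p] by (simp add: power2_eq_square)
    then show "k \<in> N" by (rule p_element_N[OF k(1)])
  qed
qed

lemma stab_N: "a \<in> Q \<Longrightarrow> g \<in> G \<Longrightarrow> g a = a \<Longrightarrow> g \<in> N"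
  using K_if_fixes_block[of g a] alpha_refl[of a] K_eq_N by simp

lemma DG_eq_N: "DG = N"
proof -
  obtain a where a: "a \<in> Q" using Q_nonempty by blast
  obtain d where d: "d \<in> DG" "d \<noteq> \<one>\<^bsub>B\<^esub>" using DG_nontrivial by blast
  have "K = DG"
  proof (rule K_eq_if_transitive_and_contains_stab[OF DG_subgroup DG_K a])
    fix x assume ax: "(a, x) \<in> \<alpha>"
    from transitive_on_blocks[OF DG_subgroup DG_K DG_normal d ax] show "\<exists>s \<in> DG. s a = x" .
  next
    fix k assume "k \<in> K" "k a = a"
    then show "k \<in> DG" by (intro stab_derived[OF a] K_G)
  qed
  then show ?thesis using K_eq_N by simp
qed

lemma G_p_group: "\<exists>r. card G = p ^ r"
proof -
  let ?D = "B\<lparr>carrier := G\<rparr>"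
  interpret D: group ?D by (rule G_group)
  have "x [^]\<^bsub>?D\<^esub> (p ^ 2) = \<one>\<^bsub>?D\<^esub>" if x: "x \<in> carrier ?D" for x
  proof -
    have "x [^]\<^bsub>B\<^esub> p \<in> N" using p_power_K[of x] x K_eq_N by simp
    then have "(x [^]\<^bsub>B\<^esub> p) [^]\<^bsub>B\<^esub> p = \<one>\<^bsub>B\<^esub>" by (rule N_pow)
    then show ?thesis
      using B.nat_pow_pow[OF G_carrier, of x p p] x
      by (simp add: power2_eq_square B.nat_pow_consistent[symmetric])
  qed
  then show ?thesis using D.order_prime_power_if_exponent[OF _ prime_p, of 2] finite_G by (simp add: order_def)
qed


section \<open>The center of the displacement group\<close>

definition Z :: "('a \<Rightarrow> 'a) set" where "Z = group_center (B\<lparr>carrier := G\<rparr>)"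

lemma Z_G: "z \<in> Z \<Longrightarrow> z \<in> G"
  using group_centerD(1)[of z "B\<lparr>carrier := G\<rparr>"] by (simp add: Z_def)

lemma Z_comm: "z \<in> Z \<Longrightarrow> g \<in> G \<Longrightarrow> z \<otimes>\<^bsub>B\<^esub> g = g \<otimes>\<^bsub>B\<^esub> z"
  using group_centerD(2)[of z "B\<lparr>carrier := G\<rparr>" g] by (simp add: Z_def)

lemma Z_I: "z \<in> G \<Longrightarrow> (\<And>g. g \<in> G \<Longrightarrow> z \<otimes>\<^bsub>B\<^esub> g = g \<otimes>\<^bsub>B\<^esub> z) \<Longrightarrow> z \<in> Z"
  unfolding Z_def by (rule group_centerI) simp_all

lemma Z_subgroup: "subgroup Z B"
  unfolding Z_def by (rule B.incl_subgroup[OF G_subgroup group.group_center_subgroup[OF G_group]])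

lemma Z_normal:
  assumes g: "g \<in> H" and z: "z \<in> Z"
  shows "g \<otimes>\<^bsub>B\<^esub> z \<otimes>\<^bsub>B\<^esub> inv\<^bsub>B\<^esub> g \<in> Z"
proof (rule Z_I[OF G_normal[OF g Z_G[OF z]]])
  fix h assume h: "h \<in> G"
  have c: "g \<in> carrier B" "z \<in> carrier B" "h \<in> carrier B"
    using H_carrier[OF g] G_carrier[OF Z_G[OF z]] G_carrier[OF h] by auto
  let ?h = "inv\<^bsub>B\<^esub> g \<otimes>\<^bsub>B\<^esub> h \<otimes>\<^bsub>B\<^esub> g"
  have hG: "?h \<in> G" using G_normal[OF subgroup.m_inv_closed[OF H_subgroup g] h] c by simp
  have "g \<otimes>\<^bsub>B\<^esub> z \<otimes>\<^bsub>B\<^esub> inv\<^bsub>B\<^esub> g \<otimes>\<^bsub>B\<^esub> h = g \<otimes>\<^bsub>B\<^esub> (z \<otimes>\<^bsub>B\<^esub> ?h) \<otimes>\<^bsub>B\<^esub> inv\<^bsub>B\<^esub> g"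
    using c by (simp add: B.m_assoc)
  also have "z \<otimes>\<^bsub>B\<^esub> ?h = ?h \<otimes>\<^bsub>B\<^esub> z" by (rule Z_comm[OF z hG])
  also have "g \<otimes>\<^bsub>B\<^esub> (?h \<otimes>\<^bsub>B\<^esub> z) \<otimes>\<^bsub>B\<^esub> inv\<^bsub>B\<^esub> g = h \<otimes>\<^bsub>B\<^esub> (g \<otimes>\<^bsub>B\<^esub> z \<otimes>\<^bsub>B\<^esub> inv\<^bsub>B\<^esub> g)"
    using c by (simp add: B.m_assoc B.inv_mult_cancel)
  finally show "g \<otimes>\<^bsub>B\<^esub> z \<otimes>\<^bsub>B\<^esub> inv\<^bsub>B\<^esub> g \<otimes>\<^bsub>B\<^esub> h = h \<otimes>\<^bsub>B\<^esub> (g \<otimes>\<^bsub>B\<^esub> z \<otimes>\<^bsub>B\<^esub> inv\<^bsub>B\<^esub> g)" .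
qed

text \<open>A central element fixing one point fixes all points of its orbit.\<close>

lemma Z_fixed_point:
  assumes z: "z \<in> Z" and x: "x \<in> Q" "z x = x"
  shows "z = \<one>\<^bsub>B\<^esub>"
proof (rule Bij_eqI[OF H_Bij[OF G_H[OF Z_G[OF z]]]])
  show "\<one>\<^bsub>B\<^esub> \<in> Bij Q" using B.one_closed by (simp add: carrier_BijGroup)
  fix y assume y: "y \<in> Q"
  from G_transitive[OF x(1) y] obtain g where g: "g \<in> G" "g x = y" ..
  have Bij: "z \<in> Bij Q" "g \<in> Bij Q" using H_Bij[OF G_H] Z_G[OF z] g(1) by auto
  have "z (g x) = (g \<otimes>\<^bsub>B\<^esub> z) x"
    using Bij_mult_apply[OF Bij x(1)] Z_comm[OF z g(1)] by simp
  also have "\<dots> = g x" using Bij_mult_apply[OF Bij(2,1) x(1)] x(2) by simp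
  finally show "z y = \<one>\<^bsub>B\<^esub> y" using g(2) y by (simp add: Bij_one_apply)
qed

lemma Z_nontrivial: "\<exists>z \<in> Z. z \<noteq> \<one>\<^bsub>B\<^esub>"
proof -
  interpret D: group "B\<lparr>carrier := G\<rparr>" by (rule G_group)
  obtain r where r: "card G = p ^ r" using G_p_group ..
  have "r \<noteq> 0"
  proof
    assume "r = 0"
    then have "card G = 1" using r by simp
    then have "G = {\<one>\<^bsub>B\<^esub>}" using subgroup.one_closed[OF G_subgroup] by (metis card_1_singletonE singletonD)
    then show False using not_commutative by simp
  qed
  then show ?thesis
    using D.p_group_center_nontrivial[OF prime_p, of r] r by (simp add: order_def Z_def)
qed

text \<open>If the center is transitive, every \<open>g\<close> in \<open>G\<close> agrees with a central element at one point, hence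
  everywhere, and \<open>G\<close> is commutative.\<close>

lemma Z_intransitive: "\<exists>u \<in> Q. \<exists>v \<in> Q. \<forall>z \<in> Z. z u \<noteq> v"
proof (rule ccontr)
  assume "\<not> ?thesis"
  then have trans: "\<exists>z \<in> Z. z u = v" if "u \<in> Q" "v \<in> Q" for u v using that by meson
  obtain a where a: "a \<in> Q" using Q_nonempty by blast
  have GZ: "g \<in> Z" if g: "g \<in> G" for g
  proof -
    have gB: "g \<in> Bij Q" by (rule H_Bij[OF G_H[OF g]])
    from trans[OF a Bij_mem[OF gB a]] obtain z where z: "z \<in> Z" "z a = g a" ..
    have zB: "z \<in> Bij Q" by (rule H_Bij[OF G_H[OF Z_G[OF z(1)]]])
    have "g = z"
    proof (rule Bij_eqI[OF gB zB])
      fix x assume x: "x \<in> Q"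
      from trans[OF a x] obtain w where w: "w \<in> Z" "w a = x" ..
      have wB: "w \<in> Bij Q" by (rule H_Bij[OF G_H[OF Z_G[OF w(1)]]])
      have "g (w a) = (w \<otimes>\<^bsub>B\<^esub> g) a" using Bij_mult_apply[OF gB wB a] Z_comm[OF w(1) g] by simp
      also have "\<dots> = (w \<otimes>\<^bsub>B\<^esub> z) a" using Bij_mult_apply[OF wB gB a] Bij_mult_apply[OF wB zB a] z(2) by simp
      also have "\<dots> = z (w a)" using Bij_mult_apply[OF zB wB a] Z_comm[OF w(1) Z_G[OF z(1)]] by simp
      finally show "g x = z x" using w(2) by simp
    qed
    then show ?thesis using z(1) by simp
  qed
  obtain g h where "g \<in> G" "h \<in> G" "g \<otimes>\<^bsub>B\<^esub> h \<noteq> h \<otimes>\<^bsub>B\<^esub> g" using not_commutative by meson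
  then show False using Z_comm[OF GZ] by metis
qed

lemma Z_orbits: "x \<in> Q \<Longrightarrow> y \<in> Q \<Longrightarrow> (\<exists>z \<in> Z. z x = y) \<longleftrightarrow> (x, y) \<in> \<alpha>"
proof -
  obtain s where s: "s \<in> Z" "s \<noteq> \<one>\<^bsub>B\<^esub>" using Z_nontrivial by meson
  obtain u v where uv: "u \<in> Q" "v \<in> Q" "\<forall>z \<in> Z. z u \<noteq> v" using Z_intransitive by meson
  have ZH: "Z \<subseteq> H" using Z_G G_H by blast
  show "x \<in> Q \<Longrightarrow> y \<in> Q \<Longrightarrow> (\<exists>z \<in> Z. z x = y) \<longleftrightarrow> (x, y) \<in> \<alpha>"
    by (rule orbits_eq_alpha[OF Z_subgroup ZH Z_normal s uv])
qed

lemma Z_alpha: "z \<in> Z \<Longrightarrow> x \<in> Q \<Longrightarrow> (x, z x) \<in> \<alpha>"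
proof -
  assume z: "z \<in> Z" and x: "x \<in> Q"
  have "z x \<in> Q" by (rule H_mem[OF G_H[OF Z_G[OF z]] x])
  then show ?thesis using Z_orbits[OF x, of "z x"] z by auto
qed

lemma alpha_Z: "(x, y) \<in> \<alpha> \<Longrightarrow> \<exists>z \<in> Z. z x = y"
  using Z_orbits[of x y] alpha_sub[of x y] by simp

lemma Z_N: "z \<in> Z \<Longrightarrow> z \<in> N"
proof -
  assume z: "z \<in> Z"
  obtain a where a: "a \<in> Q" using Q_nonempty by blast
  show ?thesis using K_if_fixes_block[OF Z_G[OF z] a alpha_sym[OF Z_alpha[OF z a]]] K_eq_N by simp
qed

lemma Z_eqI:
  assumes z: "z \<in> Z" and w: "w \<in> Z" and x: "x \<in> Q" "z x = w x"
  shows "z = w"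
proof -
  have H: "z \<in> H" "w \<in> H" using G_H Z_G z w by auto
  have c: "z \<in> carrier B" "w \<in> carrier B" using H H_carrier by auto
  have "(inv\<^bsub>B\<^esub> w \<otimes>\<^bsub>B\<^esub> z) x = x"
    using Bij_mult_apply[OF Bij_inv_closed[OF H_Bij[OF H(2)]] H_Bij[OF H(1)] x(1)] x(2) H_inv_apply(1)[OF H(2) x(1)]
    by simp
  then have "inv\<^bsub>B\<^esub> w \<otimes>\<^bsub>B\<^esub> z = \<one>\<^bsub>B\<^esub>"
    by (rule Z_fixed_point[OF subgroup.m_closed[OF Z_subgroup subgroup.m_inv_closed[OF Z_subgroup w] z] x(1)])
  then have "w \<otimes>\<^bsub>B\<^esub> (inv\<^bsub>B\<^esub> w \<otimes>\<^bsub>B\<^esub> z) = w" using c by simp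
  then show ?thesis using c by (simp add: B.inv_mult_cancel)
qed

lemma card_Z: "card Z = p ^ m"
proof -
  obtain a where a: "a \<in> Q" using Q_nonempty by blast
  have "inj_on (\<lambda>z. z a) Z" by (rule inj_onI) (rule Z_eqI[OF _ _ a])
  moreover have "(\<lambda>z. z a) ` Z = cls a"
  proof
    show "(\<lambda>z. z a) ` Z \<subseteq> cls a" using Z_alpha[OF _ a] by auto
    show "cls a \<subseteq> (\<lambda>z. z a) ` Z"
    proof
      fix x assume "x \<in> cls a"
      then have "\<exists>z \<in> Z. z a = x" using alpha_Z by simp
      then show "x \<in> (\<lambda>z. z a) ` Z" by auto
    qed
  qed
  ultimately show ?thesis using card_image[of "\<lambda>z. z a" Z] card_block[OF cls_block[OF a]] by simp
qed

section \<open>The quandle is latin\<close>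

text \<open>Passing to the factor gives \<open>c = z b\<close> with \<open>z\<close> central. Then \<open>L\<^sub>c = z w L\<^sub>b\<close>, where \<open>w\<close> is the conjugate of
  \<open>z\<inverse>\<close> by \<open>L\<^sub>b\<close>, which is central too. The central element \<open>z w\<close> fixes \<open>b \<star> a\<close>, so it is trivial and
  \<open>L\<^sub>b = L\<^sub>c\<close>. But then \<open>L\<^sub>b\<close> fixes \<open>c\<close>, which lies in the block of \<open>b\<close>.\<close>

lemma right_mult_inj:
  assumes Q: "a \<in> Q" "b \<in> Q" "c \<in> Q" and eq: "b \<star> a = c \<star> a"
  shows "b = c"
proof -
  obtain z where z: "z \<in> Z" "z b = c" using alpha_Z[OF factor_right_cancel[OF Q(2,3,1) eq]] by meson
  have zH: "z \<in> H" by (rule G_H[OF Z_G[OF z(1)]])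
  have Lb: "L b \<in> H" by (rule L_H[OF Q(2)])
  let ?w = "L b \<otimes>\<^bsub>B\<^esub> inv\<^bsub>B\<^esub> z \<otimes>\<^bsub>B\<^esub> inv\<^bsub>B\<^esub> (L b)"
  have iz: "inv\<^bsub>B\<^esub> z \<in> Z" by (rule subgroup.m_inv_closed[OF Z_subgroup z(1)])
  have w: "?w \<in> Z" by (rule Z_normal[OF Lb iz])
  have zw: "z \<otimes>\<^bsub>B\<^esub> ?w \<in> Z" by (rule subgroup.m_closed[OF Z_subgroup z(1) w])
  have c: "z \<in> carrier B" "L b \<in> carrier B" using H_carrier zH Lb by auto
  have "L c = z \<otimes>\<^bsub>B\<^esub> L b \<otimes>\<^bsub>B\<^esub> inv\<^bsub>B\<^esub> z" using conj_L[OF H_aut[OF zH] Q(2)] z(2) by simp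
  also have "\<dots> = (z \<otimes>\<^bsub>B\<^esub> ?w) \<otimes>\<^bsub>B\<^esub> L b" using c by (simp add: B.m_assoc)
  finally have Lc: "L c = (z \<otimes>\<^bsub>B\<^esub> ?w) \<otimes>\<^bsub>B\<^esub> L b" .
  have ba: "b \<star> a \<in> Q" by (rule mul_closed[OF Q(2,1)])
  have "(z \<otimes>\<^bsub>B\<^esub> ?w) (b \<star> a) = L c a"
    unfolding Lc using Bij_mult_apply[OF H_Bij[OF G_H[OF Z_G[OF zw]]] H_Bij[OF Lb] Q(1)] Q(1) by (simp add: L_apply)
  then have "(z \<otimes>\<^bsub>B\<^esub> ?w) (b \<star> a) = b \<star> a" using eq Q(1) by (simp add: L_apply)
  then have "z \<otimes>\<^bsub>B\<^esub> ?w = \<one>\<^bsub>B\<^esub>" by (rule Z_fixed_point[OF zw ba])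
  then have "L c = L b" using Lc c by simp
  then have "b \<star> c = c" using L_apply[OF Q(3), of c] L_apply[OF Q(3), of b] idem[OF Q(3)] by simp
  moreover have "(b, c) \<in> \<alpha>" using Z_alpha[OF z(1) Q(2)] z(2) by simp
  ultimately show ?thesis by (rule block_not_projection[rotated])
qed

lemma latin: "latin_quandle Q mul"
  unfolding latin_quandle_def
proof (intro conjI ballI)
  show "quandle Q mul" by (rule quandle_axioms)
  fix a assume a: "a \<in> Q"
  have "inj_on (\<lambda>b. b \<star> a) Q" by (rule inj_onI) (rule right_mult_inj[OF a])
  moreover have "(\<lambda>b. b \<star> a) ` Q \<subseteq> Q" by (rule image_subsetI) (rule mul_closed[OF _ a])
  ultimately show "bij_betw (\<lambda>b. b \<star> a) Q Q" using endo_inj_surj[OF finite_Q] by (simp add: bij_betw_def)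
qed

lemma Dis_stab_eq: "Dis_stab Q mul a = {g \<in> G. g a = a}"
  by (auto simp: Dis_stab_def stabilizer_def Dis_def)

lemma displacement_Z:
  assumes x: "x \<in> Q" and z: "z \<in> Z"
  shows "displacement Q mul (z x) x \<in> Z"
proof -
  have zH: "z \<in> H" by (rule G_H[OF Z_G[OF z]])
  have c: "z \<in> carrier B" "L x \<in> carrier B" using H_carrier zH L_H[OF x] by auto
  have "displacement Q mul (z x) x = z \<otimes>\<^bsub>B\<^esub> (L x \<otimes>\<^bsub>B\<^esub> inv\<^bsub>B\<^esub> z \<otimes>\<^bsub>B\<^esub> inv\<^bsub>B\<^esub> (L x))"
    using conj_L[OF H_aut[OF zH] x, symmetric] c by (simp add: displacement_def' B.m_assoc)
  then show ?thesis
    using subgroup.m_closed[OF Z_subgroup z Z_normal[OF L_H[OF x] subgroup.m_inv_closed[OF Z_subgroup z]]] by simp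
qed

text \<open>Two points of a block differ by a central element, and conjugation by it fixes every stabilizer.\<close>

lemma stab_eq_if_alpha:
  assumes xy: "(x, y) \<in> \<alpha>"
  shows "{g \<in> G. g x = x} = {g \<in> G. g y = y}"
proof -
  have *: "g v = v" if g: "g \<in> G" "g u = u" and uv: "(u, v) \<in> \<alpha>" for g u v
  proof -
    obtain z where z: "z \<in> Z" "z u = v" using alpha_Z[OF uv] by meson
    have u: "u \<in> Q" using alpha_sub[OF uv] by blast
    have Bij: "z \<in> Bij Q" "g \<in> Bij Q" using H_Bij[OF G_H] Z_G[OF z(1)] g(1) by auto
    have "g (z u) = (z \<otimes>\<^bsub>B\<^esub> g) u" using Bij_mult_apply[OF Bij(2,1) u] Z_comm[OF z(1) g(1)] by simp
    also have "\<dots> = z u" using Bij_mult_apply[OF Bij u] g(2) by simp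
    finally show ?thesis using z(2) by simp
  qed
  show ?thesis using *[OF _ _ xy] *[OF _ _ alpha_sym[OF xy]] by blast
qed

text \<open>The map sending \<open>z\<close> to the displacement of \<open>(z a, a)\<close> goes from \<open>Z(G)\<close> to itself. It is injective
  because the quandle is latin, so every central element is a displacement along the center of \<open>Q\<close>.\<close>

lemma center_eq_Dis_zeta: "Z = Dis_rel Q mul (quandle_center Q mul)"
proof
  have center: "group_center (Dis Q mul) = Z" by (simp add: Z_def Dis_def)
  show "Dis_rel Q mul (quandle_center Q mul) \<subseteq> Z"
    unfolding Dis_rel_def
    by (rule B.generate_subgroup_incl[OF _ Z_subgroup]) (auto simp: quandle_center_def center)
  obtain a where a: "a \<in> Q" using Q_nonempty by blast
  have finZ: "finite Z" using finite_subset[OF _ finite_G] Z_G by (metis subsetI)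
  let ?f = "\<lambda>z. displacement Q mul (z a) a"
  have za: "z a \<in> Q" if "z \<in> Z" for z by (rule H_mem[OF G_H[OF Z_G[OF that]] a])
  have inj: "inj_on ?f Z"
  proof (rule inj_onI)
    fix z w assume z: "z \<in> Z" and w: "w \<in> Z" and eq: "?f z = ?f w"
    have c: "L (z a) \<in> carrier B" "L (w a) \<in> carrier B" "L a \<in> carrier B"
      using H_carrier L_H za[OF z] za[OF w] a by auto
    have "L (z a) = L (w a)" using eq c unfolding displacement_def' by simp
    then have "z a \<star> a = w a \<star> a" using L_apply[OF a, of "z a"] L_apply[OF a, of "w a"] by simp
    then have "z a = w a" by (rule right_mult_inj[OF a za[OF z] za[OF w]])
    then show "z = w" by (rule Z_eqI[OF z w a])
  qed
  have surj: "?f ` Z = Z" by (rule endo_inj_surj[OF finZ image_subsetI inj]) (rule displacement_Z[OF a])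
  show "Z \<subseteq> Dis_rel Q mul (quandle_center Q mul)"
  proof
    fix z assume "z \<in> Z"
    then have "z \<in> ?f ` Z" unfolding surj .
    then obtain w where w: "z = ?f w" "w \<in> Z" by (rule imageE)
    have "Dis_stab Q mul (w a) = Dis_stab Q mul a"
      unfolding Dis_stab_eq by (rule stab_eq_if_alpha[OF alpha_sym[OF Z_alpha[OF w(2) a]]])
    then have "(w a, a) \<in> quandle_center Q mul"
      using displacement_Z[OF a w(2)] za[OF w(2)] a by (simp add: quandle_center_def center)
    then show "z \<in> Dis_rel Q mul (quandle_center Q mul)"
      unfolding Dis_rel_def w(1) by (intro generate.incl) blast
  qed
qed

section \<open>The structure of the derived subgroup\<close>

text \<open>Subgroups of \<open>N\<close> inherit commutativity and exponent \<open>p\<close>.\<close>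

lemma elementary_abelian_subgroup:
  assumes S: "subgroup S B" "S \<subseteq> N"
  shows "\<exists>k. card S = p ^ k \<and> B\<lparr>carrier := S\<rparr> \<cong> Zmod_power p k"
proof -
  interpret S: group "B\<lparr>carrier := S\<rparr>" by (rule B.subgroup_imp_group[OF S(1)])
  have SN: "s \<in> N" if "s \<in> S" for s using S(2) that by blast
  interpret S: comm_group "B\<lparr>carrier := S\<rparr>"
    by (rule S.group_comm_groupI) (simp, rule N_comm[OF SN SN])
  have "S \<subseteq> G" using S(2) N_K K_G by blast
  then have "finite S" using finite_G finite_subset by blast
  then show ?thesis
    using S.elementary_abelian_iso_Zmod_power[OF _ prime_p] N_pow[OF SN]
    by (simp add: order_def B.nat_pow_consistent[symmetric])
qed

lemma Z_iso: "B\<lparr>carrier := Z\<rparr> \<cong> Zmod_power p m"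
proof -
  obtain k where k: "card Z = p ^ k" "B\<lparr>carrier := Z\<rparr> \<cong> Zmod_power p k"
    using elementary_abelian_subgroup[OF Z_subgroup] Z_N by blast
  then have "k = m" using card_Z prime_gt_1_nat[OF prime_p] by (simp add: power_inject_exp)
  then show ?thesis using k(2) by simp
qed

lemma stab_subgroup: "a \<in> Q \<Longrightarrow> subgroup {g \<in> G. g a = a} B"
  using group_action.stabilizer_subgroup[OF permutation_group_action[OF G_subgroup], of a]
    B.incl_subgroup[OF G_subgroup] by (simp add: stabilizer_def)

text \<open>The center and the stabilizer of \<open>a\<close> meet trivially, and the center is transitive on the block of \<open>a\<close>.\<close>

lemma N_iso:
  assumes a: "a \<in> Q"
  shows "B\<lparr>carrier := Z\<rparr> \<times>\<times> B\<lparr>carrier := {g \<in> G. g a = a}\<rparr> \<cong> B\<lparr>carrier := N\<rparr>"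
proof (rule is_isoI, rule isoI)
  let ?St = "{g \<in> G. g a = a}"
  let ?P = "B\<lparr>carrier := Z\<rparr> \<times>\<times> B\<lparr>carrier := ?St\<rparr>"
  let ?h = "\<lambda>(z, g). z \<otimes>\<^bsub>B\<^esub> g"
  have StN: "g \<in> N" if "g \<in> ?St" for g using stab_N[OF a] that by blast
  have Nc: "g \<in> carrier B" if "g \<in> N" for g by (rule H_carrier[OF K_H[OF N_K[OF that]]])
  have NB: "g \<in> Bij Q" if "g \<in> N" for g by (rule H_Bij[OF K_H[OF N_K[OF that]]])
  show "?h \<in> hom ?P (B\<lparr>carrier := N\<rparr>)"
  proof (rule homI)
    fix u assume "u \<in> carrier ?P"
    then obtain z g where u: "u = (z, g)" "z \<in> Z" "g \<in> ?St" by auto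
    then show "?h u \<in> carrier (B\<lparr>carrier := N\<rparr>)"
      using subgroup.m_closed[OF N_subgroup Z_N[OF u(2)] StN[OF u(3)]] by simp
  next
    fix u v assume "u \<in> carrier ?P" "v \<in> carrier ?P"
    then obtain z g w h where u: "u = (z, g)" "z \<in> Z" "g \<in> ?St" and v: "v = (w, h)" "w \<in> Z" "h \<in> ?St" by auto
    have c: "z \<in> carrier B" "g \<in> carrier B" "w \<in> carrier B" "h \<in> carrier B"
      using Nc Z_N StN u v by auto
    have "w \<otimes>\<^bsub>B\<^esub> g = g \<otimes>\<^bsub>B\<^esub> w" by (rule N_comm[OF Z_N[OF v(2)] StN[OF u(3)]])
    then have "z \<otimes>\<^bsub>B\<^esub> w \<otimes>\<^bsub>B\<^esub> (g \<otimes>\<^bsub>B\<^esub> h) = z \<otimes>\<^bsub>B\<^esub> g \<otimes>\<^bsub>B\<^esub> (w \<otimes>\<^bsub>B\<^esub> h)"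
      using c by (metis B.m_assoc B.m_closed)
    then show "?h (u \<otimes>\<^bsub>?P\<^esub> v) = ?h u \<otimes>\<^bsub>B\<lparr>carrier := N\<rparr>\<^esub> ?h v" using u(1) v(1) by simp
  qed
  show "bij_betw ?h (carrier ?P) (carrier (B\<lparr>carrier := N\<rparr>))"
  proof (rule bij_betw_imageI)
    show "inj_on ?h (carrier ?P)"
    proof (rule inj_onI)
      fix u v assume "u \<in> carrier ?P" "v \<in> carrier ?P" and eq: "?h u = ?h v"
      then obtain z g w h where u: "u = (z, g)" "z \<in> Z" "g \<in> ?St" and v: "v = (w, h)" "w \<in> Z" "h \<in> ?St" by auto
      have c: "z \<in> carrier B" "g \<in> carrier B" "w \<in> carrier B" "h \<in> carrier B"
        using Nc Z_N StN u v by auto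
      have eq': "z \<otimes>\<^bsub>B\<^esub> g = w \<otimes>\<^bsub>B\<^esub> h" using eq u(1) v(1) by simp
      have "(z \<otimes>\<^bsub>B\<^esub> g) a = z a" using Bij_mult_apply[OF NB[OF Z_N[OF u(2)]] NB[OF StN[OF u(3)]] a] u(3) by simp
      moreover have "(w \<otimes>\<^bsub>B\<^esub> h) a = w a" using Bij_mult_apply[OF NB[OF Z_N[OF v(2)]] NB[OF StN[OF v(3)]] a] v(3) by simp
      ultimately have zw: "z = w" using eq' by (intro Z_eqI[OF u(2) v(2) a]) simp
      then have "g = h" using eq' c by simp
      then show "u = v" using u(1) v(1) zw by simp
    qed
    show "?h ` carrier ?P = carrier (B\<lparr>carrier := N\<rparr>)"
    proof
      show "?h ` carrier ?P \<subseteq> carrier (B\<lparr>carrier := N\<rparr>)"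
        using subgroup.m_closed[OF N_subgroup Z_N StN] by auto
      show "carrier (B\<lparr>carrier := N\<rparr>) \<subseteq> ?h ` carrier ?P"
      proof
        fix k assume "k \<in> carrier (B\<lparr>carrier := N\<rparr>)"
        then have k: "k \<in> N" by simp
        obtain z where z: "z \<in> Z" "z a = k a"
          using alpha_Z[OF alpha_sym[OF K_alpha[OF N_K[OF k] a]]] by meson
        let ?g = "inv\<^bsub>B\<^esub> z \<otimes>\<^bsub>B\<^esub> k"
        have zH: "z \<in> H" by (rule G_H[OF Z_G[OF z(1)]])
        have "?g a = (inv\<^bsub>B\<^esub> z) (z a)"
          unfolding z(2) by (rule Bij_mult_apply[OF Bij_inv_closed[OF H_Bij[OF zH]] NB[OF k] a])
        then have "?g a = a" using H_inv_apply(1)[OF zH a] by simp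
        moreover have "?g \<in> G"
          by (rule subgroup.m_closed[OF G_subgroup subgroup.m_inv_closed[OF G_subgroup Z_G[OF z(1)]] K_G[OF N_K[OF k]]])
        ultimately have g: "?g \<in> ?St" by simp
        have hk: "k = ?h (z, ?g)" using H_carrier[OF zH] Nc[OF k] by (simp add: B.inv_mult_cancel)
        have mem: "(z, ?g) \<in> carrier ?P" using z(1) g by simp
        show "k \<in> ?h ` carrier ?P" by (rule image_eqI) (rule hk, rule mem)
      qed
    qed
  qed
qed

section \<open>The Frattini subgroup\<close>

text \<open>\<open>G\<close> is a \<open>p\<close>-group with derived subgroup \<open>N\<close>, and \<open>G/N\<close> has exponent dividing \<open>p\<close>.\<close>

lemma frattini_eq_N: "frattini (B\<lparr>carrier := G\<rparr>) = N"
proof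
  let ?D = "B\<lparr>carrier := G\<rparr>"
  interpret D: group ?D by (rule G_group)
  have NG: "N \<subseteq> G" using N_K K_G by blast
  have der: "derived ?D (carrier ?D) = N" using derived_Dis DG_eq_N by simp
  obtain r where r: "order ?D = p ^ r" using G_p_group by (auto simp: order_def)
  show "frattini ?D \<subseteq> N"
  proof (rule D.frattini_subset_if_elementary_abelian_quotient)
    show "subgroup N ?D" by (rule B.subgroup_incl[OF N_subgroup G_subgroup NG])
    show "x [^]\<^bsub>?D\<^esub> p \<in> N" if "x \<in> carrier ?D" for x
      using p_power_K[of x] that K_eq_N by (simp add: B.nat_pow_consistent[symmetric])
  qed (use finite_G prime_p der in auto)
  have "N \<subseteq> M" if "maximal_subgroup M ?D" for M
    using D.derived_subset_maximal_subgroup_of_p_group[OF prime_p r that] unfolding der .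
  then show "N \<subseteq> frattini ?D" using NG unfolding frattini_def by auto
qed

lemma index_N: "card G = p ^ n * card N"
proof -
  obtain a where a: "a \<in> Q" using Q_nonempty by blast
  have GH: "G \<subseteq> H" using G_H by blast
  have act: "group_action (B\<lparr>carrier := G\<rparr>) (Q // \<alpha>) factor_map"
    using group_action.induced_action[OF factor_action B.subgroup_incl[OF G_subgroup H_subgroup GH]] by simp
  have "orbit (B\<lparr>carrier := G\<rparr>) factor_map (cls a) = Q // \<alpha>"
  proof
    show "orbit (B\<lparr>carrier := G\<rparr>) factor_map (cls a) \<subseteq> Q // \<alpha>"
      using factor_map_cls[OF G_H a] cls_block[OF H_mem[OF G_H a]] by (auto simp: orbit_def)
    show "Q // \<alpha> \<subseteq> orbit (B\<lparr>carrier := G\<rparr>) factor_map (cls a)"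
    proof
      fix X assume "X \<in> Q // \<alpha>"
      then obtain x where x: "x \<in> Q" "X = cls x" by (rule blockE)
      from G_transitive[OF a x(1)] obtain g where g: "g \<in> G" "g a = x" ..
      then have "factor_map g (cls a) = X" using factor_map_cls[OF G_H[OF g(1)] a] x(2) by simp
      then show "X \<in> orbit (B\<lparr>carrier := G\<rparr>) factor_map (cls a)" using g(1) by (auto simp: orbit_def)
    qed
  qed
  moreover have "stabilizer (B\<lparr>carrier := G\<rparr>) factor_map (cls a) = N"
  proof -
    have "factor_map g (cls a) = cls a \<longleftrightarrow> g \<in> K" if g: "g \<in> G" for g
    proof -
      have "factor_map g (cls a) = cls a \<longleftrightarrow> (g a, a) \<in> \<alpha>"
        using factor_map_cls[OF G_H[OF g] a] cls_eq_iff[OF H_mem[OF G_H[OF g] a] a] by simp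
      then show ?thesis using K_if_fixes_block[OF g a] K_alpha[of g a] a by blast
    qed
    then have "stabilizer (B\<lparr>carrier := G\<rparr>) factor_map (cls a) = {g \<in> G. g \<in> K}"
      unfolding stabilizer_def by (intro Collect_cong) auto
    then show ?thesis using K_eq_N K_G by auto
  qed
  ultimately show ?thesis
    using group_action.orbit_stabilizer_theorem[OF act cls_block[OF a]] card_factor by (simp add: order_def)
qed

text \<open>If \<open>n = 1\<close>, then \<open>N\<close> has index \<open>p\<close>. As it is the Frattini subgroup, it is the only maximal subgroup,
  and an element outside it generates \<open>G\<close>.\<close>

lemma n_ge_2: "n \<ge> 2"
proof (rule ccontr)
  assume "\<not> ?thesis"
  then have n1: "n = 1" using n_pos by simp
  let ?D = "B\<lparr>carrier := G\<rparr>"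
  interpret D: group ?D by (rule G_group)
  have NG: "N \<subseteq> G" using N_K K_G by blast
  have finN: "finite N" using finite_subset[OF NG finite_G] .
  have cN: "card N > 0" using finN subgroup.one_closed[OF N_subgroup] by (metis card_gt_0_iff empty_iff)
  have max_eq_N: "M = N" if max: "maximal_subgroup M ?D" for M
  proof -
    have M: "subgroup M ?D" "M \<noteq> G" using max unfolding maximal_subgroup_def by auto
    have MG: "M \<subseteq> G" using subgroup.subset[OF M(1)] by simp
    have NM: "N \<subseteq> M" using max frattini_eq_N unfolding frattini_def by blast
    have finM: "finite M" using finite_subset[OF MG finite_G] .
    have MB: "subgroup M B" by (rule B.incl_subgroup[OF G_subgroup M(1)])
    interpret M: group "B\<lparr>carrier := M\<rparr>" by (rule B.subgroup_imp_group[OF MB])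
    have "subgroup N (B\<lparr>carrier := M\<rparr>)" by (rule B.subgroup_incl[OF N_subgroup MB NM])
    from M.lagrange[OF this] have "card (rcosets\<^bsub>B\<lparr>carrier := M\<rparr>\<^esub> N) * card N = card M" by (simp add: order_def)
    then obtain d where d: "card M = d * card N" by metis
    from D.lagrange[OF M(1)] have "card (rcosets\<^bsub>?D\<^esub> M) * card M = card G" by (simp add: order_def)
    then obtain e where e: "card G = e * card M" by metis
    have "card N * (e * d) = e * (d * card N)" by simp
    also have "\<dots> = card G" by (simp only: d[symmetric] e[symmetric])
    also have "\<dots> = card N * p" unfolding index_N n1 by simp
    finally have "card N * (e * d) = card N * p" .
    then have ed: "e * d = p" using cN by (simp only: mult_cancel1) simp
    then have "e dvd p" by (metis dvd_triv_left)
    then have "e = 1 \<or> e = p" using prime_p by (simp add: prime_nat_iff)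
    moreover have "d = 1" if "e = p" using ed that prime_gt_0_nat[OF prime_p] by simp
    ultimately have "e = 1 \<or> d = 1" by (elim disjE) simp_all
    then show "M = N"
    proof
      assume "e = 1"
      then have "M = G" using e card_subset_eq[OF finite_G MG] by simp
      then show ?thesis using M(2) by simp
    next
      assume "d = 1"
      then show ?thesis using d card_subset_eq[OF finM NM] by simp
    qed
  qed
  have "N \<noteq> G" using index_N n1 cN prime_gt_1_nat[OF prime_p] by auto
  then obtain x where x: "x \<in> G" "x \<notin> N" using NG by blast
  let ?C = "generate ?D {x}"
  have C: "subgroup ?C ?D" by (rule D.generate_is_subgroup) (use x in simp)
  have xC: "x \<in> ?C" by (rule generate.incl) simp
  have "?C = G"
  proof (rule ccontr)
    assume ne: "?C \<noteq> G"
    let ?S = "{M. subgroup M ?D \<and> ?C \<subseteq> M \<and> M \<noteq> G}"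
    have "?S \<subseteq> Pow G" using subgroup.subset by fastforce
    then have "finite ?S" using finite_G by (meson finite_Pow_iff finite_subset)
    moreover have "?C \<in> ?S" using C ne by simp
    ultimately obtain M where M: "M \<in> ?S" "\<And>M'. M' \<in> ?S \<Longrightarrow> M \<subseteq> M' \<Longrightarrow> M = M'"
      using finite_has_maximal2[of ?S ?C] by auto
    have "maximal_subgroup M ?D"
      unfolding maximal_subgroup_def
    proof (intro conjI allI impI)
      show "subgroup M ?D" "M \<noteq> carrier ?D" using M(1) by auto
      fix M' assume M': "subgroup M' ?D \<and> M \<subseteq> M'"
      show "M' = M \<or> M' = carrier ?D"
      proof (cases "M' = G")
        case False
        then have "M' \<in> ?S" using M' M(1) by blast
        then show ?thesis using M(2)[of M'] M' by simp
      qed simp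
    qed
    then have "M = N" by (rule max_eq_N)
    then show False using M(1) xC x(2) by blast
  qed
  then have pow: "\<exists>i::int. g = x [^]\<^bsub>?D\<^esub> i" if "g \<in> G" for g
    using that D.generate_pow[of x] x(1) by auto
  obtain g h where gh: "g \<in> G" "h \<in> G" "g \<otimes>\<^bsub>B\<^esub> h \<noteq> h \<otimes>\<^bsub>B\<^esub> g" using not_commutative by meson
  from pow[OF gh(1)] obtain i :: int where i: "g = x [^]\<^bsub>?D\<^esub> i" ..
  from pow[OF gh(2)] obtain j :: int where j: "h = x [^]\<^bsub>?D\<^esub> j" ..
  have "g \<otimes>\<^bsub>?D\<^esub> h = h \<otimes>\<^bsub>?D\<^esub> g"
    unfolding i j using D.int_pow_mult[of x i j] D.int_pow_mult[of x j i] x(1) by (simp add: add.commute)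
  then show False using gh(3) by simp
qed

end

theorem theorem3p9:
  fixes p m n :: nat and Q :: "'a set" and mul :: "'a \<Rightarrow> 'a \<Rightarrow> 'a" and a :: 'a
    and G :: "('a \<Rightarrow> 'a) monoid"
  assumes "Factorial_Ring.prime p" and "m \<ge> 1" and "n \<ge> 1" and "p ^ m > 2"
    and "LSS (p ^ m) (p ^ n) (sigma_rel Q mul) Q mul"
    and "G = Dis Q mul" and "a \<in> Q"
  shows "latin_quandle Q mul \<and>
    group_center G = Dis_rel Q mul (quandle_center Q mul) \<and>
    G\<lparr>carrier := group_center G\<rparr> \<cong> Zmod_power p m \<and>
    frattini G = derived G (carrier G) \<and>
    (\<exists>k::nat.
      G\<lparr>carrier := derived G (carrier G)\<rparr> \<cong>
        G\<lparr>carrier := group_center G\<rparr> \<times>\<times> G\<lparr>carrier := Dis_stab Q mul a\<rparr> \<and>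
      G\<lparr>carrier := group_center G\<rparr> \<times>\<times> G\<lparr>carrier := Dis_stab Q mul a\<rparr> \<cong>
        Zmod_power p (m + k)) \<and>
    n \<ge> 2"
proof -
  from assms(5) obtain \<alpha> where \<alpha>:
    "{\<beta>. quandle_congruence Q mul \<beta> \<and> \<beta> \<noteq> Id_on Q \<and> \<beta> \<noteq> Q \<times> Q} = {\<alpha>}"
    "card (Q // \<alpha>) = p ^ n" "\<forall>C \<in> Q // \<alpha>. card C = p ^ m"
    unfolding LSS_def by (elim conjE exE)
  have lss: "finite Q" "connected_quandle Q mul" "\<not> abelian_quandle Q mul" "locally_strictly_simple Q mul"
    using assms(5) unfolding LSS_def by simp_all
  have quandle: "quandle Q mul" and trans: "transitive_action (Dis Q mul) Q id"
    using lss(2) unfolding connected_quandle_def by auto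
  interpret quandle Q mul by (rule quandle)
  interpret lss_p_quandle Q mul \<alpha> p m n
  proof (rule lss_p_quandle.intro[OF quandle], rule lss_p_quandle_axioms.intro)
    show "card C = p ^ m" if "C \<in> Q // \<alpha>" for C using \<alpha>(3) that by (rule bspec)
  qed (rule lss trans \<alpha> assms)+
  let ?St = "{g \<in> Dis_rel Q mul (Q \<times> Q). g a = a}"
  let ?P = "B\<lparr>carrier := Z\<rparr> \<times>\<times> B\<lparr>carrier := ?St\<rparr>"
  have GD: "G = B\<lparr>carrier := Dis_rel Q mul (Q \<times> Q)\<rparr>" using assms(6) by (simp add: Dis_def)
  have center: "group_center G = Z" by (simp add: GD Z_def)
  have der: "derived G (carrier G) = N" using derived_Dis DG_eq_N by (simp add: GD)
  have sZ: "subgroup Z B" and sSt: "subgroup ?St B" by (rule Z_subgroup, rule stab_subgroup[OF assms(7)])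
  have gP: "group ?P" by (intro DirProd_group B.subgroup_imp_group sZ sSt)
  have PN: "?P \<cong> B\<lparr>carrier := N\<rparr>" by (rule N_iso[OF assms(7)])
  have NP: "B\<lparr>carrier := N\<rparr> \<cong> ?P" by (rule group.iso_sym[OF gP PN])
  obtain j where j: "card N = p ^ j" "B\<lparr>carrier := N\<rparr> \<cong> Zmod_power p j"
    using elementary_abelian_subgroup[OF N_subgroup subset_refl] by blast
  have StN: "?St \<subseteq> N" using stab_N[OF assms(7)] by blast
  obtain k where k: "card ?St = p ^ k" using elementary_abelian_subgroup[OF sSt StN] by blast
  have "p ^ j = p ^ (m + k)"
    using iso_same_card[OF PN] j(1) k card_Z by (simp add: power_add card_cartesian_product)
  then have jk: "j = m + k" using prime_gt_1_nat[OF prime_p] by (simp add: power_inject_exp)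
  have PZ: "?P \<cong> Zmod_power p (m + k)" using iso_trans[OF PN j(2)] jk by simp
  have rec: "G\<lparr>carrier := S\<rparr> = B\<lparr>carrier := S\<rparr>" for S by (simp add: GD)
  show ?thesis
    unfolding rec center der Dis_stab_eq
  proof (intro conjI)
    show "frattini G = N" unfolding GD by (rule frattini_eq_N)
    show "\<exists>k. B\<lparr>carrier := N\<rparr> \<cong> ?P \<and> ?P \<cong> Zmod_power p (m + k)"
      by (rule exI[of _ k]) (rule conjI[OF NP PZ])
  qed (rule latin center_eq_Dis_zeta Z_iso n_ge_2)+
qed

end
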